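(* Let $B,\Omega,K,\Psi,\boldsymbol\lambda,\boldsymbol\tau,\boldsymbol\zeta,\mathcal{S},\mathcal{C},\mathcal{H},\mathcal{M},A$ be as in the context, and let $(\boldsymbol\kappa_n)$ be vectors of nonnegative integers with $\boldsymbol\kappa_n=\boldsymbol\lambda n+O(1)$. Then for every $r\ge1$ there exist coefficients $a_{k,n}$ ($0\le k\le r-1$), each a function of $\boldsymbol\kappa_n-\boldsymbol\lambda n$ (hence bounded in $n$), such that \[ [\mathbf{z}^{\boldsymbol\kappa_n}]\frac{A(\mathbf{z})B(\mathbf{z})^n}{\prod_{j=1}^d(1-z_j)}=\frac{B(\boldsymbol\zeta)^n}{\boldsymbol\zeta^{\boldsymbol\kappa_n}}\cdot\frac{1}{n^{|\mathcal{S}|/2}}\left(\sum_{k=0}^{r-1}a_{k,n}n^{-k/2}+O(n^{-r/2})\right). \] Moreover $a_{0,n}=a_0$ does not depend on $n$ and \[ a_0=\frac{A(\boldsymbol\zeta)}{\prod_{j\in\mathcal{S}}(1-\zeta_j)}\cdot\frac{1}{\sqrt{(2\pi)^d\det(\mathcal{H})}}\int_{(0,+\infty)^{|\mathcal{C}|}}e^{-\mathbf{u}^T\mathcal{M}\mathbf{u}/2}\,d\mathbf{u}, \] and if $\mathcal{C}=\emptyset$ then $a_{k,n}=0$ for every odd $k$.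
   Context: $B(z_1,\dots,z_d)$ is a power series with nonnegative coefficients, of full rank (the real span of $\{\mathbf{n}-\mathbf{m}:\mathbf{n},\mathbf{m}\in S_B\}$ has dimension $d$, where $S_B=\{\mathbf{n}:[\mathbf{z}^{\mathbf{n}}]B\neq0\}$), aperiodic (there is no $q\ge2$, nonnegative integers $p_1,\dots,p_d$ not all divisible by $q$, and integer $r$ with $\{\mathbf{p}^T\mathbf{n}:\mathbf{n}\in S_B\}\subseteq r+q\mathbb{Z}_{\ge0}$), convergent on a neighborhood $\Omega$ of $\mathbf{0}$. $K(\mathbf{t})=\log B(e^{t_1},\dots,e^{t_d})$, $\Psi=\{\mathbf{t}\in\mathbb{R}^d:e^{\mathbf{t}}\in\Omega\}$. $\boldsymbol\lambda$ is a vector of positive reals such that $K(\mathbf{t})-\boldsymbol\lambda^T\mathbf{t}$ does not tend to its infimum on the boundary of $\Psi$; $\boldsymbol\tau$ is the unique point of $\Psi$ where it is minimal and $\boldsymbol\zeta=e^{\boldsymbol\tau}$. It is assumed $\zeta_j\le1$ for all $j$; $\mathcal{S}=\{j:\zeta_j<1\}$, $\mathcal{C}=\{j:\zeta_j=1\}$. $\mathcal{H}$ is the Hessian of $K$ at $\boldsymbol\tau$ and $\mathcal{M}$ the submatrix of $\mathcal{H}^{-1}$ with rows and columns in $\mathcal{C}$. $A(\mathbf{z})$ is a power series analytic on the torus $\{|z_j|=\zeta_j\}$ with $A(\boldsymbol\zeta)\neq0$. Notation $\boldsymbol\zeta^{\boldsymbol\kappa}=\prod_j\zeta_j^{\kappa_j}$;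 empty integral equals $1$. *)

theory Defs
  imports "HOL-Analysis.Analysis" "HOL-Library.Landau_Symbols"
begin

text \<open>Multivariate power series over the finite index type 'd are represented by their
  coefficient functions on multi-indices ('d \<Rightarrow> nat).\<close>

definition mle :: "('d::finite \<Rightarrow> nat) \<Rightarrow> ('d \<Rightarrow> nat) \<Rightarrow> bool" where
  "mle p m \<longleftrightarrow> (\<forall>j. p j \<le> m j)"

definition mconv :: "(('d::finite \<Rightarrow> nat) \<Rightarrow> complex) \<Rightarrow> (('d \<Rightarrow> nat) \<Rightarrow> complex)
     \<Rightarrow> ('d \<Rightarrow> nat) \<Rightarrow> complex" where
  "mconv f g m = (\<Sum>p\<in>{p. mle p m}. f p * g (\<lambda>j. m j - p j))"

definition mone :: "('d::finite \<Rightarrow> nat) \<Rightarrow> complex" where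
  "mone m = (if m = (\<lambda>_. 0) then 1 else 0)"

primrec mpow :: "(('d::finite \<Rightarrow> nat) \<Rightarrow> complex) \<Rightarrow> nat \<Rightarrow> ('d \<Rightarrow> nat) \<Rightarrow> complex" where
  "mpow f 0 = mone"
| "mpow f (Suc n) = mconv f (mpow f n)"

text \<open>Coefficient of z^kappa in A(z) B(z)^n / prod_j (1 - z_j); the series of
  1/prod_j(1-z_j) has all coefficients equal to 1.\<close>
definition target_coeff :: "(('d::finite \<Rightarrow> nat) \<Rightarrow> complex) \<Rightarrow> (('d \<Rightarrow> nat) \<Rightarrow> real)
     \<Rightarrow> nat \<Rightarrow> ('d \<Rightarrow> nat) \<Rightarrow> complex" where
  "target_coeff a b n kappa =
     mconv (mconv a (mpow (\<lambda>m. complex_of_real (b m)) n)) (\<lambda>_. 1) kappa"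

definition mono_r :: "real^'d::finite \<Rightarrow> ('d \<Rightarrow> nat) \<Rightarrow> real" where
  "mono_r x m = (\<Prod>j\<in>UNIV. (x $ j) ^ m j)"

definition mono_c :: "complex^'d::finite \<Rightarrow> ('d \<Rightarrow> nat) \<Rightarrow> complex" where
  "mono_c z m = (\<Prod>j\<in>UNIV. (z $ j) ^ m j)"

definition Bval :: "(('d::finite \<Rightarrow> nat) \<Rightarrow> real) \<Rightarrow> real^'d \<Rightarrow> real" where
  "Bval b x = infsum (\<lambda>m. b m * mono_r x m) UNIV"

definition Aval :: "(('d::finite \<Rightarrow> nat) \<Rightarrow> complex) \<Rightarrow> real^'d \<Rightarrow> complex" where
  "Aval a x = infsum (\<lambda>m. a m * complex_of_real (mono_r x m)) UNIV"

definition support :: "(('d::finite \<Rightarrow> nat) \<Rightarrow> real) \<Rightarrow> ('d \<Rightarrow> nat) set" where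
  "support b = {m. b m \<noteq> 0}"

definition ivec :: "('d::finite \<Rightarrow> nat) \<Rightarrow> real^'d" where
  "ivec m = (\<chi> j. real (m j))"

definition full_rank :: "(('d::finite \<Rightarrow> nat) \<Rightarrow> real) \<Rightarrow> bool" where
  "full_rank b \<longleftrightarrow>
     dim {ivec n - ivec m | n m. n \<in> support b \<and> m \<in> support b} = CARD('d)"

definition aperiodic :: "(('d::finite \<Rightarrow> nat) \<Rightarrow> real) \<Rightarrow> bool" where
  "aperiodic b \<longleftrightarrow> \<not> (\<exists>(q::nat) (p::'d \<Rightarrow> nat) (r::int). q \<ge> 2 \<and> \<not> (\<forall>j. q dvd p j) \<and>
       (\<forall>n\<in>support b. \<exists>k::nat. int (\<Sum>j\<in>UNIV. p j * n j) = r + int q * int k))"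

definition converges_on :: "(('d::finite \<Rightarrow> nat) \<Rightarrow> real) \<Rightarrow> (complex^'d) set \<Rightarrow> bool" where
  "converges_on b \<Omega> \<longleftrightarrow>
     (\<forall>z\<in>\<Omega>. (\<lambda>m. norm (complex_of_real (b m) * mono_c z m)) summable_on UNIV)"

definition expvec :: "real^'d::finite \<Rightarrow> real^'d" where
  "expvec t = (\<chi> j. exp (t $ j))"

definition Psi :: "(complex^'d::finite) set \<Rightarrow> (real^'d) set" where
  "Psi \<Omega> = {t. (\<chi> j. complex_of_real (exp (t $ j))) \<in> \<Omega>}"

definition Kfun :: "(('d::finite \<Rightarrow> nat) \<Rightarrow> real) \<Rightarrow> real^'d \<Rightarrow> real" where
  "Kfun b t = ln (Bval b (expvec t))"

definition partial :: "(real^'d::finite \<Rightarrow> real) \<Rightarrow> 'd \<Rightarrow> real^'d \<Rightarrow> real" where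
  "partial f i t = deriv (\<lambda>s. f (t + s *\<^sub>R axis i 1)) 0"

definition hessian :: "(real^'d::finite \<Rightarrow> real) \<Rightarrow> real^'d \<Rightarrow> real^'d^'d" where
  "hessian f t = (\<chi> i j. partial (\<lambda>x. partial f j x) i t)"

definition tends_to_inf_on_boundary :: "(real^'d::finite \<Rightarrow> real) \<Rightarrow> (real^'d) set \<Rightarrow> bool" where
  "tends_to_inf_on_boundary f P \<longleftrightarrow>
     (\<exists>s::nat \<Rightarrow> real^'d. (\<forall>k. s k \<in> P) \<and> ((\<lambda>k. f (s k)) \<longlonglongrightarrow> Inf (f ` P)) \<and>
        ((\<exists>x\<in>frontier P. s \<longlonglongrightarrow> x) \<or> filterlim (\<lambda>k. norm (s k)) at_top sequentially))"

end

theory Submission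
  imports Defs "HOL-Probability.Probability" "HOL-Complex_Analysis.Complex_Analysis"
begin

text \<open>
  Dividing the coefficients \<open>b m * \<zeta>^m\<close> by \<open>B \<zeta>\<close> turns \<open>B\<close> into the generating function of a
  probability distribution with mean \<open>\<lambda>\<close> (the gradient of \<open>K\<close> at \<open>\<tau>\<close>) and covariance \<open>H\<close> (its
  Hessian). The coefficient is a Fourier integral over a torus; to avoid the poles of \<open>1 / (1 - z\<^sub>j)\<close>
  for \<open>\<zeta>\<^sub>j = 1\<close>, the radius is shrunk by \<open>exp (- h)\<close> there, where \<open>h = 1 / sqrt n\<close>. With
  \<open>z = \<zeta> exp (h w)\<close>, \<open>w = - 1\<^sub>C + i x\<close>, the integrand is \<open>exp (w\<^sup>T H w / 2) * (\<Prod>j\<in>C. - 1 / w\<^sub>j)\<close> times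
  a function of \<open>h\<close> which, for fixed \<open>x\<close>, is holomorphic and bounded on a disc of radius
  \<open>e / (1 + |x|)^3\<close>. Cauchy's estimates give its Taylor expansion in \<open>h\<close> with a remainder
  \<open>O(h^r (1 + |x|)^(3 r))\<close>. Where \<open>h (1 + |x|)^3\<close> is not small, the same bound holds trivially,
  because aperiodicity makes the whole integrand \<open>O((1 + |x|)^d exp (- c |x|\<^sup>2))\<close>. Integrating term
  by term gives the expansion. For \<open>C = {}\<close> the odd Taylor coefficients are odd functions of \<open>x\<close>;
  the leading coefficient comes from \<open>- 1 / w = \<integral> exp (w u) du\<close> over \<open>u > 0\<close> and the Fourier transform
  of the Gaussian.
\<close>

text \<open>The obstacle is uniformity: the expansion in \<open>h\<close> has to be integrated over
  all \<open>x\<close>, with bounds that depend on the multi-index only through a bound for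
  \<open>\<delta> = \<kappa> - n \<lambda>\<close>. The cube in \<open>(1 + |x|)^3\<close> comes
  from the logarithm: once its linear and quadratic terms are removed, \<open>n\<close> times the
  logarithm leaves \<open>h q(h)\<close> with \<open>q = O((1 + |x|)^3)\<close>, so the exponential
  is under control where \<open>h (1 + |x|)^3\<close> is small.

  The depth \<open>1 / sqrt n\<close> of the shift balances two effects. The linear part of its cost
  cancels against the factor from \<open>\<lambda>\<close>, and the quadratic part is of size
  \<open>n h^2 = 1\<close>, so the n-th power grows by a bounded factor only; yet in the scaled
  variable the poles stay at distance 1 from the contour. Each pole contributes a factor
  \<open>sqrt n\<close>, which cancels the \<open>1 / sqrt n\<close> from rescaling its angle. Only
  the coordinates with \<open>\<zeta> j < 1\<close> keep theirs, which gives the power of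
  \<open>n\<close> in front.

  Measurability and integrability of the Taylor coefficients in \<open>x\<close> are not shown from
  their definition but drawn from the expansion itself.\<close>

no_notation fps_nth (infixl \<open>$\<close> 75)
no_notation Infinite_Set_Sum.abs_summable_on (infix \<open>abs'_summable'_on\<close> 50)

section \<open>Lebesgue integrals and Gaussian integrals on real vectors\<close>

lemma measurable_vec_PiM [measurable]:
  "(\<lambda>f. \<chi> i. f i) \<in> Pi\<^sub>M (UNIV :: 'd::finite set) (\<lambda>_. lborel :: real measure) \<rightarrow>\<^sub>M borel"
proof (subst borel_measurable_euclidean_space, rule ballI)
  fix b :: "real^'d" assume "b \<in> Basis"
  then obtain i where "b = axis i 1" by (auto simp: Basis_vec_def)
  then show "(\<lambda>f. (\<chi> i. f i) \<bullet> b) \<in> borel_measurable (Pi\<^sub>M (UNIV :: 'd set) (\<lambda>_. lborel :: real measure))"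
    by (simp add: inner_axis)
qed

text \<open>Lebesgue measure is determined by its values on boxes, and a box is a product of
  intervals. This carries the theorems on iterated integrals and on integrals of products over to
  \<open>real^'d\<close>.\<close>

lemma distr_PiM_lborel_vec:
  "distr (Pi\<^sub>M (UNIV :: 'd::finite set) (\<lambda>_. lborel)) borel (\<lambda>f. \<chi> i. f i) = (lborel :: (real^'d) measure)"
proof (rule lborel_eqI[symmetric])
  interpret product_sigma_finite "\<lambda>_::'d. lborel :: real measure" ..
  note m = measurable_vec_PiM
  fix l u :: "real^'d" assume le: "\<And>b. b \<in> Basis \<Longrightarrow> l \<bullet> b \<le> u \<bullet> b"
  have le': "l $ i \<le> u $ i" for i
    using le[of "axis i 1"] by (auto simp: inner_axis Basis_vec_def)
  have "(\<lambda>f. \<chi> i. f i) -` box l u \<inter> space (Pi\<^sub>M (UNIV :: 'd set) (\<lambda>_. lborel :: real measure))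
      = (\<Pi>\<^sub>E i\<in>UNIV. {l$i<..<u$i})"
    by (auto simp: mem_box_cart space_PiM PiE_iff)
  then have "emeasure (distr (Pi\<^sub>M (UNIV :: 'd set) (\<lambda>_. lborel)) borel (\<lambda>f. \<chi> i. f i)) (box l u)
      = emeasure (Pi\<^sub>M (UNIV :: 'd set) (\<lambda>_. lborel :: real measure)) (\<Pi>\<^sub>E i\<in>UNIV. {l$i<..<u$i})"
    using m by (simp add: emeasure_distr)
  also have "\<dots> = (\<Prod>i\<in>UNIV. ennreal (u$i - l$i))"
    by (subst emeasure_PiM) (auto simp: le')
  also have "\<dots> = ennreal (\<Prod>i\<in>UNIV. (u$i - l$i))"
    by (simp add: prod_ennreal le')
  also have "(\<Prod>i\<in>UNIV. (u$i - l$i)) = (\<Prod>b\<in>Basis. (u - l) \<bullet> b)"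
    by (subst Basis_vec_def, simp add: UNION_singleton_eq_range, subst prod.reindex)
       (auto simp: inner_axis inj_on_def axis_eq_axis)
  finally show "emeasure (distr (Pi\<^sub>M (UNIV :: 'd set) (\<lambda>_. lborel)) borel (\<lambda>f. \<chi> i. f i)) (box l u)
      = ennreal (\<Prod>b\<in>Basis. (u - l) \<bullet> b)" .
qed simp

lemma
  fixes f :: "'d::finite \<Rightarrow> real \<Rightarrow> 'b::{real_normed_field,banach,second_countable_topology}"
  assumes int: "\<And>i. integrable lborel (f i)"
  shows integrable_vec_prod: "integrable lborel (\<lambda>x::real^'d. \<Prod>i\<in>UNIV. f i (x $ i))"
    and integral_vec_prod: "(\<integral>x. (\<Prod>i\<in>UNIV. f i (x $ i)) \<partial>(lborel :: (real^'d) measure)) = (\<Prod>i\<in>UNIV. integral\<^sup>L lborel (f i))"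
proof -
  interpret product_sigma_finite "\<lambda>_::'d. lborel :: real measure" ..
  have [measurable]: "f i \<in> borel_measurable borel" for i
    using borel_measurable_integrable[OF int] by simp
  have m: "(\<lambda>x::real^'d. \<Prod>i\<in>UNIV. f i (x $ i)) \<in> borel_measurable borel"
    by measurable
  show "integrable lborel (\<lambda>x::real^'d. \<Prod>i\<in>UNIV. f i (x $ i))"
    unfolding distr_PiM_lborel_vec[symmetric]
    using product_integrable_prod[of UNIV f] int m
    by (subst integrable_distr_eq) auto
  show "(\<integral>x. (\<Prod>i\<in>UNIV. f i (x $ i)) \<partial>(lborel :: (real^'d) measure)) = (\<Prod>i\<in>UNIV. integral\<^sup>L lborel (f i))"
    unfolding distr_PiM_lborel_vec[symmetric]
    using product_integral_prod[of UNIV f] int m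
    by (subst integral_distr) auto
qed


section \<open>Linear change of variables for Lebesgue integrals\<close>

lemma nn_integral_vec_transpose:
  fixes f :: "real^'d::finite \<Rightarrow> ennreal"
  assumes [measurable]: "f \<in> borel_measurable borel"
  shows "(\<integral>\<^sup>+x. f (\<chi> i. x $ Transposition.transpose m n i) \<partial>lborel) = (\<integral>\<^sup>+x. f x \<partial>lborel)"
proof -
  let ?s = "Transposition.transpose m n"
  let ?T = "\<lambda>x::real^'d. \<chi> i. x $ ?s i"
  have "linear ?T" by (rule linearI) (auto simp: vec_eq_iff)
  then have [measurable]: "?T \<in> borel \<rightarrow>\<^sub>M borel"
    by (intro borel_measurable_continuous_onI linear_continuous_on) (simp add: linear_linear)
  have "lborel = distr lborel borel ?T"
  proof (rule lborel_eqI)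
    fix l u :: "real^'d" assume le: "\<And>b. b \<in> Basis \<Longrightarrow> l \<bullet> b \<le> u \<bullet> b"
    have le': "l $ i \<le> u $ i" for i
      using le[of "axis i 1"] by (auto simp: inner_axis Basis_vec_def)
    have prod: "(\<Prod>b\<in>Basis. y \<bullet> b) = (\<Prod>i\<in>UNIV. y $ i)" for y :: "real^'d"
      by (subst Basis_vec_def, simp add: UNION_singleton_eq_range, subst prod.reindex)
         (auto simp: inner_axis inj_on_def axis_eq_axis)
    have "?T -` box l u = box (?T l) (?T u)"
      by (auto simp: mem_box_cart) (metis transpose_involutory)+
    then have "emeasure (distr lborel borel ?T) (box l u) = emeasure lborel (box (?T l) (?T u))"
      by (simp add: emeasure_distr)
    also have "\<dots> = ennreal (\<Prod>b\<in>Basis. (?T u - ?T l) \<bullet> b)"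
      by (rule emeasure_lborel_box) (auto simp: Basis_vec_def inner_axis le')
    also have "(\<Prod>b\<in>Basis. (?T u - ?T l) \<bullet> b) = (\<Prod>b\<in>Basis. (u - l) \<bullet> b)"
      unfolding prod using prod.permute[OF permutes_swap_id[of m UNIV n], of "\<lambda>i. (u-l)$i"]
      by (simp add: o_def)
    finally show "emeasure (distr lborel borel ?T) (box l u) = ennreal (\<Prod>b\<in>Basis. (u - l) \<bullet> b)" .
  qed simp
  then have "(\<integral>\<^sup>+x. f x \<partial>lborel) = (\<integral>\<^sup>+x. f x \<partial>distr lborel borel ?T)" by simp
  also have "\<dots> = (\<integral>\<^sup>+x. f (?T x) \<partial>lborel)" by (subst nn_integral_distr) auto
  finally show ?thesis by simp
qed

text \<open>Integrating over coordinate \<open>m\<close> first, with the others fixed, the shear is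
  a translation by \<open>c * x n\<close>, which leaves the inner integral unchanged.\<close>

lemma nn_integral_vec_shear:
  fixes f :: "real^'d::finite \<Rightarrow> ennreal"
  assumes [measurable]: "f \<in> borel_measurable borel" and mn: "m \<noteq> n"
  shows "(\<integral>\<^sup>+x. f (\<chi> i. if i = m then x $ m + c * x $ n else x $ i) \<partial>lborel) = (\<integral>\<^sup>+x. f x \<partial>lborel)"
proof -
  interpret product_sigma_finite "\<lambda>_::'d. lborel :: real measure" ..
  have U: "UNIV = insert m (UNIV - {m})" by auto
  let ?T = "\<lambda>x::real^'d. \<chi> i. if i = m then x $ m + c * x $ n else x $ i"
  have "linear ?T" by (rule linearI) (auto simp: vec_eq_iff algebra_simps)
  then have [measurable]: "?T \<in> borel \<rightarrow>\<^sub>M borel"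
    by (intro borel_measurable_continuous_onI linear_continuous_on) (simp add: linear_linear)
  have ins: "(\<integral>\<^sup>+x. g (\<chi> i. x i) \<partial>Pi\<^sub>M (UNIV::'d set) (\<lambda>_. lborel)) =
      (\<integral>\<^sup>+x. \<integral>\<^sup>+y. g (\<chi> i. (x(m := y)) i) \<partial>lborel \<partial>Pi\<^sub>M (UNIV - {m}) (\<lambda>_. lborel))"
    if [measurable]: "g \<in> borel_measurable borel" for g :: "real^'d \<Rightarrow> ennreal"
  proof -
    have "(\<lambda>x. g (\<chi> i. x i)) \<in> borel_measurable (Pi\<^sub>M (insert m (UNIV-{m})) (\<lambda>_. lborel :: real measure))"
      unfolding U[symmetric] by (rule measurable_compose[OF measurable_vec_PiM that])
    from product_nn_integral_insert[OF _ _ this] show ?thesis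
      unfolding U[symmetric] by simp
  qed
  have "(\<integral>\<^sup>+x. f (?T x) \<partial>lborel) = (\<integral>\<^sup>+x. f (?T (\<chi> i. x i)) \<partial>Pi\<^sub>M (UNIV::'d set) (\<lambda>_. lborel))"
    unfolding distr_PiM_lborel_vec[symmetric] by (subst nn_integral_distr) auto
  also have "\<dots> = (\<integral>\<^sup>+x. \<integral>\<^sup>+y. f (?T (\<chi> i. (x(m := y)) i)) \<partial>lborel \<partial>Pi\<^sub>M (UNIV - {m}) (\<lambda>_. lborel))"
    by (rule ins) measurable
  also have "\<dots> = (\<integral>\<^sup>+x. \<integral>\<^sup>+y. f (\<chi> i. (x(m := y)) i) \<partial>lborel \<partial>Pi\<^sub>M (UNIV - {m}) (\<lambda>_. lborel))"
  proof (rule nn_integral_cong)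
    fix x :: "'d \<Rightarrow> real"
    have "(\<lambda>y. \<chi> i. (x(m := y)) i) = (\<lambda>y. (\<chi> i. (x(m := 0)) i) + y *\<^sub>R axis m 1)"
      by (auto simp: vec_eq_iff axis_def)
    then have [measurable]: "(\<lambda>y. \<chi> i. (x(m := y)) i) \<in> borel \<rightarrow>\<^sub>M (borel :: (real^'d) measure)"
      by simp
    have "(\<integral>\<^sup>+y. f (\<chi> i. (x(m := y)) i) \<partial>lborel) = (\<integral>\<^sup>+y. f (\<chi> i. (x(m := c * x n + 1 * y)) i) \<partial>lborel)"
      by (subst nn_integral_real_affine[where c = 1 and t = "c * x n"]) auto
    also have "\<dots> = (\<integral>\<^sup>+y. f (?T (\<chi> i. (x(m := y)) i)) \<partial>lborel)"
      using mn by (intro nn_integral_cong arg_cong[where f=f]) (auto simp: vec_eq_iff)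
    finally show "(\<integral>\<^sup>+y. f (?T (\<chi> i. (x(m := y)) i)) \<partial>lborel) = (\<integral>\<^sup>+y. f (\<chi> i. (x(m := y)) i) \<partial>lborel)" ..
  qed
  also have "\<dots> = (\<integral>\<^sup>+x. f (\<chi> i. x i) \<partial>Pi\<^sub>M (UNIV::'d set) (\<lambda>_. lborel))"
    by (rule ins[symmetric]) measurable
  also have "\<dots> = (\<integral>\<^sup>+x. f x \<partial>lborel)"
    unfolding distr_PiM_lborel_vec[symmetric] by (subst nn_integral_distr) auto
  finally show ?thesis .
qed

lemma nn_integral_vec_diagonal:
  fixes f :: "real^'d::finite \<Rightarrow> ennreal"
  assumes [measurable]: "f \<in> borel_measurable borel" and a: "\<And>i. a i \<noteq> 0"
  shows "ennreal \<bar>\<Prod>i\<in>UNIV. a i\<bar> * (\<integral>\<^sup>+x. f (\<chi> i. a i * x $ i) \<partial>lborel) = (\<integral>\<^sup>+x. f x \<partial>lborel)"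
proof -
  \<comment> \<open>The affine substitution rule indexes its factors by basis vectors; this sum of
    squares is an expression on vectors that takes the value \<open>a i\<close> at
    \<open>axis i 1\<close>.\<close>
  define c where "c b = (\<Sum>i\<in>UNIV. a i * (b $ i)\<^sup>2)" for b :: "real^'d"
  have c: "c (axis i 1) = a i" for i
    by (simp add: c_def axis_def if_distrib[of "\<lambda>x. _ * x\<^sup>2"] cong: if_cong)
  have nz: "j \<in> Basis \<Longrightarrow> c j \<noteq> 0" for j :: "real^'d"
    using a c by (auto simp: Basis_vec_def)
  have B: "Basis = range (\<lambda>i::'d. axis i (1::real))"
    by (auto simp: Basis_vec_def)
  have inj: "inj (\<lambda>i::'d. axis i (1::real))" by (auto simp: inj_on_def axis_eq_axis)
  have T: "(0::real^'d) + (\<Sum>j\<in>Basis. (c j * (x \<bullet> j)) *\<^sub>R j) = (\<chi> i. a i * x $ i)" for x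
    unfolding B by (subst sum.reindex[OF inj]) (simp add: vec_eq_iff c inner_axis, simp add: axis_def if_distrib cong: if_cong)
  have P: "(\<Prod>j\<in>Basis. \<bar>c j\<bar>) = \<bar>\<Prod>i\<in>UNIV. a i\<bar>"
    unfolding B by (subst prod.reindex[OF inj]) (simp add: c abs_prod)
  have "linear (\<lambda>x::real^'d. \<chi> i. a i * x $ i)" by (rule linearI) (auto simp: vec_eq_iff algebra_simps)
  then have [measurable]: "(\<lambda>x::real^'d. \<chi> i. a i * x $ i) \<in> borel \<rightarrow>\<^sub>M borel"
    by (intro borel_measurable_continuous_onI linear_continuous_on) (simp add: linear_linear)
  have "(\<integral>\<^sup>+x. f x \<partial>lborel) = (\<integral>\<^sup>+x. f x \<partial>density (distr lborel borel (\<lambda>x. \<chi> i. a i * x $ i)) (\<lambda>_. \<bar>\<Prod>i\<in>UNIV. a i\<bar>))"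
    using lborel_affine_euclidean[of c "0::real^'d", OF nz] unfolding T P by simp
  also have "\<dots> = ennreal \<bar>\<Prod>i\<in>UNIV. a i\<bar> * (\<integral>\<^sup>+x. f (\<chi> i. a i * x $ i) \<partial>lborel)"
    by (subst nn_integral_density) (auto simp: nn_integral_cmult nn_integral_distr)
  finally show ?thesis by simp
qed

lemma borel_measurable_matrix_vector [measurable]:
  "(\<lambda>x. A *v x) \<in> (borel :: (real^'n::finite) measure) \<rightarrow>\<^sub>M (borel :: (real^'m::finite) measure)"
  by (intro borel_measurable_continuous_onI linear_continuous_on) (simp add: linear_linear[symmetric] matrix_vector_mul_linear)

text \<open>Induction over products of elementary matrices: swaps, shears and diagonal matrices are
  treated above. The claim ranges over all \<open>f\<close> because the product case applies it to
  \<open>f\<close> composed with the first factor, and \<open>det A \<noteq> 0\<close> is part of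
  the claim because a matrix with a zero row also occurs.\<close>

lemma nn_integral_matrix_vector:
  fixes f :: "real^'d::finite \<Rightarrow> ennreal"
  assumes "f \<in> borel_measurable borel" "det A \<noteq> 0"
  shows "ennreal \<bar>det A\<bar> * (\<integral>\<^sup>+x. f (A *v x) \<partial>lborel) = (\<integral>\<^sup>+x. f x \<partial>lborel)"
proof -
  have "\<forall>f \<in> borel_measurable borel. det A \<noteq> 0 \<longrightarrow>
      ennreal \<bar>det A\<bar> * (\<integral>\<^sup>+x. f (A *v x) \<partial>lborel) = (\<integral>\<^sup>+x. f x \<partial>lborel)" (is "?P A")
  proof (rule induct_matrix_elementary[where P = ?P])
    fix A B :: "real^'d^'d" assume A: "?P A" and B: "?P B"
    show "?P (A ** B)"
    proof (intro ballI impI)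
      fix f :: "real^'d \<Rightarrow> ennreal" assume [measurable]: "f \<in> borel_measurable borel" and d: "det (A ** B) \<noteq> 0"
      have fA: "(\<lambda>x. f (A *v x)) \<in> borel_measurable borel" by measurable
      have "ennreal \<bar>det (A ** B)\<bar> * (\<integral>\<^sup>+x. f ((A ** B) *v x) \<partial>lborel) =
        ennreal \<bar>det A\<bar> * (ennreal \<bar>det B\<bar> * (\<integral>\<^sup>+x. f (A *v (B *v x)) \<partial>lborel))"
        by (simp add: det_mul abs_mult ennreal_mult matrix_vector_mul_assoc mult.assoc)
      also have "\<dots> = (\<integral>\<^sup>+x. f x \<partial>lborel)"
        using bspec[OF B fA] bspec[OF A, of f] d by (simp add: det_mul)
      finally show "ennreal \<bar>det (A ** B)\<bar> * (\<integral>\<^sup>+x. f ((A ** B) *v x) \<partial>lborel) = (\<integral>\<^sup>+x. f x \<partial>lborel)" .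
    qed
  next
    fix A :: "real^'d^'d" and i assume "row i A = 0"
    then show "?P A" using det_zero_row(1)[of i A] by simp
  next
    fix A :: "real^'d^'d" assume diag: "\<And>i j. i \<noteq> j \<Longrightarrow> A$i$j = 0"
    have "A *v x = (\<chi> i. A$i$i * x$i)" for x
    proof -
      have "(\<Sum>j\<in>UNIV. A$i$j * x$j) = (\<Sum>j\<in>UNIV. if j = i then A$i$i * x$i else 0)" for i
        by (rule sum.cong) (auto simp: diag)
      then show ?thesis by (simp add: matrix_vector_mult_def vec_eq_iff)
    qed
    then show "?P A"
      using nn_integral_vec_diagonal[of _ "\<lambda>i. A$i$i"] by (auto simp: det_diagonal[OF diag])
  next
    fix m n :: 'd assume mn: "m \<noteq> n"
    let ?A = "(\<chi> i j. mat 1 $ i $ Transposition.transpose m n j) :: real^'d^'d"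
    have d: "\<bar>det ?A\<bar> = 1"
      using det_permute_columns[OF permutes_swap_id[of m UNIV n], of "mat 1 :: real^'d^'d"]
      by (simp add: sign_swap_id mn)
    have "?A *v x = (\<chi> i. x $ Transposition.transpose m n i)" for x
    proof -
      have "(\<Sum>j\<in>UNIV. mat 1 $ i $ Transposition.transpose m n j * x$j)
          = (\<Sum>j\<in>UNIV. if j = Transposition.transpose m n i then x $ Transposition.transpose m n i else 0)" for i
        by (rule sum.cong) (auto simp: mat_def)
      then show ?thesis by (simp add: matrix_vector_mult_def vec_eq_iff)
    qed
    then show "?P ?A" using nn_integral_vec_transpose[of _ m n] d by simp
  next
    fix m n :: 'd and c :: real assume mn: "m \<noteq> n"
    let ?A = "(\<chi> i j. if i = m \<and> j = n then c else of_bool (i = j)) :: real^'d^'d"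
    have "?A = (\<chi> k. if k = m then row m (mat 1) + c *s row n (mat 1) else row k (mat 1))"
      using mn by (auto simp: vec_eq_iff row_def mat_def)
    then have d: "det ?A = 1"
      using det_row_operation[OF mn, of "mat 1 :: real^'d^'d" c] by simp
    have "?A *v x = (\<chi> i. if i = m then x $ m + c * x $ n else x $ i)" for x
    proof -
      have "(\<Sum>j\<in>UNIV. (if i = m \<and> j = n then c else of_bool (i = j)) * x$j)
          = (\<Sum>j\<in>UNIV. (if j = i then x $ i else 0) + (if j = n then (if i = m then c * x $ n else 0) else 0))" for i
        using mn by (intro sum.cong) auto
      then show ?thesis by (simp add: matrix_vector_mult_def vec_eq_iff sum.distrib)
    qed
    then show "?P ?A" using nn_integral_vec_shear[OF _ mn, of _ c] d by simp
  qed
  with assms show ?thesis by blast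
qed

text \<open>As an identity of measures the substitution rule also applies to Bochner integrals,
  which is needed for complex integrands.\<close>

lemma lborel_distr_matrix_vector:
  fixes A :: "real^'d::finite^'d"
  assumes "det A \<noteq> 0"
  shows "lborel = density (distr lborel borel (\<lambda>x. A *v x)) (\<lambda>_. ennreal \<bar>det A\<bar>)"
proof (rule measure_eqI)
  fix S :: "(real^'d) set" assume "S \<in> sets lborel"
  then have [measurable]: "S \<in> sets borel" by simp
  have "emeasure lborel S = (\<integral>\<^sup>+x. indicator S x \<partial>lborel)" by simp
  also have "\<dots> = ennreal \<bar>det A\<bar> * (\<integral>\<^sup>+x. indicator S (A *v x) \<partial>lborel)"
    by (rule nn_integral_matrix_vector[symmetric]) (use assms in auto)
  also have "(\<integral>\<^sup>+x. indicator S (A *v x) \<partial>lborel) = (\<integral>\<^sup>+x. indicator S x \<partial>distr lborel borel (\<lambda>x. A *v x))"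
    by (subst nn_integral_distr) auto
  also have "\<dots> = emeasure (distr lborel borel (\<lambda>x. A *v x)) S" by simp
  finally show "emeasure lborel S = emeasure (density (distr lborel borel (\<lambda>x. A *v x)) (\<lambda>_. ennreal \<bar>det A\<bar>)) S"
    by (simp add: emeasure_density nn_integral_cmult_indicator)
qed simp

lemma integral_matrix_vector:
  fixes f :: "real^'d::finite \<Rightarrow> 'b::{banach,second_countable_topology}" and A :: "real^'d^'d"
  assumes d: "det A \<noteq> 0" and [measurable]: "f \<in> borel_measurable borel"
  shows "(\<integral>x. f x \<partial>lborel) = \<bar>det A\<bar> *\<^sub>R (\<integral>x. f (A *v x) \<partial>lborel)"
  by (subst lborel_distr_matrix_vector[OF d], subst integral_density) (auto simp: integral_distr)

section \<open>Gaussian integrals and their Fourier transforms\<close>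

lemma positive_definite_congruent_mat_1:
  fixes H :: "real^'d::finite^'d"
  assumes sym: "transpose H = H" and pd: "\<And>x. x \<noteq> 0 \<Longrightarrow> x \<bullet> (H *v x) > 0"
  obtains P :: "real^'d^'d" where "transpose P ** H ** P = mat 1"
proof -
  have *: "x \<bullet> (H *v y) = y \<bullet> (H *v x)" for x y
    by (metis sym dot_lmul_matrix inner_commute transpose_matrix_vector)
  \<comment> \<open>Gram-Schmidt for the scalar product with matrix \<open>H\<close>, along growing
    index sets; the vectors become the columns of \<open>P\<close>. A further vector exists by
    dimension: fewer than \<open>CARD('d)\<close> vectors \<open>H *v v j\<close> leave a nonzero
    \<open>x\<close> orthogonal to all of them.\<close>
  have "\<exists>v. \<forall>i\<in>J. \<forall>j\<in>J. v i \<bullet> (H *v v j) = of_bool (i = j)" for J :: "'d set"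
  proof (induction J rule: finite_induct[OF finite])
    case (2 k J)
    then obtain v where v: "\<forall>i\<in>J. \<forall>j\<in>J. v i \<bullet> (H *v v j) = of_bool (i = j)" by blast
    have "dim ((\<lambda>j. H *v v j) ` J) \<le> card ((\<lambda>j. H *v v j) ` J)"
      by (rule dim_le_card') auto
    also have "\<dots> \<le> card J" by (rule card_image_le) auto
    also have "\<dots> < CARD('d)" using 2 by (intro psubset_card_mono) auto
    finally have "dim ((\<lambda>j. H *v v j) ` J) < DIM(real^'d)" by simp
    then obtain x where x: "x \<noteq> 0" "\<And>y. y \<in> span ((\<lambda>j. H *v v j) ` J) \<Longrightarrow> orthogonal x y"
      using orthogonal_to_subspace_exists by blast
    have xo: "x \<bullet> (H *v v j) = 0" if "j \<in> J" for j
      using x(2)[OF span_base, of "H *v v j"] that by (auto simp: orthogonal_def)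
    define s where "s = sqrt (x \<bullet> (H *v x))"
    have s: "s > 0" "s * s = x \<bullet> (H *v x)" using pd[OF x(1)] by (auto simp: s_def)
    define e where "e = (1 / s) *\<^sub>R x"
    have e: "e \<bullet> (H *v e) = 1" "\<And>j. j \<in> J \<Longrightarrow> e \<bullet> (H *v v j) = 0"
      using s xo by (auto simp: e_def matrix_vector_mult_scaleR field_simps)
    show ?case
    proof (intro exI[of _ "v(k := e)"] ballI)
      fix i j assume "i \<in> insert k J" "j \<in> insert k J"
      then show "(v(k := e)) i \<bullet> (H *v (v(k := e)) j) = of_bool (i = j)"
        using v e 2 *[of "v i" e] by auto
    qed
  qed auto
  from this[of UNIV] have "\<exists>v. \<forall>i j::'d. v i \<bullet> (H *v v j) = of_bool (i = j)" by (simp only: UNIV_I ball_simps ball_UNIV)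
  then obtain v where v: "\<And>i j::'d. v i \<bullet> (H *v v j) = of_bool (i = j)" by blast
  define P :: "real^'d^'d" where "P = (\<chi> i j. v j $ i)"
  have "(transpose P ** (H ** P)) $ i $ j = v i \<bullet> (H *v v j)" for i j
    by (simp add: matrix_matrix_mult_def matrix_vector_mult_def transpose_def P_def inner_vec_def)
  then have "transpose P ** H ** P = mat 1"
    by (simp add: vec_eq_iff v mat_def flip: matrix_mul_assoc)
  then show ?thesis by (rule that)
qed

text \<open>Up to the factor \<open>sqrt (2 * pi)\<close> this is the characteristic function of the
  standard normal distribution.\<close>

lemma
  shows integrable_gauss_char: "integrable lborel (\<lambda>x. exp (complex_of_real (- x\<^sup>2 / 2) + \<i> * complex_of_real (t * x)))"
    and integral_gauss_char: "(\<integral>x. exp (complex_of_real (- x\<^sup>2 / 2) + \<i> * complex_of_real (t * x)) \<partial>lborel)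
      = complex_of_real (sqrt (2 * pi) * exp (- t\<^sup>2 / 2))"
proof -
  let ?f = "\<lambda>x. exp (complex_of_real (- x\<^sup>2 / 2) + \<i> * complex_of_real (t * x))"
  have eq: "?f x = complex_of_real (sqrt (2 * pi)) * (std_normal_density x *\<^sub>R iexp (t * x))" for x
    by (simp add: std_normal_density_def scaleR_conv_of_real exp_of_real[symmetric] flip: exp_add)
  have 1: "integrable lborel (\<lambda>x. std_normal_density x *\<^sub>R iexp (t * x))"
  proof (rule Bochner_Integration.integrable_bound)
    show "integrable lborel std_normal_density" by simp
  qed (auto simp: abs_mult)
  show "integrable lborel ?f" unfolding eq by (rule integrable_mult_right[OF 1])
  have "(\<integral>x. std_normal_density x *\<^sub>R iexp (t * x) \<partial>lborel) = char std_normal_distribution t"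
    unfolding char_def by (subst integral_density) auto
  then show "(\<integral>x. ?f x \<partial>lborel) = complex_of_real (sqrt (2 * pi) * exp (- t\<^sup>2 / 2))"
    unfolding eq integral_mult_right_zero by (simp add: char_std_normal_distribution)
qed

text \<open>The substitution \<open>x = P y\<close> with \<open>P\<close> from the congruence turns
  the quadratic form into the sum of squares and \<open>v\<close> into
  \<open>u = transpose P *v v\<close>, so the integral splits into one-dimensional ones. Since the
  inverse of \<open>H\<close> is \<open>P ** transpose P\<close>, the sum of squares of
  \<open>u\<close> is the quadratic form of that inverse at \<open>v\<close>.\<close>

lemma
  fixes H :: "real^'d::finite^'d" and v :: "real^'d"
  assumes sym: "transpose H = H" and pd: "\<And>x. x \<noteq> 0 \<Longrightarrow> x \<bullet> (H *v x) > 0"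
  shows det_positive_definite: "det H > 0"
    and integral_gauss_char_vec:
      "(\<integral>x. exp (complex_of_real (- (x \<bullet> (H *v x)) / 2) + \<i> * complex_of_real (v \<bullet> x)) \<partial>lborel)
        = complex_of_real (sqrt ((2 * pi) ^ CARD('d) / det H) * exp (- (v \<bullet> (matrix_inv H *v v)) / 2))"
proof -
  obtain P :: "real^'d^'d" where P: "transpose P ** H ** P = mat 1"
    by (rule positive_definite_congruent_mat_1[OF sym pd])
  then have "det (transpose P ** H ** P) = 1" by simp
  then have dP: "(det P)\<^sup>2 * det H = 1"
    by (simp add: det_mul det_transpose power2_eq_square mult.commute mult.left_commute)
  have P0: "det P \<noteq> 0" using dP by auto
  show dH: "det H > 0"
    using zero_less_mult_pos[of "(det P)\<^sup>2" "det H"] dP P0 by simp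
  have detP: "\<bar>det P\<bar> = sqrt (1 / det H)"
    using dP dH by (intro real_sqrt_unique[symmetric]) (auto simp: field_simps)
  have "P ** (transpose P ** H) = mat 1"
    using P unfolding matrix_left_right_inverse[of P] .
  then have PPH: "(P ** transpose P) ** H = mat 1" by (simp add: matrix_mul_assoc)
  then have "H ** (P ** transpose P) = mat 1"
    unfolding matrix_left_right_inverse[of H] .
  then have "\<exists>X. H ** X = mat 1 \<and> X ** H = mat 1"
    using PPH by blast
  then have "H ** matrix_inv H = mat 1"
    unfolding matrix_inv_def by (rule someI_ex[THEN conjunct1])
  then have "(P ** transpose P) ** (H ** matrix_inv H) = P ** transpose P"
    by (simp only: matrix_mul_rid)
  then have inv: "matrix_inv H = P ** transpose P"
    by (simp only: matrix_mul_assoc[of _ H] PPH matrix_mul_lid)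
  define u where "u = transpose P *v v"
  have T: "x \<bullet> (P *v y) = (transpose P *v x) \<bullet> y" for x y
    by (simp add: dot_lmul_matrix transpose_matrix_vector)
  have uv: "v \<bullet> (P *v y) = u \<bullet> y" for y
    by (simp add: u_def T)
  have uu: "u \<bullet> u = v \<bullet> (matrix_inv H *v v)"
    unfolding inv matrix_vector_mul_assoc[symmetric] T u_def ..
  have yy: "(P *v y) \<bullet> (H *v (P *v y)) = y \<bullet> y" for y
  proof -
    have "(P *v y) \<bullet> (H *v (P *v y)) = y \<bullet> ((transpose P ** H ** P) *v y)"
      unfolding matrix_vector_mul_assoc[symmetric] by (subst inner_commute, subst T, subst inner_commute) simp
    then show ?thesis by (simp add: P)
  qed
  let ?f = "\<lambda>x. exp (complex_of_real (- (x \<bullet> (H *v x)) / 2) + \<i> * complex_of_real (v \<bullet> x))"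
  let ?g = "\<lambda>i x. exp (complex_of_real (- x\<^sup>2 / 2) + \<i> * complex_of_real (u $ i * x))"
  have f: "?f (P *v y) = (\<Prod>i\<in>UNIV. ?g i (y $ i))" for y
    unfolding yy uv
    by (simp add: inner_vec_def exp_sum[symmetric] sum.distrib sum_distrib_left sum_subtractf power2_eq_square
        sum_negf sum_divide_distrib algebra_simps)
  have m: "?f \<in> borel_measurable borel" by measurable
  have "(\<integral>x. ?f x \<partial>lborel) = \<bar>det P\<bar> *\<^sub>R (\<integral>y. ?f (P *v y) \<partial>lborel)"
    by (rule integral_matrix_vector[OF P0 m])
  also have "(\<integral>y. ?f (P *v y) \<partial>lborel) = (\<Prod>i\<in>UNIV. complex_of_real (sqrt (2 * pi) * exp (- (u $ i)\<^sup>2 / 2)))"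
    unfolding f by (subst integral_vec_prod) (simp_all only: integrable_gauss_char integral_gauss_char)
  also have "\<dots> = complex_of_real (sqrt (2 * pi) ^ CARD('d) * exp (- (u \<bullet> u) / 2))"
    by (simp add: prod.distrib inner_vec_def sum_negf sum_divide_distrib power2_eq_square flip: exp_sum of_real_prod)
  finally show "(\<integral>x. ?f x \<partial>lborel) = complex_of_real (sqrt ((2 * pi) ^ CARD('d) / det H) * exp (- (v \<bullet> (matrix_inv H *v v)) / 2))"
    by (simp add: detP uu scaleR_conv_of_real real_sqrt_mult real_sqrt_divide real_sqrt_power power_mult_distrib)
qed

lemma integrable_exp_neg_square:
  assumes "c > 0" shows "integrable lborel (\<lambda>x::real. exp (- c * x\<^sup>2))"
proof -
  define \<sigma> where "\<sigma> = 1 / sqrt (2 * c)"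
  have s: "\<sigma> > 0" "\<sigma>\<^sup>2 = 1 / (2 * c)" using assms by (auto simp: \<sigma>_def power_divide)
  have "integrable lborel (\<lambda>x. sqrt (2 * pi * \<sigma>\<^sup>2) * normal_density 0 \<sigma> x)"
    using integrable_normal_density[OF s(1)] by (rule integrable_mult_right)
  moreover have "sqrt (2 * pi * \<sigma>\<^sup>2) * normal_density 0 \<sigma> x = exp (- c * x\<^sup>2)" for x
    using assms s by (simp add: normal_density_def field_simps)
  ultimately show ?thesis by simp
qed

text \<open>One term of the exponential series bounds \<open>(1 + s) ^ N / fact N\<close> by
  \<open>exp (1 + s)\<close>, and completing the square bounds \<open>s\<close> by
  \<open>1 / (4 * c) + c * s\<^sup>2\<close>.\<close>

lemma poly_le_exp_square:
  fixes s c :: real assumes "c > 0" "s \<ge> 0"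
  shows "(1 + s) ^ N \<le> fact N * exp (1 + 1 / (4 * c)) * exp (c * s\<^sup>2)"
proof -
  have "s \<le> 1 / (4 * c) + c * s\<^sup>2"
  proof -
    have "0 \<le> (2 * c * s - 1)\<^sup>2 / (4 * c)" using assms by simp
    also have "\<dots> = c * s\<^sup>2 + 1 / (4 * c) - s" using assms by (simp add: field_simps power2_eq_square)
    finally show ?thesis by simp
  qed
  have "sum (\<lambda>n. (1 + s) ^ n /\<^sub>R fact n) {N} \<le> (\<Sum>n. (1 + s) ^ n /\<^sub>R fact n)"
    using assms by (intro sum_le_suminf summable_exp_generic) auto
  then have "(1 + s) ^ N / fact N \<le> exp (1 + s)"
    by (simp add: exp_def divide_inverse mult.commute)
  also have "\<dots> \<le> exp (1 + 1 / (4 * c) + c * s\<^sup>2)" using \<open>s \<le> _\<close> by simp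
  finally show ?thesis by (simp add: field_simps exp_add)
qed

text \<open>Half of the Gaussian decay pays for the polynomial; the other half is a product of
  integrable functions of one coordinate.\<close>

lemma integrable_poly_gauss_vec:
  assumes "c > 0" shows "integrable lborel (\<lambda>x::real^'d::finite. (1 + norm x) ^ N * exp (- c * (norm x)\<^sup>2))"
proof (rule Bochner_Integration.integrable_bound)
  have "integrable lborel (\<lambda>x::real^'d. \<Prod>i\<in>UNIV. exp (- (c/2) * (x $ i)\<^sup>2))"
    using assms by (intro integrable_vec_prod integrable_exp_neg_square) auto
  also have "(\<lambda>x::real^'d. \<Prod>i\<in>UNIV. exp (- (c/2) * (x $ i)\<^sup>2)) = (\<lambda>x. exp (- (c/2) * (norm x)\<^sup>2))"
    by (simp add: norm_vec_def L2_set_def sum_nonneg sum_distrib_left flip: exp_sum)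
  finally show "integrable lborel (\<lambda>x::real^'d. fact N * exp (1 + 1 / (4 * (c/2))) * exp (- (c/2) * (norm x)\<^sup>2))"
    by (rule integrable_mult_right)
  show "AE x::real^'d in lborel. norm ((1 + norm x) ^ N * exp (- c * (norm x)\<^sup>2)) \<le>
      norm (fact N * exp (1 + 1 / (4 * (c/2))) * exp (- (c/2) * (norm x)\<^sup>2))"
  proof (rule AE_I2)
    fix x :: "real^'d"
    have "(1 + norm x) ^ N * exp (- c * (norm x)\<^sup>2) \<le>
      fact N * exp (1 + 1 / (4 * (c/2))) * exp (c/2 * (norm x)\<^sup>2) * exp (- c * (norm x)\<^sup>2)"
      using assms poly_le_exp_square[of "c/2" "norm x" N] by (intro mult_right_mono) auto
    also have "\<dots> = fact N * exp (1 + 1 / (4 * (c/2))) * exp (- (c/2) * (norm x)\<^sup>2)"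
      by (simp add: mult.assoc flip: exp_add)
    finally show "norm ((1 + norm x) ^ N * exp (- c * (norm x)\<^sup>2)) \<le>
      norm (fact N * exp (1 + 1 / (4 * (c/2))) * exp (- (c/2) * (norm x)\<^sup>2))" by simp
  qed
qed measurable

section \<open>Exponential series in several variables\<close>

definition msize :: "('d::finite \<Rightarrow> nat) \<Rightarrow> real" where
  "msize m = (\<Sum>j\<in>UNIV. real (m j))"

definition mdot :: "('d::finite \<Rightarrow> nat) \<Rightarrow> ('d \<Rightarrow> complex) \<Rightarrow> complex" where
  "mdot m w = (\<Sum>j\<in>UNIV. of_nat (m j) * w j)"

text \<open>A power series in logarithmic coordinates \<open>z j = exp (w j)\<close>: a torus
  becomes a box in the imaginary directions, and differentiation multiplies the coefficients by a
  linear form in \<open>m\<close>.\<close>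

definition exp_series :: "(('d::finite \<Rightarrow> nat) \<Rightarrow> complex) \<Rightarrow> ('d \<Rightarrow> complex) \<Rightarrow> complex" where
  "exp_series f w = (\<Sum>\<^sub>\<infinity>m. f m * exp (mdot m w))"

text \<open>Absolute convergence at the point with all \<open>z j = exp r\<close>. For
  \<open>r > 0\<close> this is a margin of analyticity beyond the torus
  \<open>Re (w j) = 0\<close>.\<close>

definition exp_summable :: "(('d::finite \<Rightarrow> nat) \<Rightarrow> complex) \<Rightarrow> real \<Rightarrow> bool" where
  "exp_summable f r \<longleftrightarrow> (\<lambda>m. norm (f m) * exp (r * msize m)) summable_on UNIV"

definition exp_abs_summable :: "(('d::finite \<Rightarrow> nat) \<Rightarrow> complex) \<Rightarrow> ('d \<Rightarrow> complex) \<Rightarrow> bool" where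
  "exp_abs_summable f w \<longleftrightarrow> (\<lambda>m. f m * exp (mdot m w)) abs_summable_on UNIV"

lemma msize_nonneg [simp]: "msize m \<ge> 0"
  by (simp add: msize_def sum_nonneg)

lemma mdot_add: "mdot (\<lambda>j. p j + q j) w = mdot p w + mdot q w"
  by (simp add: mdot_def algebra_simps sum.distrib)

lemma mdot_scale: "mdot m (\<lambda>j. c * w j) = c * mdot m w"
  by (simp add: mdot_def sum_distrib_left mult_ac)

lemma norm_mdot_le:
  assumes "\<And>j. norm (w j) \<le> W"
  shows "norm (mdot m w) \<le> W * msize m"
proof -
  have "norm (mdot m w) \<le> (\<Sum>j\<in>UNIV. real (m j) * norm (w j))"
    unfolding mdot_def by (rule order_trans[OF norm_sum]) (simp add: norm_mult)
  also have "\<dots> \<le> (\<Sum>j\<in>UNIV. real (m j) * W)"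
    by (intro sum_mono mult_left_mono assms) auto
  finally show ?thesis by (simp add: msize_def sum_distrib_left mult.commute)
qed

lemma Re_mdot_le:
  assumes "\<And>j. Re (w j) \<le> r"
  shows "Re (mdot m w) \<le> r * msize m"
proof -
  have "Re (mdot m w) = (\<Sum>j\<in>UNIV. real (m j) * Re (w j))" by (simp add: mdot_def)
  also have "\<dots> \<le> (\<Sum>j\<in>UNIV. real (m j) * r)"
    by (intro sum_mono mult_left_mono assms) auto
  finally show ?thesis by (simp add: msize_def sum_distrib_left mult.commute)
qed

lemma exp_summable_mono:
  assumes "exp_summable f r" "s \<le> r" shows "exp_summable f s"
  using assms unfolding exp_summable_def
  by (elim summable_on_comparison_test) (auto intro!: mult_left_mono mult_right_mono)

lemma norm_exp_mdot_le:
  assumes "\<And>j. Re (w j) \<le> r"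
  shows "norm (f m * exp (mdot m w)) \<le> norm (f m) * exp (r * msize m)"
  using Re_mdot_le[OF assms, of m] by (auto simp: norm_mult intro!: mult_left_mono)

lemma exp_summable_exp_abs_summable:
  assumes "exp_summable f r" "\<And>j. Re (w j) \<le> r" shows "exp_abs_summable f w"
  unfolding exp_abs_summable_def
  by (rule summable_on_comparison_test[OF assms(1)[unfolded exp_summable_def]])
     (use norm_exp_mdot_le[OF assms(2)] in auto)

lemma norm_exp_series_le:
  assumes "exp_summable f r" "\<And>j. Re (w j) \<le> r"
  shows "norm (exp_series f w) \<le> (\<Sum>\<^sub>\<infinity>m. norm (f m) * exp (r * msize m))"
  unfolding exp_series_def using assms(1) norm_exp_mdot_le[OF assms(2)]
  by (intro norm_infsum_le[OF has_sum_infsum has_sum_infsum])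
     (auto simp: exp_summable_def intro!: abs_summable_summable[OF exp_summable_exp_abs_summable[OF assms, unfolded exp_abs_summable_def]])

lemma uniform_limit_exp_series:
  assumes "exp_summable f r" "\<And>y j. y \<in> Y \<Longrightarrow> Re (w y j) \<le> r"
  shows "uniform_limit Y (\<lambda>X y. \<Sum>m\<in>X. f m * exp (mdot m (w y))) (\<lambda>y. exp_series f (w y)) (finite_subsets_at_top UNIV)"
  unfolding exp_series_def
  by (rule Weierstrass_m_test_general[OF _ assms(1)[unfolded exp_summable_def]])
     (use norm_exp_mdot_le[OF assms(2)] in auto)

lemma continuous_on_exp_series:
  fixes w :: "'a::topological_space \<Rightarrow> 'd::finite \<Rightarrow> complex"
  assumes "exp_summable f r" "\<And>y j. y \<in> Y \<Longrightarrow> Re (w y j) \<le> r" "\<And>j. continuous_on Y (\<lambda>y. w y j)"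
  shows "continuous_on Y (\<lambda>y. exp_series f (w y))"
proof (rule uniform_limit_theorem)
  show "uniform_limit Y (\<lambda>X y. \<Sum>m\<in>X. f m * exp (mdot m (w y))) (\<lambda>y. exp_series f (w y)) (finite_subsets_at_top UNIV)"
    by (rule uniform_limit_exp_series[OF assms(1,2)])
  show "\<forall>\<^sub>F X in finite_subsets_at_top UNIV. continuous_on Y (\<lambda>y. \<Sum>m\<in>X. f m * exp (mdot m (w y)))"
    unfolding mdot_def by (intro always_eventually allI continuous_intros assms(3))
qed auto

text \<open>A factor of linear growth costs an arbitrarily small part of the radius, because
  \<open>t \<le> exp ((r - s) * t) / (r - s)\<close>. This keeps termwise derivatives
  summable.\<close>

lemma exp_summable_mult:
  assumes "exp_summable f r" "s < r" "\<And>m. norm (g m) \<le> K * msize m"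
  shows "exp_summable (\<lambda>m. f m * g m) s"
  unfolding exp_summable_def
proof (rule summable_on_comparison_test)
  show "(\<lambda>m. \<bar>K\<bar> / (r - s) * (norm (f m) * exp (r * msize m))) summable_on UNIV"
    using assms(1) unfolding exp_summable_def by (rule summable_on_cmult_right)
  fix m :: "'a \<Rightarrow> nat"
  have "(r - s) * msize m \<le> exp ((r - s) * msize m)"
    using exp_ge_add_one_self[of "(r - s) * msize m"] by linarith
  then have ms: "msize m \<le> exp ((r - s) * msize m) / (r - s)"
    using assms(2) by (simp add: field_simps)
  have "norm (g m) \<le> \<bar>K\<bar> * msize m"
    by (rule order_trans[OF assms(3)]) (auto intro!: mult_right_mono)
  also have "\<dots> \<le> \<bar>K\<bar> * (exp ((r - s) * msize m) / (r - s))"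
    by (intro mult_left_mono ms) auto
  finally have "norm (f m) * norm (g m) * exp (s * msize m) \<le>
      norm (f m) * (\<bar>K\<bar> * (exp ((r - s) * msize m) / (r - s))) * exp (s * msize m)"
    by (intro mult_right_mono mult_left_mono) auto
  also have "\<dots> = \<bar>K\<bar> / (r - s) * (norm (f m) * exp (r * msize m))"
    by (simp add: left_diff_distrib exp_diff)
  finally show "norm (f m * g m) * exp (s * msize m) \<le> \<bar>K\<bar> / (r - s) * (norm (f m) * exp (r * msize m))"
    by (simp add: norm_mult)
qed auto

lemma exp_summable_mdot:
  assumes "exp_summable f r" "s < r" shows "exp_summable (\<lambda>m. f m * mdot m w) s"
proof (rule exp_summable_mult[OF assms])
  fix m
  show "norm (mdot m w) \<le> Max (range (\<lambda>j. norm (w j))) * msize m"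
    by (rule norm_mdot_le) auto
qed

text \<open>Only restrictions to complex lines through the origin are ever differentiated, with
  \<open>w\<close> frozen and \<open>\<eta>\<close> as variable, so one complex variable suffices.
  Uniform convergence of the finite partial sums on a disc allows termwise differentiation.\<close>

lemma exp_series_has_field_derivative:
  assumes f: "exp_summable f r" and w: "\<And>j. norm (w j) \<le> W" and \<eta>: "norm \<eta> * W < r" and W: "W > 0"
  shows "((\<lambda>\<eta>. exp_series f (\<lambda>j. \<eta> * w j)) has_field_derivative exp_series (\<lambda>m. f m * mdot m w) (\<lambda>j. \<eta> * w j)) (at \<eta>)"
proof -
  have r: "r > 0" using \<eta> W by (smt (verit) mult_nonneg_nonneg norm_ge_zero)
  have "norm \<eta> < r / W" using \<eta> W by (simp add: field_simps)
  \<comment> \<open>A radius strictly between \<open>norm \<eta>\<close> and \<open>r / W\<close>: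
    convergence is uniform on this disc, and \<open>\<rho> * W < r\<close> leaves room for the
    linear factor of the derived series.\<close>
  then obtain \<rho> where "\<rho> > norm \<eta>" "\<rho> < r / W" using dense by blast
  then have \<rho>: "\<rho> > norm \<eta>" "\<rho> < r / W" "\<rho> > 0"
    using norm_ge_zero[of \<eta>] by linarith+
  have re: "Re (y * w j) \<le> \<rho> * W" if "norm y \<le> \<rho>" for y j
  proof -
    have "Re (y * w j) \<le> norm y * norm (w j)" by (metis complex_Re_le_cmod norm_mult)
    also have "\<dots> \<le> \<rho> * W" using that w[of j] W \<rho> by (intro mult_mono) auto
    finally show ?thesis .
  qed
  have \<rho>W: "\<rho> * W < r" using \<rho> W by (simp add: field_simps)
  let ?D = "\<lambda>X y. \<Sum>m\<in>X. f m * mdot m w * exp (mdot m (\<lambda>j. y * w j))"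
  obtain g' where g': "\<And>y. y \<in> ball 0 \<rho> \<Longrightarrow>
      ((\<lambda>\<eta>. exp_series f (\<lambda>j. \<eta> * w j)) has_field_derivative g' y) (at y) \<and> ((\<lambda>X. ?D X y) \<longlongrightarrow> g' y) (finite_subsets_at_top UNIV)"
  proof (rule has_complex_derivative_uniform_limit)
    show "uniform_limit (cball 0 \<rho>) (\<lambda>X y. \<Sum>m\<in>X. f m * exp (mdot m (\<lambda>j. y * w j)))
       (\<lambda>\<eta>. exp_series f (\<lambda>j. \<eta> * w j)) (finite_subsets_at_top UNIV)"
      by (rule uniform_limit_exp_series[OF exp_summable_mono[OF f less_imp_le[OF \<rho>W]]]) (use re in auto)
    show "\<forall>\<^sub>F X in finite_subsets_at_top UNIV. continuous_on (cball 0 \<rho>) (\<lambda>y. \<Sum>m\<in>X. f m * exp (mdot m (\<lambda>j. y * w j))) \<and>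
      (\<forall>y\<in>ball 0 \<rho>. ((\<lambda>y. \<Sum>m\<in>X. f m * exp (mdot m (\<lambda>j. y * w j))) has_field_derivative ?D X y) (at y))"
      unfolding mdot_scale
      by (auto intro!: always_eventually continuous_intros derivative_eq_intros sum.cong simp: mult_ac)
  qed (use \<rho> in auto)
  have "((\<lambda>X. ?D X \<eta>) \<longlongrightarrow> exp_series (\<lambda>m. f m * mdot m w) (\<lambda>j. \<eta> * w j)) (finite_subsets_at_top UNIV)"
  proof -
    have "exp_abs_summable (\<lambda>m. f m * mdot m w) (\<lambda>j. \<eta> * w j)"
      by (rule exp_summable_exp_abs_summable[OF exp_summable_mdot[OF f \<rho>W]]) (use re \<rho> in auto)
    from has_sum_infsum[OF abs_summable_summable[OF this[unfolded exp_abs_summable_def]]] show ?thesis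
      unfolding exp_series_def has_sum_def .
  qed
  moreover have \<eta>\<rho>: "\<eta> \<in> ball 0 \<rho>" using \<rho> by auto
  ultimately have "g' \<eta> = exp_series (\<lambda>m. f m * mdot m w) (\<lambda>j. \<eta> * w j)"
    by (intro tendsto_unique[OF finite_subsets_at_top_neq_bot g'[THEN conjunct2]])
  then show ?thesis using g'[OF \<eta>\<rho>] by simp
qed

lemma holomorphic_on_exp_series:
  assumes f: "exp_summable f r" and w: "\<And>j. norm (w j) \<le> W" and W: "W > 0"
  shows "(\<lambda>\<eta>. exp_series f (\<lambda>j. \<eta> * w j)) holomorphic_on ball 0 (r / W)"
proof (subst holomorphic_on_open, goal_cases)
  case 2
  show ?case
  proof (intro ballI exI)
    fix x assume "x \<in> ball (0::complex) (r / W)"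
    then show "((\<lambda>\<eta>. exp_series f (\<lambda>j. \<eta> * w j)) has_field_derivative exp_series (\<lambda>m. f m * mdot m w) (\<lambda>j. x * w j)) (at x)"
      using W by (intro exp_series_has_field_derivative[where W = W, OF f w _ W]) (auto simp: field_simps)
  qed
qed auto

section \<open>Cauchy products and the geometric series in several variables\<close>

lemma finite_mle: "finite {p. mle p (m :: 'd::finite \<Rightarrow> nat)}"
proof -
  have "{p. mle p m} = Pi\<^sub>E UNIV (\<lambda>j. {..m j})" by (auto simp: mle_def PiE_iff)
  then show ?thesis by (simp add: finite_PiE)
qed

text \<open>The double family over pairs \<open>(p, q)\<close> is absolutely summable; indexing it
  by \<open>(p + q, p)\<close> instead makes the inner sums finite, and they are the
  convolution.\<close>

lemma
  fixes f g :: "('d::finite \<Rightarrow> nat) \<Rightarrow> complex"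
  assumes f: "f abs_summable_on UNIV" and g: "g abs_summable_on UNIV"
  shows mconv_abs_summable: "mconv f g abs_summable_on UNIV"
    and infsum_mconv: "(\<Sum>\<^sub>\<infinity>m. mconv f g m) = (\<Sum>\<^sub>\<infinity>m. f m) * (\<Sum>\<^sub>\<infinity>m. g m)"
proof -
  have fg: "(\<lambda>(p, q). f p * g q) abs_summable_on (UNIV \<times> UNIV)"
    by (rule Infinite_Sum.abs_summable_on_Sigma_iff[THEN iffD2])
       (use f g in \<open>auto simp: norm_mult abs_mult infsum_cmult_right' intro!: summable_on_cmult_right summable_on_cmult_left\<close>)
  let ?S = "Sigma (UNIV :: ('d \<Rightarrow> nat) set) (\<lambda>m. {p. mle p m})"
  let ?h = "\<lambda>(m::'d \<Rightarrow> nat, p). (p, \<lambda>j. m j - p j)"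
  have bij: "bij_betw ?h ?S (UNIV \<times> UNIV)"
    by (rule bij_betwI[where g = "\<lambda>(p, q). (\<lambda>j. p j + q j, p)"]) (auto simp: mle_def)
  have 1: "(\<lambda>x. (\<lambda>(p, q). f p * g q) (?h x)) abs_summable_on ?S"
    using summable_on_reindex_bij_betw[OF bij, of "\<lambda>x. norm ((\<lambda>(p, q). f p * g q) x)"] fg by simp
  have 2: "(\<lambda>x. (\<lambda>(p, q). f p * g q) (?h x)) = (\<lambda>(m, p). f p * g (\<lambda>j. m j - p j))"
    by auto
  have 3: "(\<lambda>(m, p). f p * g (\<lambda>j. m j - p j)) abs_summable_on ?S" using 1 by (simp add: case_prod_unfold)
  have "(\<lambda>m. infsum (\<lambda>p. norm (f p * g (\<lambda>j. m j - p j))) {p. mle p m}) abs_summable_on UNIV"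
    using 3 unfolding Infinite_Sum.abs_summable_on_Sigma_iff by auto
  then have "(\<lambda>m. \<Sum>p\<in>{p. mle p m}. norm (f p * g (\<lambda>j. m j - p j))) abs_summable_on UNIV"
    by (simp add: finite_mle)
  then show "mconv f g abs_summable_on UNIV"
    by (rule Infinite_Sum.abs_summable_on_comparison_test) (auto simp: mconv_def intro!: order_trans[OF norm_sum] sum_nonneg)
  have "(\<Sum>\<^sub>\<infinity>m. mconv f g m) = (\<Sum>\<^sub>\<infinity>m. \<Sum>\<^sub>\<infinity>p\<in>{p. mle p m}. f p * g (\<lambda>j. m j - p j))"
    by (simp add: mconv_def finite_mle)
  also have "\<dots> = infsum (\<lambda>(m, p). f p * g (\<lambda>j. m j - p j)) ?S"
    by (rule infsum_Sigma'_banach) (rule abs_summable_summable[OF 3])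
  also have "\<dots> = infsum (\<lambda>(p, q). f p * g q) (UNIV \<times> UNIV)"
    using infsum_reindex_bij_betw[OF bij, of "\<lambda>(p, q). f p * g q"] unfolding 2 .
  also have "\<dots> = (\<Sum>\<^sub>\<infinity>p. \<Sum>\<^sub>\<infinity>q. f p * g q)"
    by (rule infsum_Sigma'_banach[symmetric]) (rule abs_summable_summable[OF fg])
  also have "\<dots> = (\<Sum>\<^sub>\<infinity>m. f m) * (\<Sum>\<^sub>\<infinity>m. g m)"
    by (simp add: infsum_cmult_right' infsum_cmult_left')
  finally show "(\<Sum>\<^sub>\<infinity>m. mconv f g m) = (\<Sum>\<^sub>\<infinity>m. f m) * (\<Sum>\<^sub>\<infinity>m. g m)" .
qed

text \<open>Used twice: with \<open>e m = exp (mdot m w)\<close> to evaluate a convolution at a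
  point, and with \<open>e m\<close> the monomial at the saddle point to pass to the tilted
  coefficients.\<close>

lemma mconv_twist:
  assumes "\<And>p q. e (\<lambda>j. p j + q j) = e p * e q"
  shows "mconv f g m * e m = mconv (\<lambda>m. f m * e m) (\<lambda>m. g m * e m) m"
proof -
  have "e m = e p * e (\<lambda>j. m j - p j)" if "mle p m" for p
    using assms[of p "\<lambda>j. m j - p j"] that by (simp add: mle_def)
  then show ?thesis unfolding mconv_def sum_distrib_right by (intro sum.cong) (auto simp: mult_ac)
qed

lemma mpow_twist:
  assumes "\<And>p q. e (\<lambda>j. p j + q j) = e p * e q" "e (\<lambda>_. 0) = 1"
  shows "mpow f n m * e m = mpow (\<lambda>m. f m * e m) n m"
proof (induction n arbitrary: m)
  case (Suc n)
  show ?case by (simp add: mconv_twist[of e, OF assms(1)] Suc)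
qed (simp add: mone_def assms)

lemma exp_mdot_add: "exp (mdot (\<lambda>j. p j + q j) w) = exp (mdot p w) * exp (mdot q w)"
  by (simp add: mdot_add exp_add)

lemma
  assumes "exp_abs_summable f w" "exp_abs_summable g w"
  shows exp_abs_summable_mconv: "exp_abs_summable (mconv f g) w" and exp_series_mconv: "exp_series (mconv f g) w = exp_series f w * exp_series g w"
  using mconv_abs_summable[OF assms[unfolded exp_abs_summable_def]] infsum_mconv[OF assms[unfolded exp_abs_summable_def]]
  by (simp_all add: exp_abs_summable_def exp_series_def mconv_twist[of "\<lambda>m. exp (mdot m w)", OF exp_mdot_add])

lemma
  assumes "exp_abs_summable f w"
  shows exp_abs_summable_mpow: "exp_abs_summable (mpow f n) w" and exp_series_mpow: "exp_series (mpow f n) w = exp_series f w ^ n"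
proof (induction n)
  case 0
  have "((\<lambda>m. mone m * exp (mdot m w)) has_sum 1) UNIV"
    by (rule has_sum_finite_neutralI[of "{\<lambda>_. 0}"]) (auto simp: mone_def mdot_def)
  moreover have "((\<lambda>m. norm (mone m * exp (mdot m w))) has_sum 1) UNIV"
    by (rule has_sum_finite_neutralI[of "{\<lambda>_. 0}"]) (auto simp: mone_def mdot_def)
  ultimately show "exp_abs_summable (mpow f 0) w" "exp_series (mpow f 0) w = exp_series f w ^ 0"
    by (auto simp: exp_abs_summable_def exp_series_def has_sum_imp_summable infsumI)
next
  case (Suc n)
  then show "exp_abs_summable (mpow f (Suc n)) w" "exp_series (mpow f (Suc n)) w = exp_series f w ^ Suc n"
    using assms by (auto intro: exp_abs_summable_mconv simp: exp_series_mconv)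
qed

text \<open>The product rule for sums gives the value. For absolute summability, every finite set of
  multi-indices lies in a cube, and the sum over a cube is a product of partial geometric
  sums.\<close>

lemma
  fixes z :: "'d::finite \<Rightarrow> complex"
  assumes z: "\<And>j. norm (z j) < 1"
  shows abs_summable_mgeometric: "(\<lambda>m. \<Prod>j\<in>UNIV. z j ^ m j) abs_summable_on UNIV"
    and infsum_mgeometric: "(\<Sum>\<^sub>\<infinity>m. \<Prod>j\<in>UNIV. z j ^ m j) = (\<Prod>j\<in>UNIV. 1 / (1 - z j))"
proof -
  have U: "(UNIV :: ('d \<Rightarrow> nat) set) = Pi\<^sub>E UNIV (\<lambda>_. UNIV)" by auto
  have g: "((\<lambda>k. z j ^ k) has_sum (1 / (1 - z j))) UNIV" "(\<lambda>k. z j ^ k) abs_summable_on UNIV" for j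
  proof -
    have "(\<lambda>k. norm (z j ^ k)) sums (1 / (1 - norm (z j)))"
      using geometric_sums[of "norm (z j)"] z[of j] by (simp add: norm_power)
    then show "(\<lambda>k. z j ^ k) abs_summable_on UNIV"
      by (intro summable_nonneg_imp_summable_on) (auto simp: sums_iff)
    show "((\<lambda>k. z j ^ k) has_sum (1 / (1 - z j))) UNIV"
      using geometric_sums[of "z j"] z[of j]
      by (intro norm_summable_imp_has_sum) (auto simp: norm_power)
  qed
  have "infsum (\<lambda>m. \<Prod>j\<in>UNIV. z j ^ m j) (Pi\<^sub>E UNIV (\<lambda>_. UNIV)) = (\<Prod>j\<in>UNIV. infsum (\<lambda>k. z j ^ k) UNIV)"
    by (rule infsum_prod_PiE_abs) (use g in auto)
  then show "(\<Sum>\<^sub>\<infinity>m. \<Prod>j\<in>UNIV. z j ^ m j) = (\<Prod>j\<in>UNIV. 1 / (1 - z j))"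
    unfolding U[symmetric] infsumI[OF g(1)] .
  show "(\<lambda>m. \<Prod>j\<in>UNIV. z j ^ m j) abs_summable_on UNIV"
  proof (rule nonneg_bdd_above_summable_on)
    show "bdd_above (sum (\<lambda>m. norm (\<Prod>j\<in>UNIV. z j ^ m j)) ` {F. F \<subseteq> UNIV \<and> finite F})"
    proof (rule bdd_aboveI2)
      fix F :: "('d \<Rightarrow> nat) set" assume F: "F \<in> {F. F \<subseteq> UNIV \<and> finite F}"
      define N where "N = Max (insert 0 ((\<lambda>(m, j). m j) ` (F \<times> UNIV)))"
      have N: "m j \<le> N" if "m \<in> F" for m j
        unfolding N_def by (rule Max_ge) (use F that in \<open>auto intro!: finite_imageI\<close>)
      have "(\<Sum>m\<in>F. norm (\<Prod>j\<in>UNIV. z j ^ m j)) \<le> (\<Sum>m\<in>Pi\<^sub>E UNIV (\<lambda>_. {..N}). norm (\<Prod>j\<in>UNIV. z j ^ m j))"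
        by (rule sum_mono2) (use N in \<open>auto simp: finite_PiE\<close>)
      also have "\<dots> = (\<Prod>j\<in>UNIV. \<Sum>k\<le>N. norm (z j) ^ k)"
        by (subst prod_sum_PiE) (auto simp: norm_power prod_norm[symmetric])
      also have "\<dots> \<le> (\<Prod>j\<in>UNIV. 1 / (1 - norm (z j)))"
      proof (rule prod_mono, safe)
        fix j
        show "(\<Sum>k\<le>N. norm (z j) ^ k) \<le> 1 / (1 - norm (z j))"
          using sum_le_suminf[of "\<lambda>k. norm (z j) ^ k" "{..N}"] z[of j] by (simp add: suminf_geometric)
      qed (auto intro!: sum_nonneg)
      finally show "(\<Sum>m\<in>F. norm (\<Prod>j\<in>UNIV. z j ^ m j)) \<le> (\<Prod>j\<in>UNIV. 1 / (1 - norm (z j)))" .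
    qed
  qed auto
qed

lemma exp_mdot: "exp (mdot m w) = (\<Prod>j\<in>UNIV. exp (w j) ^ m j)"
  by (simp add: mdot_def exp_sum exp_of_nat_mult)

lemma
  fixes z :: "'d::finite \<Rightarrow> complex"
  assumes z: "\<And>j. norm (z j * exp (w j)) < 1"
  shows exp_abs_summable_mgeometric: "exp_abs_summable (\<lambda>m. \<Prod>j\<in>UNIV. z j ^ m j) w"
    and exp_series_mgeometric: "exp_series (\<lambda>m. \<Prod>j\<in>UNIV. z j ^ m j) w = (\<Prod>j\<in>UNIV. 1 / (1 - z j * exp (w j)))"
  using abs_summable_mgeometric[OF z] infsum_mgeometric[OF z]
  by (simp_all add: exp_abs_summable_def exp_series_def exp_mdot power_mult_distrib prod.distrib)


section \<open>Extraction of a coefficient by a Fourier integral\<close>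

lemma has_sum_integral_dominated:
  fixes f :: "'i \<Rightarrow> 'a \<Rightarrow> complex"
  assumes f: "\<And>i. integrable M (f i)" and g: "integrable M g"
    and b: "b summable_on UNIV" and fb: "\<And>i x. norm (f i x) \<le> b i * g x"
    and m: "(\<lambda>x. \<Sum>\<^sub>\<infinity>i. f i x) \<in> borel_measurable M"
  shows "((\<lambda>i. \<integral>x. f i x \<partial>M) has_sum (\<integral>x. (\<Sum>\<^sub>\<infinity>i. f i x) \<partial>M)) UNIV"
proof -
  have s: "(\<lambda>i. f i x) abs_summable_on A" for x A
    by (rule summable_on_subset_banach[where A = UNIV],
        rule summable_on_comparison_test[OF summable_on_cmult_left[OF b]]) (use fb in auto)
  \<comment> \<open>Since the bound separates into \<open>b i * g x\<close>, one number, the tail of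
    the sum of \<open>b\<close>, controls the error for all \<open>x\<close> at once. This replaces
    dominated convergence, whose usual form is about sequences, for a sum over an arbitrary index
    type.\<close>
  have tail: "norm ((\<Sum>\<^sub>\<infinity>i. f i x) - (\<Sum>i\<in>F. f i x)) \<le> (infsum b UNIV - sum b F) * g x" if F: "finite F" for F x
  proof -
    have "(\<Sum>\<^sub>\<infinity>i. f i x) - (\<Sum>i\<in>F. f i x) = infsum (\<lambda>i. f i x) (UNIV - F)"
      using F by (subst infsum_Diff) (auto intro: abs_summable_summable s)
    also have "norm \<dots> \<le> infsum (\<lambda>i. norm (f i x)) (UNIV - F)"
      by (rule norm_infsum_bound) (rule s)
    also have "\<dots> \<le> infsum (\<lambda>i. b i * g x) (UNIV - F)"
      by (rule infsum_mono) (auto intro!: s fb summable_on_cmult_left summable_on_subset_banach[OF b])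
    also have "\<dots> = (infsum b UNIV - sum b F) * g x"
      using F by (subst infsum_cmult_left', subst infsum_Diff) (auto intro: b)
    finally show ?thesis .
  qed
  have int: "integrable M (\<lambda>x. \<Sum>\<^sub>\<infinity>i. f i x)"
    by (rule Bochner_Integration.integrable_bound[OF _ m, of "\<lambda>x. infsum b UNIV * g x"])
       (use g tail[of "{}"] in \<open>auto intro!: AE_I2 intro: order_trans[OF _ abs_ge_self]\<close>)
  have "((\<lambda>F. (infsum b UNIV - sum b F) * (\<integral>x. g x \<partial>M)) \<longlongrightarrow> 0) (finite_subsets_at_top UNIV)"
  proof -
    have "(sum b \<longlongrightarrow> infsum b UNIV) (finite_subsets_at_top UNIV)"
      using has_sum_infsum[OF b] unfolding has_sum_def .
    then have "((\<lambda>F. (infsum b UNIV - sum b F) * (\<integral>x. g x \<partial>M)) \<longlongrightarrow> (infsum b UNIV - infsum b UNIV) * (\<integral>x. g x \<partial>M)) (finite_subsets_at_top UNIV)"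
      by (intro tendsto_intros)
    then show ?thesis by simp
  qed
  then have "((\<lambda>F. (\<Sum>i\<in>F. \<integral>x. f i x \<partial>M) - (\<integral>x. (\<Sum>\<^sub>\<infinity>i. f i x) \<partial>M)) \<longlongrightarrow> 0) (finite_subsets_at_top UNIV)"
  proof (rule Lim_null_comparison[rotated])
    show "\<forall>\<^sub>F F in finite_subsets_at_top UNIV. norm ((\<Sum>i\<in>F. \<integral>x. f i x \<partial>M) - (\<integral>x. (\<Sum>\<^sub>\<infinity>i. f i x) \<partial>M))
      \<le> (infsum b UNIV - sum b F) * (\<integral>x. g x \<partial>M)"
    proof (rule eventually_finite_subsets_at_top_weakI)
      fix F :: "'i set" assume F: "finite F"
      have "(\<integral>x. (\<Sum>\<^sub>\<infinity>i. f i x) \<partial>M) - (\<Sum>i\<in>F. \<integral>x. f i x \<partial>M) = (\<integral>x. (\<Sum>\<^sub>\<infinity>i. f i x) - (\<Sum>i\<in>F. f i x) \<partial>M)"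
        using int f by simp
      also have "norm \<dots> \<le> (\<integral>x. (infsum b UNIV - sum b F) * g x \<partial>M)"
      proof (rule order_trans[OF integral_norm_bound integral_mono])
        show "integrable M (\<lambda>x. norm ((\<Sum>\<^sub>\<infinity>i. f i x) - (\<Sum>i\<in>F. f i x)))"
          using int f by auto
      qed (use g tail[OF F] in auto)
      finally show "norm ((\<Sum>i\<in>F. \<integral>x. f i x \<partial>M) - (\<integral>x. (\<Sum>\<^sub>\<infinity>i. f i x) \<partial>M))
        \<le> (infsum b UNIV - sum b F) * (\<integral>x. g x \<partial>M)"
        by (simp add: norm_minus_commute)
    qed
  qed
  then show "((\<lambda>i. \<integral>x. f i x \<partial>M) has_sum (\<integral>x. (\<Sum>\<^sub>\<infinity>i. f i x) \<partial>M)) UNIV"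
    unfolding has_sum_def using LIM_zero_cancel by fast
qed

lemma
  fixes R :: real and k :: int
  assumes R: "R > 0"
  shows integrable_character: "integrable lborel (\<lambda>x. indicator {- pi * R..pi * R} x *\<^sub>R exp (\<i> * of_int k * of_real x / of_real R))"
    and integral_character: "(\<integral>x. indicator {- pi * R..pi * R} x *\<^sub>R exp (\<i> * of_int k * of_real x / of_real R) \<partial>lborel)
      = (if k = 0 then complex_of_real (2 * pi * R) else 0)"
proof -
  let ?f = "\<lambda>x::real. exp (\<i> * of_int k * of_real x / of_real R)"
  have c: "continuous_on {- pi * R..pi * R} ?f"
    using R by (intro continuous_intros) auto
  show "integrable lborel (\<lambda>x. indicator {- pi * R..pi * R} x *\<^sub>R ?f x)"
    using borel_integrable_atLeastAtMost'[OF c] by (simp add: set_integrable_def)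
  show "(\<integral>x. indicator {- pi * R..pi * R} x *\<^sub>R ?f x \<partial>lborel) = (if k = 0 then complex_of_real (2 * pi * R) else 0)"
  proof (cases "k = 0")
    case True
    then show ?thesis using R by (simp add: scaleR_conv_of_real)
  next
    case False
    let ?F = "\<lambda>x::real. of_real R / (\<i> * of_int k) * ?f x"
    have "(\<integral>x. indicator {- pi * R..pi * R} x *\<^sub>R ?f x \<partial>lborel) = ?F (pi * R) - ?F (- pi * R)"
    proof (rule integral_FTC_Icc)
      fix x
      have "((\<lambda>z. of_real R / (\<i> * of_int k) * exp (\<i> * of_int k * z / of_real R)) has_field_derivative ?f x) (at (of_real x))"
        using R False by (auto intro!: derivative_eq_intros simp: field_simps)
      then show "(?F has_vector_derivative ?f x) (at x within {- pi * R..pi * R})"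
        using has_vector_derivative_real_field has_vector_derivative_at_within by blast
    qed (use R c in auto)
    also have "?f (pi * R) = ?f (- pi * R)"
      using R by (intro exp_eq[THEN iffD2] exI[of _ k]) (simp add: field_simps)
    finally show ?thesis using False by simp
  qed
qed

text \<open>Sum and integral may be exchanged, and orthogonality of characters leaves only the term
  with \<open>m = \<kappa>\<close>. The torus has radii \<open>exp (u j)\<close>, and the angles are
  stretched by \<open>R\<close>, which will be \<open>sqrt n\<close>.\<close>

lemma fourier_inversion:
  fixes T :: "('d::finite \<Rightarrow> nat) \<Rightarrow> complex" and u :: "'d \<Rightarrow> real" and R :: real
  assumes T: "exp_abs_summable T (\<lambda>j. of_real (u j))" and R: "R > 0"
    and m: "(\<lambda>x::real^'d. exp_series T (\<lambda>j. Complex (u j) (x $ j / R))) \<in> borel_measurable borel"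
  shows "(\<integral>x. indicator {x. \<forall>j. \<bar>x $ j\<bar> \<le> pi * R} x *\<^sub>R
      (exp_series T (\<lambda>j. Complex (u j) (x $ j / R)) * exp (- mdot \<kappa> (\<lambda>j. Complex (u j) (x $ j / R)))) \<partial>(lborel :: (real^'d) measure))
     = complex_of_real ((2 * pi * R) ^ CARD('d)) * T \<kappa>"
proof -
  let ?B = "{x::real^'d. \<forall>j. \<bar>x $ j\<bar> \<le> pi * R}"
  let ?w = "\<lambda>x::real^'d. \<lambda>j. Complex (u j) (x $ j / R)"
  let ?D = "\<lambda>m. \<Sum>j\<in>UNIV. (real (m j) - real (\<kappa> j)) * u j"
  let ?e = "\<lambda>m x. \<Prod>j\<in>UNIV. indicator {- pi * R..pi * R} (x $ j) *\<^sub>R exp (\<i> * of_int (int (m j) - int (\<kappa> j)) * of_real (x $ j) / of_real R)"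
  \<comment> \<open>The term of index \<open>m\<close> in the integrand, written as a product over
    the coordinates so that its integral factorises. Its modulus on the box is constant in
    \<open>x\<close>, which provides the separated bound.\<close>
  define f where "f = (\<lambda>m x. T m * exp (of_real (?D m)) * ?e m (x :: real^'d))"
  have ind: "complex_of_real (indicator ?B x) = (\<Prod>j\<in>UNIV. complex_of_real (indicator {- pi * R..pi * R} (x $ j)))" for x
    by (auto simp: indicator_def abs_le_iff minus_le_iff prod_eq_1_iff split: if_splits)
  have mw: "mdot m (?w x) = of_real (\<Sum>j\<in>UNIV. real (m j) * u j) + (\<Sum>j\<in>UNIV. \<i> * of_nat (m j) * of_real (x $ j) / of_real R)" for m x
    unfolding mdot_def of_real_sum sum.distrib[symmetric]
    by (intro sum.cong refl) (simp add: complex_eq_iff)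
  have f: "f m x = indicator ?B x *\<^sub>R (T m * exp (mdot m (?w x)) * exp (- mdot \<kappa> (?w x)))" for m x
  proof -
    have "exp (mdot m (?w x)) * exp (- mdot \<kappa> (?w x)) = exp (of_real (?D m)) *
        exp (\<Sum>j\<in>UNIV. \<i> * of_int (int (m j) - int (\<kappa> j)) * of_real (x $ j) / of_real R)"
      unfolding mw exp_add[symmetric]
      by (simp add: sum_subtractf algebra_simps diff_divide_distrib)
    then have "T m * exp (mdot m (?w x)) * exp (- mdot \<kappa> (?w x)) = T m * (exp (of_real (?D m)) *
        (\<Prod>j\<in>UNIV. exp (\<i> * of_int (int (m j) - int (\<kappa> j)) * of_real (x $ j) / of_real R)))"
      by (simp only: mult.assoc exp_sum[OF finite])
    then show ?thesis
      unfolding f_def scaleR_conv_of_real prod.distrib ind[symmetric] by (simp only: mult_ac)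
  qed
  have norm_f: "norm (f m x) = norm (T m * exp (mdot m (\<lambda>j. of_real (u j)))) * (exp (- (\<Sum>j\<in>UNIV. real (\<kappa> j) * u j)) * indicator ?B x)" for m x
    unfolding f by (simp add: norm_mult mdot_def mult_ac)
  have exp_series: "(\<Sum>\<^sub>\<infinity>m. f m x) = indicator ?B x *\<^sub>R (exp_series T (?w x) * exp (- mdot \<kappa> (?w x)))" for x
    unfolding f exp_series_def scaleR_conv_of_real
    by (simp only: infsum_cmult_right' infsum_cmult_left')
  have B: "?B = cbox (\<chi> j. - pi * R) (\<chi> j. pi * R)"
    by (auto simp: mem_box_cart abs_le_iff minus_le_iff)
  have [measurable]: "?B \<in> sets borel" unfolding B by simp
  have Bfin: "integrable lborel (indicator ?B :: real^'d \<Rightarrow> real)"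
    unfolding B by (rule integrable_real_indicator) (use emeasure_lborel_cbox_finite in auto)
  have int: "integrable lborel (f m)" for m
    unfolding f_def by (intro integrable_mult_right integrable_vec_prod integrable_character R)
  have [measurable]: "(\<lambda>x::real^'d. Complex (u j) (x $ j / R)) \<in> borel_measurable borel" for j
    unfolding Complex_eq by measurable
  have "((\<lambda>m. \<integral>x. f m x \<partial>lborel) has_sum (\<integral>x. (\<Sum>\<^sub>\<infinity>m. f m x) \<partial>lborel)) UNIV"
  proof (rule has_sum_integral_dominated[OF int, where g = "\<lambda>x. exp (- (\<Sum>j\<in>UNIV. real (\<kappa> j) * u j)) * indicator ?B x"])
    show "(\<lambda>m. norm (T m * exp (mdot m (\<lambda>j. of_real (u j))))) summable_on UNIV"
      using T by (simp add: exp_abs_summable_def)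
    show "(\<lambda>x. \<Sum>\<^sub>\<infinity>m. f m x) \<in> borel_measurable lborel"
      unfolding exp_series mdot_def using m by measurable
  qed (use Bfin norm_f in auto)
  moreover have "((\<lambda>m. \<integral>x. f m x \<partial>lborel) has_sum (complex_of_real ((2 * pi * R) ^ CARD('d)) * T \<kappa>)) UNIV"
  proof -
    have "(\<integral>x. f m x \<partial>lborel) = (if m = \<kappa> then complex_of_real ((2 * pi * R) ^ CARD('d)) * T \<kappa> else 0)" for m
    proof -
      have "(\<integral>x. f m x \<partial>lborel) = T m * exp (of_real (?D m)) *
          (\<Prod>j\<in>UNIV. if int (m j) - int (\<kappa> j) = 0 then complex_of_real (2 * pi * R) else 0)"
        unfolding f_def integral_mult_right_zero integral_vec_prod[OF integrable_character[OF R]] integral_character[OF R] ..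
      moreover have "\<exists>j. int (m j) - int (\<kappa> j) \<noteq> 0" if "m \<noteq> \<kappa>" using that by (auto simp: fun_eq_iff)
      ultimately show ?thesis by (cases "m = \<kappa>") auto
    qed
    then show ?thesis
      by (intro has_sum_finite_neutralI[of "{\<kappa>}"]) auto
  qed
  ultimately show ?thesis
    unfolding exp_series using has_sum_unique by blast
qed

section \<open>Taylor remainders and uniform aperiodicity\<close>

text \<open>Cauchy's inequality on the circle of radius \<open>\<rho> / 2\<close>, because
  \<open>f\<close> is only controlled on the open disc; hence the 2 in the bound.\<close>

lemma norm_taylor_coeff_le:
  assumes f: "f holomorphic_on ball 0 \<rho>" and M: "\<And>z. norm z < \<rho> \<Longrightarrow> norm (f z) \<le> M" and \<rho>: "\<rho> > 0"
  shows "norm ((deriv ^^ k) f 0 / fact k) \<le> M * (2 / \<rho>) ^ k"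
proof -
  have "norm ((deriv ^^ k) f 0) \<le> fact k * M / (\<rho> / 2) ^ k"
  proof (rule Cauchy_inequality)
    show "f holomorphic_on ball 0 (\<rho>/2)" by (rule holomorphic_on_subset[OF f]) (use \<rho> in auto)
    show "continuous_on (cball 0 (\<rho>/2)) f"
      by (rule continuous_on_subset[OF holomorphic_on_imp_continuous_on[OF f]]) (use \<rho> in auto)
  qed (use \<rho> M in auto)
  then show ?thesis by (simp add: norm_divide field_simps power_divide)
qed

text \<open>The quotient is the shifted power series. For \<open>norm z \<le> \<rho> / 4\<close> the
  bound for the coefficients makes its terms decay like \<open>(1/2) ^ k\<close>, and their sum
  accounts for the leading factor 2.\<close>

lemma taylor_quotient:
  assumes f: "f holomorphic_on ball 0 \<rho>" and M: "\<And>z. norm z < \<rho> \<Longrightarrow> norm (f z) \<le> M" and \<rho>: "\<rho> > 0"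
  shows "\<exists>q. q holomorphic_on ball 0 \<rho> \<and>
    (\<forall>z. norm z < \<rho> \<longrightarrow> f z = (\<Sum>k<r. (deriv ^^ k) f 0 / fact k * z ^ k) + z ^ r * q z) \<and>
    (\<forall>z. norm z \<le> \<rho> / 4 \<longrightarrow> norm (q z) \<le> 2 * M * (2 / \<rho>) ^ r)"
proof -
  define c where "c k = (deriv ^^ k) f 0 / fact k" for k
  have c: "norm (c k) \<le> M * (2 / \<rho>) ^ k" for k
    unfolding c_def by (rule norm_taylor_coeff_le[OF f M \<rho>])
  have M0: "M \<ge> 0" using M[of 0] \<rho> norm_ge_zero order_trans by (metis norm_zero)
  have sums: "(\<lambda>k. c k * z ^ k) sums f z" if "norm z < \<rho>" for z
    using holomorphic_power_series[OF f, of z] that by (simp add: c_def)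
  define q where "q z = (\<Sum>k. c (k + r) * z ^ k)" for z
  have qs: "(\<lambda>k. c (k + r) * z ^ k) sums q z" if z: "norm z < \<rho>" for z
  proof (cases "z = 0")
    case True
    then show ?thesis unfolding q_def by (intro summable_sums) (auto intro: summable_comparison_test_ev summable_finite[of "{0}"])
  next
    case False
    have "(\<lambda>k. c (k + r) * z ^ (k + r)) sums (f z - (\<Sum>k<r. c k * z ^ k))"
      using sums_split_initial_segment[OF sums[OF z]] .
    from sums_divide[OF this, of "z ^ r"] have "(\<lambda>k. c (k + r) * z ^ k) sums ((f z - (\<Sum>k<r. c k * z ^ k)) / z ^ r)"
      using False by (simp add: power_add)
    then show ?thesis unfolding q_def by (metis sums_summable summable_sums)
  qed
  show ?thesis
  proof (intro exI[of _ q] conjI allI impI)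
    show "q holomorphic_on ball 0 \<rho>"
      by (rule power_series_holomorphic[where a = "\<lambda>k. c (k + r)"]) (use qs in auto)
    show "f z = (\<Sum>k<r. (deriv ^^ k) f 0 / fact k * z ^ k) + z ^ r * q z" if z: "norm z < \<rho>" for z
    proof -
      have "(\<lambda>k. c (k + r) * z ^ (k + r)) sums (f z - (\<Sum>k<r. c k * z ^ k))"
        using sums_split_initial_segment[OF sums[OF z]] .
      moreover have "(\<lambda>k. c (k + r) * z ^ (k + r)) sums (z ^ r * q z)"
        using sums_mult[OF qs[OF z], of "z ^ r"] by (simp add: power_add mult_ac)
      ultimately have "f z - (\<Sum>k<r. c k * z ^ k) = z ^ r * q z" by (rule sums_unique2)
      then show ?thesis by (simp add: c_def algebra_simps)
    qed
    show "norm (q z) \<le> 2 * M * (2 / \<rho>) ^ r" if z: "norm z \<le> \<rho> / 4" for z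
    proof -
      have le: "norm (c (k + r) * z ^ k) \<le> M * (2 / \<rho>) ^ r * (1/2) ^ k" for k
      proof -
        have "norm (c (k + r) * z ^ k) \<le> (M * (2 / \<rho>) ^ (k + r)) * (\<rho> / 4) ^ k"
          unfolding norm_mult norm_power using z M0 \<rho> by (intro mult_mono c power_mono) auto
        also have "\<dots> = M * (2 / \<rho>) ^ r * ((2 / \<rho>) * (\<rho> / 4)) ^ k"
          by (simp only: power_add power_mult_distrib mult_ac)
        also have "(2 / \<rho>) * (\<rho> / 4) = 1 / 2" using \<rho> by simp
        finally show ?thesis .
      qed
      have g: "(\<lambda>k. M * (2 / \<rho>) ^ r * (1/2) ^ k) sums (M * (2 / \<rho>) ^ r * 2)"
        using sums_mult[OF geometric_sums[of "1/2 :: real"], of "M * (2 / \<rho>) ^ r"] by simp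
      have "norm (q z) \<le> (\<Sum>k. M * (2 / \<rho>) ^ r * (1/2) ^ k)"
        unfolding q_def by (rule norm_suminf_le[OF le]) (use g in \<open>auto simp: sums_iff\<close>)
      then show ?thesis using g by (simp add: sums_iff mult_ac)
    qed
  qed
qed

text \<open>The factor \<open>1 / (1 - z exp u)\<close> of the generating function; for \<open>z = 1\<close> its pole at \<open>u = 0\<close>
  is removed by multiplying with \<open>-u\<close>.\<close>

definition geo_fac :: "real \<Rightarrow> complex \<Rightarrow> complex" where
  "geo_fac z u = (if z = 1 then (if u = 0 then 1 else u / (exp u - 1)) else 1 / (1 - of_real z * exp u))"

text \<open>\<open>geo_fac z\<close> is the reciprocal of an entire function that does not vanish at
  0, so on a small disc it is holomorphic and at most twice as large as at 0.\<close>

lemma geo_fac_local: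
  obtains e M where "e > 0" "geo_fac z holomorphic_on ball 0 e" "\<And>u. norm u < e \<Longrightarrow> norm (geo_fac z u) \<le> M"
proof -
  define D where "D u = (if z = 1 then (if u = 0 then 1 else (exp u - 1) / u) else 1 - of_real z * exp u)" for u :: complex
  have "D holomorphic_on UNIV"
  proof (cases "z = 1")
    case True
    \<comment> \<open>The difference quotient of \<open>exp\<close> at 0, with the derivative as
      value at the removable singularity, is entire.\<close>
    have "(\<lambda>u. if u = 0 then deriv exp 0 else (exp u - exp 0) / (u - 0)) holomorphic_on (UNIV :: complex set)"
      by (rule pole_lemma) (auto intro!: holomorphic_intros)
    moreover have "deriv exp (0::complex) = 1" using DERIV_imp_deriv[OF DERIV_exp, of 0] by simp
    ultimately show ?thesis
      using True by (simp add: D_def[abs_def] cong: if_cong)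
  next
    case False
    then show ?thesis unfolding D_def by (auto intro!: holomorphic_intros)
  qed
  then have hD: "D holomorphic_on A" for A using holomorphic_on_subset by blast
  have D0: "D 0 \<noteq> 0" by (auto simp: D_def)
  have "isCont D 0"
    using hD[of UNIV] by (metis holomorphic_on_imp_continuous_on continuous_on_eq_continuous_at open_UNIV UNIV_I)
  then obtain e where e: "e > 0" "\<And>u. norm u < e \<Longrightarrow> norm (D u - D 0) < norm (D 0) / 2"
    using D0 unfolding continuous_at_eps_delta dist_norm by (metis diff_zero zero_less_divide_iff zero_less_norm_iff zero_less_numeral)
  have low: "norm (D u) \<ge> norm (D 0) / 2" if "norm u < e" for u
    using e(2)[OF that] norm_triangle_ineq2[of "D 0" "D u"] by (simp add: norm_minus_commute)
  have eq: "geo_fac z u = inverse (D u)" for u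
    by (auto simp: geo_fac_def D_def divide_simps)
  show ?thesis
  proof
    show "e > 0" by fact
    show "geo_fac z holomorphic_on ball 0 e"
      unfolding eq using low D0 by (intro holomorphic_intros hD) (fastforce simp: eq[abs_def])
    show "norm (geo_fac z u) \<le> 2 / norm (D 0)" if "norm u < e" for u
      using le_imp_inverse_le[OF low[OF that]] D0 by (simp add: eq norm_inverse)
  qed
qed

text \<open>On the shifted contour \<open>norm (exp u) = exp (- h)\<close>, and
  \<open>exp (- h) \<le> 1 - h / 2\<close> for \<open>h \<le> 1\<close>, so the denominator is at
  least \<open>h / 2\<close>. With \<open>u = h w\<close> the bound becomes
  \<open>2 * norm w\<close>, free of \<open>h\<close>.\<close>

lemma geo_fac_global:
  assumes z: "0 \<le> z" "z \<le> 1" and h: "0 < h" "h \<le> 1" and u: "Re u = - h * of_bool (z = 1)"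
  shows "norm (geo_fac z u) \<le> (if z = 1 then 2 * norm u / h else 1 / (1 - z))"
proof (cases "z = 1")
  case True
  have "exp (- h) \<le> 1 / (1 + h)"
    using exp_ge_add_one_self[of h] h by (simp add: exp_minus field_simps)
  also have "\<dots> \<le> 1 - h / 2" using h by (simp add: field_simps mult_left_le)
  finally have "h / 2 \<le> 1 - norm (exp u)" using True u by simp
  also have "\<dots> \<le> norm (exp u - 1)"
    using norm_triangle_ineq2[of 1 "exp u"] by (simp add: norm_minus_commute)
  finally have *: "h / 2 \<le> norm (exp u - 1)" .
  have "norm u / norm (exp u - 1) \<le> norm u / (h / 2)"
    using * h by (intro divide_left_mono mult_pos_pos) auto
  moreover have "u \<noteq> 0" using u True h by auto
  ultimately show ?thesis using True by (simp add: geo_fac_def norm_divide mult.commute)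
next
  case False
  have "1 - z \<le> norm (1 - of_real z * exp u)"
    using norm_triangle_ineq2[of 1 "of_real z * exp u"] False u z by (simp add: norm_mult)
  then have "1 / norm (1 - of_real z * exp u) \<le> 1 / (1 - z)"
    using False z by (intro frac_le) auto
  then show ?thesis using False by (simp add: geo_fac_def norm_divide)
qed

section \<open>Full rank and aperiodicity on the torus\<close>

lemma full_rank_separates:
  assumes "full_rank b" "u \<noteq> 0"
  obtains m n where "m \<in> support b" "n \<in> support b" "u \<bullet> (ivec n - ivec m) \<noteq> 0"
proof -
  have "span {ivec n - ivec m |n m. n \<in> support b \<and> m \<in> support b} = UNIV"
    using assms(1) unfolding full_rank_def by (subst dim_eq_full[symmetric]) simp
  then have "u \<in> span {ivec n - ivec m |n m. n \<in> support b \<and> m \<in> support b}" by simp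
  moreover have "\<not> orthogonal u u" using assms(2) by (simp add: orthogonal_self)
  ultimately have "\<exists>y\<in>{ivec n - ivec m |n m. n \<in> support b \<and> m \<in> support b}. \<not> orthogonal u y"
    using orthogonal_to_span by blast
  then show ?thesis using that by (auto simp: orthogonal_def)
qed

lemma det_Ints:
  fixes A :: "real^'d::finite^'d"
  assumes "\<And>i j. A $ i $ j \<in> \<int>" shows "det A \<in> \<int>"
  unfolding det_def by (intro Ints_sum Ints_mult Ints_prod assms Ints_of_int)

text \<open>The vector \<open>x = \<theta> / (2 pi)\<close> has integral products with all
  differences of support points. Choosing \<open>d\<close> independent differences, Cramer's rule
  shows \<open>x = y / q\<close> with \<open>y\<close> integral and \<open>q\<close> the modulus of
  an integral determinant. Modulo \<open>q\<close>, the product of \<open>y\<close> with a support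
  point is constant, so aperiodicity forces \<open>q\<close> to divide \<open>y\<close>. Thus
  \<open>x\<close> is integral, and it is too small to be nonzero.\<close>

lemma aperiodic_torus:
  fixes b :: "('d::finite \<Rightarrow> nat) \<Rightarrow> real" and \<theta> :: "real^'d"
  assumes fr: "full_rank b" and ap: "aperiodic b" and \<theta>: "\<And>j. \<bar>\<theta> $ j\<bar> \<le> pi"
    and cos: "\<And>m n. m \<in> support b \<Longrightarrow> n \<in> support b \<Longrightarrow> cos (\<theta> \<bullet> (ivec n - ivec m)) = 1"
  shows "\<theta> = 0"
proof -
  let ?D = "{ivec n - ivec m |n m. n \<in> support b \<and> m \<in> support b} :: (real^'d) set"
  define x where "x = (1 / (2 * pi)) *\<^sub>R \<theta>"
  have xint: "x \<bullet> v \<in> \<int>" if "v \<in> ?D" for v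
  proof -
    have "cos (\<theta> \<bullet> v) = 1" using that cos by auto
    then obtain k :: int where "\<theta> \<bullet> v = of_int k * 2 * pi" unfolding cos_one_2pi_int by blast
    then have "x \<bullet> v = of_int k" by (simp add: x_def)
    then show ?thesis by simp
  qed
  obtain B where B: "B \<subseteq> ?D" "independent B" "?D \<subseteq> span B" "card B = dim ?D"
    using basis_exists by blast
  have spB: "span B = UNIV"
    using fr dim_eq_full[of ?D] span_mono[OF B(3)] unfolding full_rank_def by (auto simp: span_span)
  have "finite B" using B(2) by (rule independent_imp_finite)
  moreover have "card (UNIV :: 'd set) = card B" using B(4) fr by (simp add: full_rank_def)
  ultimately obtain f where f: "bij_betw f (UNIV :: 'd set) B"
    using finite_same_card_bij finite_class.finite_UNIV by blast
  \<comment> \<open>The rows of \<open>V\<close> are the chosen differences, so \<open>V\<close> and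
    \<open>V *v x\<close> both have integral entries.\<close>
  define V :: "real^'d^'d" where "V = (\<chi> i. f i)"
  have "V $ i \<in> B" for i using f by (auto simp: V_def bij_betw_def)
  then have Vi: "V $ i \<in> ?D" for i using B(1) by blast
  have mv: "(V *v y) $ i = V $ i \<bullet> y" for y i by (simp add: matrix_vector_mult_def inner_vec_def)
  have "y = 0" if "V *v y = 0" for y
  proof -
    have "orthogonal y v" if "v \<in> B" for v
    proof -
      obtain i where "v = f i" using f \<open>v \<in> B\<close> by (auto simp: bij_betw_def)
      then show ?thesis using mv[of y i] \<open>V *v y = 0\<close> by (simp add: orthogonal_def V_def inner_commute)
    qed
    then have "orthogonal y y" using orthogonal_to_span[of y B y] spB by auto
    then show ?thesis by (simp add: orthogonal_self)
  qed
  then have dV: "det V \<noteq> 0"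
    using matrix_left_invertible_ker[of V] invertible_left_inverse[of V] invertible_det_nz[of V] by blast
  have Vint: "V $ i $ j \<in> \<int>" for i j using Vi[of i] by (auto simp: ivec_def)
  define q where "q = nat \<lfloor>\<bar>det V\<bar>\<rfloor>"
  have "\<bar>det V\<bar> \<in> \<int>" using det_Ints[OF Vint] by (auto simp: abs_if)
  then have q: "real q = \<bar>det V\<bar>" unfolding q_def by (auto elim!: Ints_cases)
  have "det V * x $ k \<in> \<int>" for k
  proof -
    have "x = (\<chi> k. det (\<chi> i j. if j = k then (V *v x) $ i else V $ i $ j) / det V)"
      using cramer[OF dV, of x "V *v x"] by simp
    then have "x $ k = det (\<chi> i j. if j = k then (V *v x) $ i else V $ i $ j) / det V"
      by (metis (no_types, lifting) vec_lambda_beta)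
    then have "det V * x $ k = det (\<chi> i j. if j = k then (V *v x) $ i else V $ i $ j)"
      using dV by (simp add: field_simps)
    also have "\<dots> \<in> \<int>"
      by (rule det_Ints) (use Vint xint[OF Vi] in \<open>auto simp: mv inner_commute\<close>)
    finally show ?thesis .
  qed
  then have "real q * x $ k \<in> \<int>" for k
    unfolding q by (auto simp: abs_if)
  then have "\<forall>k. \<exists>y::int. real q * x $ k = of_int y" by (auto elim!: Ints_cases)
  then obtain y :: "'d \<Rightarrow> int" where y: "\<And>k. real q * x $ k = of_int (y k)" by metis
  have q0: "q > 0" using q dV by (intro Nat.gr0I) auto
  \<comment> \<open>Reduction modulo \<open>q\<close> because aperiodicity speaks of nonnegative
    exponents; residues and divisibility by \<open>q\<close> are unaffected.\<close>
  define p where "p k = nat (y k mod int q)" for k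
  have p: "int (p k) = y k mod int q" for k using q0 by (simp add: p_def)
  have "q dvd p k" for k
  proof (cases "q \<ge> 2")
    case True
    have modp: "int (\<Sum>j\<in>UNIV. p j * n j) mod int q = (\<Sum>j\<in>UNIV. y j * int (n j)) mod int q" for n :: "'d \<Rightarrow> nat"
    proof -
      have "(\<Sum>j\<in>UNIV. (y j mod int q) * int (n j)) mod int q = (\<Sum>j\<in>UNIV. (y j mod int q) * int (n j) mod int q) mod int q"
        by (rule mod_sum_eq[symmetric])
      also have "\<dots> = (\<Sum>j\<in>UNIV. y j * int (n j) mod int q) mod int q"
        by (simp only: mod_mult_left_eq)
      also have "\<dots> = (\<Sum>j\<in>UNIV. y j * int (n j)) mod int q" by (rule mod_sum_eq)
      finally show ?thesis by (simp add: p)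
    qed
    have mods: "int (\<Sum>j\<in>UNIV. p j * n j) mod int q = int (\<Sum>j\<in>UNIV. p j * m j) mod int q"
      if "n \<in> support b" "m \<in> support b" for m n
    proof -
      have "x \<bullet> (ivec n - ivec m) \<in> \<int>" using xint that by blast
      then obtain k where k: "x \<bullet> (ivec n - ivec m) = of_int k" by (auto elim!: Ints_cases)
      have "of_int ((\<Sum>j\<in>UNIV. y j * int (n j)) - (\<Sum>j\<in>UNIV. y j * int (m j))) = real q * (x \<bullet> (ivec n - ivec m))"
        by (simp add: inner_vec_def ivec_def sum_distrib_left y[symmetric] sum_subtractf algebra_simps)
      also have "\<dots> = of_int (int q * k)" using k by simp
      finally have "(\<Sum>j\<in>UNIV. y j * int (n j)) - (\<Sum>j\<in>UNIV. y j * int (m j)) = int q * k"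
        by (simp only: of_int_eq_iff)
      then show ?thesis unfolding modp by (simp add: mod_eq_dvd_iff)
    qed
    have "\<exists>r. \<forall>n\<in>support b. int (\<Sum>j\<in>UNIV. p j * n j) mod int q = r"
    proof (cases "support b = {}")
      case False
      then obtain m0 where "m0 \<in> support b" by blast
      then show ?thesis using mods[of _ m0] by blast
    qed simp
    then obtain r where r: "\<And>n. n \<in> support b \<Longrightarrow> int (\<Sum>j\<in>UNIV. p j * n j) mod int q = r" by blast
    \<comment> \<open>\<open>r\<close> is the common residue in the range from 0 to
      \<open>q - 1\<close>, so the multiple of \<open>q\<close> is given by the quotient of natural
      numbers and is nonnegative, as the definition demands.\<close>
    have "\<exists>k. int (\<Sum>j\<in>UNIV. p j * n j) = r + int q * int k" if "n \<in> support b" for n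
    proof (intro exI)
      show "int (\<Sum>j\<in>UNIV. p j * n j) = r + int q * int ((\<Sum>j\<in>UNIV. p j * n j) div q)"
        unfolding r[OF that, symmetric] zdiv_int by simp
    qed
    then show ?thesis using ap True unfolding aperiodic_def by blast
  next
    case False
    then show ?thesis using q0 by (cases "q = 1") auto
  qed
  then have "int q dvd int (p k)" for k by simp
  then have qy: "int q dvd y k" for k
    unfolding p by (simp add: dvd_mod_iff)
  have "x $ k = 0" for k
  proof -
    obtain t where "y k = int q * t" using qy[of k] by (elim dvdE)
    then have "x $ k = of_int t" using y[of k] q0 by simp
    moreover have "\<bar>\<theta> $ k\<bar> < 2 * pi" using \<theta>[of k] pi_gt_zero by linarith
    then have "\<bar>x $ k\<bar> < 1" by (simp add: x_def abs_mult field_simps)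
    ultimately have "t = 0" by linarith
    then show ?thesis using \<open>x $ k = of_int t\<close> by simp
  qed
  then have "x = 0" by (simp add: vec_eq_iff)
  then show ?thesis by (simp add: x_def)
qed

text \<open>By Taylor's formula of order 4, \<open>1 - cos y\<close> is at least
  \<open>y^2 / 2 - y^4 / 24\<close>, and \<open>y^4 \<le> y^2\<close> here.\<close>

lemma one_minus_cos_ge:
  fixes y :: real assumes "\<bar>y\<bar> \<le> 1" shows "1 - cos y \<ge> y\<^sup>2 / 4"
proof -
  obtain t where "cos y = (\<Sum>m<4. cos_coeff m * y ^ m) + cos (t + 1/2 * real 4 * pi) / fact 4 * y ^ 4"
    using Maclaurin_cos_expansion[of y 4] by auto
  moreover have "(\<Sum>m<4. cos_coeff m * y ^ m) = cos_coeff 0 * y ^ 0 + cos_coeff 1 * y ^ 1 + cos_coeff 2 * y ^ 2 + cos_coeff 3 * y ^ 3"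
    by (simp add: eval_nat_numeral)
  moreover have "cos_coeff 0 = 1" "cos_coeff 1 = 0" "cos_coeff 2 = - 1 / 2" "cos_coeff 3 = 0"
    by (simp_all add: cos_coeff_def)
  ultimately have "cos y - (1 - y\<^sup>2 / 2) = cos (t + 2 * pi) / 24 * y ^ 4"
    by (simp add: fact_numeral mult.commute)
  then have "\<bar>cos y - (1 - y\<^sup>2 / 2)\<bar> = \<bar>cos (t + 2 * pi)\<bar> * \<bar>y\<bar> ^ 4 / 24"
    by (simp only: abs_mult abs_divide power_abs) (simp only: abs_numeral times_divide_eq_left)?
  then have "\<bar>cos y - (1 - y\<^sup>2 / 2)\<bar> \<le> 1 / 24 * \<bar>y\<bar> ^ 4"
    using mult_right_mono[OF abs_cos_le_one, of "\<bar>y\<bar> ^ 4" "t + 2 * pi"] by simp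
  moreover have "\<bar>y\<bar> ^ 4 \<le> \<bar>y\<bar> ^ 2" using assms by (intro power_decreasing) auto
  ultimately show ?thesis
    using abs_ge_self[of "cos y - (1 - y\<^sup>2 / 2)"] zero_le_power2[of y] unfolding power2_abs by linarith
qed

text \<open>Compactness: if no \<open>c\<close> worked, there would be points \<open>t k\<close>
  violating the bound for \<open>1 / (k + 1)\<close> and every pair. A limit point has all cosines
  equal to 1, so it is 0 by \<open>aperiodic_torus\<close>. Near 0 the cosine is quadratic, so a
  limit of the directions of \<open>t k\<close> is orthogonal to all differences, against full rank.
  The weights are left general so that they can later bound a whole family from below.\<close>

lemma aperiodic_quadratic_bound:
  fixes b :: "('d::finite \<Rightarrow> nat) \<Rightarrow> real" and e :: "('d \<Rightarrow> nat) \<Rightarrow> real"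
  assumes fr: "full_rank b" and ap: "aperiodic b" and e: "\<And>m. m \<in> support b \<Longrightarrow> e m > 0"
  obtains c where "c > 0" "\<And>\<theta>::real^'d. (\<And>j. \<bar>\<theta> $ j\<bar> \<le> pi) \<Longrightarrow>
    \<exists>m\<in>support b. \<exists>n\<in>support b. c * (norm \<theta>)\<^sup>2 \<le> min (e m) (e n) * (1 - cos (\<theta> \<bullet> (ivec n - ivec m)))"
proof (rule ccontr)
  assume no: "\<not> thesis"
  let ?K = "{\<theta>::real^'d. \<forall>j. \<bar>\<theta> $ j\<bar> \<le> pi}"
  have aux: "A / N \<le> 4 / E * S" if "E > 0" "N > 0" "E * (A / 4) \<le> S * N" for A N E S :: real
    using that by (simp add: field_simps)
  let ?g = "\<lambda>m n \<theta>. min (e m) (e n) * (1 - cos (\<theta> \<bullet> (ivec n - ivec m)))"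
  have "\<exists>\<theta>\<in>?K. \<forall>m\<in>support b. \<forall>n\<in>support b. ?g m n \<theta> < 1 / real (Suc k) * (norm \<theta>)\<^sup>2" for k
    using no that[of "1 / real (Suc k)"] by (force simp: not_le)
  then obtain t where t: "\<And>k. t k \<in> ?K"
    "\<And>k m n. m \<in> support b \<Longrightarrow> n \<in> support b \<Longrightarrow> ?g m n (t k) < 1 / real (Suc k) * (norm (t k))\<^sup>2" by metis
  have K: "?K = cbox (\<chi> j. - pi) (\<chi> j. pi)"
    by (auto simp: mem_box_cart abs_le_iff minus_le_iff)
  have "compact ?K" unfolding K by simp
  then have "\<exists>\<theta>\<in>?K. \<exists>s. strict_mono s \<and> (t \<circ> s) \<longlonglongrightarrow> \<theta>"
    unfolding compact_def using t(1) by (elim allE[of _ t]) blast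
  then obtain \<theta> s where s: "\<theta> \<in> ?K" "strict_mono s" "(t \<circ> s) \<longlonglongrightarrow> \<theta>" by blast
  have inv: "(\<lambda>k. 1 / real (Suc (s k))) \<longlonglongrightarrow> 0"
    using LIMSEQ_subseq_LIMSEQ[OF LIMSEQ_inverse_real_of_nat s(2)] by (simp add: o_def inverse_eq_divide)
  have ts: "(\<lambda>k. t (s k)) \<longlonglongrightarrow> \<theta>" using s(3) by (simp add: o_def)
  have emin: "min (e m) (e n) > 0" if "m \<in> support b" "n \<in> support b" for m n using e that by simp
  have "?g m n \<theta> \<le> 0 * (norm \<theta>)\<^sup>2" if mn: "m \<in> support b" "n \<in> support b" for m n
  proof (rule LIMSEQ_le)
    show "(\<lambda>k. ?g m n (t (s k))) \<longlonglongrightarrow> ?g m n \<theta>" by (intro tendsto_intros ts)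
    show "(\<lambda>k. 1 / real (Suc (s k)) * (norm (t (s k)))\<^sup>2) \<longlonglongrightarrow> 0 * (norm \<theta>)\<^sup>2"
      by (intro tendsto_intros ts inv)
  qed (use t(2)[OF mn] in \<open>auto intro: less_imp_le\<close>)
  then have "cos (\<theta> \<bullet> (ivec n - ivec m)) \<ge> 1" if "m \<in> support b" "n \<in> support b" for m n
    using emin[OF that] that by (force simp: mult_le_0_iff)
  then have "cos (\<theta> \<bullet> (ivec n - ivec m)) = 1" if "m \<in> support b" "n \<in> support b" for m n
    using that cos_le_one by (metis antisym)
  then have \<theta>0: "\<theta> = 0" using aperiodic_torus[OF fr ap] s(1) by blast
  have "full_rank b" by fact
  then have "support b \<noteq> {}"
    by (auto simp: full_rank_def)
  then obtain m0 where m0: "m0 \<in> support b" by blast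
  \<comment> \<open>For \<open>m = n\<close> the left side is 0, so the strict inequality excludes
    \<open>t k = 0\<close> and the directions are defined.\<close>
  have tn0: "t k \<noteq> 0" for k using t(2)[OF m0 m0, of k] by auto
  define v where "v k = (1 / norm (t (s k))) *\<^sub>R t (s k)" for k
  have vsph: "\<forall>k. v k \<in> sphere 0 1" using tn0 by (simp add: v_def)
  have "compact (sphere (0::real^'d) 1)" by simp
  then have "\<exists>u\<in>sphere 0 1. \<exists>s'. strict_mono s' \<and> (v \<circ> s') \<longlonglongrightarrow> u"
    unfolding compact_def using vsph by (elim allE[of _ v]) blast
  then obtain u s' where s': "u \<in> sphere 0 1" "strict_mono s'" "(v \<circ> s') \<longlonglongrightarrow> u" by blast
  have vs: "(\<lambda>k. v (s' k)) \<longlonglongrightarrow> u" using s'(3) by (simp add: o_def)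
  have "u \<bullet> (ivec n - ivec m) = 0" if mn: "m \<in> support b" "n \<in> support b" for m n
  proof -
    let ?d = "ivec n - ivec m"
    have "(u \<bullet> ?d)\<^sup>2 \<le> 4 / min (e m) (e n) * 0"
    proof (rule LIMSEQ_le)
      show "(\<lambda>k. (v (s' k) \<bullet> ?d)\<^sup>2) \<longlonglongrightarrow> (u \<bullet> ?d)\<^sup>2" by (intro tendsto_intros vs)
      show "(\<lambda>k. 4 / min (e m) (e n) * (1 / real (Suc (s (s' k))))) \<longlonglongrightarrow> 4 / min (e m) (e n) * 0"
        by (intro tendsto_intros) (use LIMSEQ_subseq_LIMSEQ[OF inv s'(2)] in \<open>simp add: o_def\<close>)
      \<comment> \<open>As the points tend to 0, the arguments of the cosine eventually lie in the
        interval where \<open>one_minus_cos_ge\<close> applies.\<close>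
      have "(\<lambda>k. \<bar>t (s (s' k)) \<bullet> ?d\<bar>) \<longlonglongrightarrow> \<bar>\<theta> \<bullet> ?d\<bar>"
        using LIMSEQ_subseq_LIMSEQ[OF ts s'(2)] by (intro tendsto_intros) (simp add: o_def)
      then have "\<forall>\<^sub>F k in sequentially. \<bar>t (s (s' k)) \<bullet> ?d\<bar> < 1"
        by (rule order_tendstoD) (simp add: \<theta>0)
      then show "\<exists>N. \<forall>k\<ge>N. (v (s' k) \<bullet> ?d)\<^sup>2 \<le> 4 / min (e m) (e n) * (1 / real (Suc (s (s' k))))"
        unfolding eventually_sequentially
      proof (elim exE, intro exI allI impI)
        fix N k assume N: "\<forall>k\<ge>N. \<bar>t (s (s' k)) \<bullet> ?d\<bar> < 1" "N \<le> k"
        let ?t = "t (s (s' k))"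
        have "(?t \<bullet> ?d)\<^sup>2 / 4 \<le> 1 - cos (?t \<bullet> ?d)"
          using N by (intro one_minus_cos_ge) (auto intro: less_imp_le)
        then have "min (e m) (e n) * ((?t \<bullet> ?d)\<^sup>2 / 4) \<le> ?g m n ?t"
          using emin[OF mn] by (intro mult_left_mono) auto
        also have "\<dots> \<le> 1 / real (Suc (s (s' k))) * (norm ?t)\<^sup>2" using t(2)[OF mn] by (rule less_imp_le)
        finally have "(?t \<bullet> ?d)\<^sup>2 / (norm ?t)\<^sup>2 \<le> 4 / min (e m) (e n) * (1 / real (Suc (s (s' k))))"
          using emin[OF mn] tn0[of "s (s' k)"] by (intro aux) auto
        then show "(v (s' k) \<bullet> ?d)\<^sup>2 \<le> 4 / min (e m) (e n) * (1 / real (Suc (s (s' k))))"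
          by (simp add: v_def power_divide)
      qed
    qed
    then show ?thesis by simp
  qed
  moreover have "u \<noteq> 0" using s'(1) by auto
  ultimately show False using full_rank_separates[OF fr] by metis
qed

section \<open>The tilted probability distribution\<close>

lemma positive_definite_lower_bound:
  fixes H :: "real^'d::finite^'d"
  assumes pd: "\<And>x. x \<noteq> 0 \<Longrightarrow> x \<bullet> (H *v x) > 0"
  obtains c where "c > 0" "\<And>x. c * (norm x)\<^sup>2 \<le> x \<bullet> (H *v x)"
proof -
  have "continuous_on (sphere 0 1) (\<lambda>x. x \<bullet> (H *v x))"
    by (intro continuous_intros linear_continuous_on) (simp add: linear_linear[symmetric] matrix_vector_mul_linear)
  moreover have "sphere (0::real^'d) 1 \<noteq> {}" by simp
  ultimately obtain u where u: "u \<in> sphere 0 1" "\<And>x. x \<in> sphere 0 1 \<Longrightarrow> u \<bullet> (H *v u) \<le> x \<bullet> (H *v x)"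
    using continuous_attains_inf[of "sphere (0::real^'d) 1"] compact_sphere by blast
  show ?thesis
  proof
    show "u \<bullet> (H *v u) > 0" using u(1) by (intro pd) auto
    show "u \<bullet> (H *v u) * (norm x)\<^sup>2 \<le> x \<bullet> (H *v x)" for x
    proof (cases "x = 0")
      case False
      have "u \<bullet> (H *v u) \<le> ((1 / norm x) *\<^sub>R x) \<bullet> (H *v ((1 / norm x) *\<^sub>R x))"
        using False by (intro u(2)) simp
      also have "\<dots> = (x \<bullet> (H *v x)) / (norm x)\<^sup>2"
        by (simp add: matrix_vector_mult_scaleR power2_eq_square)
      finally show ?thesis using False by (simp add: field_simps)
    qed simp
  qed
qed

text \<open>With unit vectors of angles \<open>a\<close> and \<open>- b\<close>, this is the
  nonnegativity of the squared length of their sum minus 2, up to the sign of the second sine. It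
  splits a deficit for a pair of support points into deficits relative to an unknown phase.\<close>

lemma one_minus_cos_diff_le:
  fixes a b :: real shows "1 - cos (a - b) \<le> 2 * ((1 - cos a) + (1 - cos b))"
proof -
  have "1 - (x * y + u * v) \<le> 2 * ((1 - x) + (1 - y))" if "x\<^sup>2 + u\<^sup>2 = 1" "y\<^sup>2 + v\<^sup>2 = 1" for x y u v :: real
  proof -
    have "0 \<le> (x + y - 2)\<^sup>2 + (u + v)\<^sup>2" by simp
    then show ?thesis using that by (simp add: power2_eq_square algebra_simps)
  qed
  from this[of "cos a" "sin a" "cos b" "sin b"] show ?thesis by (simp add: cos_diff)
qed

text \<open>The upper bound at \<open>- u\<close> follows from the lower bound
  \<open>1 + u + u\<^sup>2 / 2\<close> at \<open>u\<close>, because the two quadratics multiply to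
  at least 1.\<close>

lemma exp_minus_le_quadratic:
  fixes u :: real assumes "u \<ge> 0" shows "exp (- u) \<le> 1 - u + u\<^sup>2 / 2"
proof -
  have pos: "1 + u + u\<^sup>2 / 2 > 0" using assms by (simp add: add_pos_nonneg)
  have "exp (- u) \<le> 1 / (1 + u + u\<^sup>2 / 2)"
    unfolding exp_minus inverse_eq_divide
    using exp_lower_Taylor_quadratic[OF assms] pos by (intro divide_left_mono) (auto intro: mult_pos_pos)
  also have "\<dots> \<le> 1 - u + u\<^sup>2 / 2"
  proof -
    have "(1 - u + u\<^sup>2 / 2) * (1 + u + u\<^sup>2 / 2) = 1 + u ^ 4 / 4"
      by (simp add: field_simps power2_eq_square power4_eq_xxxx)
    also have "\<dots> \<ge> 1" by simp
    finally show ?thesis using pos by (simp add: pos_divide_le_eq)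
  qed
  finally show ?thesis .
qed

text \<open>The situation after tilting: \<open>p\<close> stands for the normalised coefficients of
  \<open>B\<close>, \<open>\<alpha>\<close> for those of \<open>A\<close> times the monomials at the
  saddle point, and \<open>\<epsilon>\<close> is a common margin of convergence. The saddle point
  has moved to the origin of the logarithmic coordinates, and the minimum condition has become the
  statement that \<open>lam\<close> is the mean of \<open>p\<close>.\<close>

locale saddle =
  fixes p :: "('d::finite \<Rightarrow> nat) \<Rightarrow> real" and \<alpha> :: "('d \<Rightarrow> nat) \<Rightarrow> complex"
    and \<zeta> :: "'d \<Rightarrow> real" and \<epsilon> :: real and lam :: "real^'d"
  assumes p_nonneg: "\<And>m. p m \<ge> 0" and p_sum: "(p has_sum 1) UNIV"
    and eps: "\<epsilon> > 0"
    and p_exp: "exp_summable (\<lambda>m. complex_of_real (p m)) \<epsilon>" and alpha_exp: "exp_summable \<alpha> \<epsilon>"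
    and zeta: "\<And>j. 0 < \<zeta> j" "\<And>j. \<zeta> j \<le> 1"
    and lam: "\<And>j. lam $ j = (\<Sum>\<^sub>\<infinity>m. p m * real (m j))"
    and fr: "full_rank p" and ap: "aperiodic p"
begin

definition expect :: "(('d \<Rightarrow> nat) \<Rightarrow> real) \<Rightarrow> real" where "expect f = (\<Sum>\<^sub>\<infinity>m. p m * f m)"

abbreviation pc :: "('d \<Rightarrow> nat) \<Rightarrow> complex" where "pc \<equiv> \<lambda>m. complex_of_real (p m)"

definition crit_ind :: "real^'d" where "crit_ind = (\<chi> j. of_bool (\<zeta> j = 1))"

definition wv :: "real^'d \<Rightarrow> 'd \<Rightarrow> complex" where "wv x j = Complex (- crit_ind $ j) (x $ j)"

definition cov :: "real^'d^'d" where
  "cov = (\<chi> i j. expect (\<lambda>m. real (m i) * real (m j)) - lam $ i * lam $ j)"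

lemma msize_le_exp: "msize m \<le> 1 / \<epsilon> * exp (\<epsilon> * msize m)"
proof -
  have "\<epsilon> * msize m \<le> exp (\<epsilon> * msize m)"
    using exp_ge_add_one_self[of "\<epsilon> * msize m"] by linarith
  then show ?thesis using eps by (simp add: field_simps)
qed

lemma msize2_le_exp: "(msize m)\<^sup>2 \<le> 2 / \<epsilon>\<^sup>2 * exp (\<epsilon> * msize m)"
proof -
  have "(\<epsilon> * msize m)\<^sup>2 / 2 \<le> exp (\<epsilon> * msize m)"
    using exp_lower_Taylor_quadratic[of "\<epsilon> * msize m"] eps mult_nonneg_nonneg[of \<epsilon> "msize m"]
    by (auto simp del: mult_nonneg_nonneg zero_le_mult_iff)
  then show ?thesis using eps by (simp add: field_simps power_mult_distrib)
qed

lemma summable_expect: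
  assumes "\<And>m. \<bar>f m\<bar> \<le> K * exp (\<epsilon> * msize m)"
  shows "(\<lambda>m. p m * f m) summable_on UNIV"
proof (rule abs_summable_summable, rule summable_on_comparison_test)
  show "(\<lambda>m. K * (norm (pc m) * exp (\<epsilon> * msize m))) summable_on UNIV"
    using p_exp unfolding exp_summable_def by (rule summable_on_cmult_right)
  show "norm (p m * f m) \<le> K * (norm (pc m) * exp (\<epsilon> * msize m))" for m
    using mult_left_mono[OF assms[of m] p_nonneg[of m]] p_nonneg[of m] by (simp add: abs_mult mult_ac)
qed auto

lemma summable_linear: "(\<lambda>m. p m * (ivec m \<bullet> x)) summable_on UNIV"
  and summable_quadratic: "(\<lambda>m. p m * (ivec m \<bullet> x)\<^sup>2) summable_on UNIV"
proof -
  have le: "\<bar>ivec m \<bullet> x\<bar> \<le> norm x * msize m" for m :: "'d \<Rightarrow> nat"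
  proof -
    have "\<bar>ivec m \<bullet> x\<bar> \<le> (\<Sum>j\<in>UNIV. real (m j) * \<bar>x $ j\<bar>)"
      unfolding inner_vec_def ivec_def by (rule order_trans[OF sum_abs]) (simp add: abs_mult)
    also have "\<dots> \<le> (\<Sum>j\<in>UNIV. real (m j) * norm x)"
      by (intro sum_mono mult_left_mono component_le_norm_cart) auto
    finally show ?thesis by (simp add: msize_def sum_distrib_left mult.commute)
  qed
  show "(\<lambda>m. p m * (ivec m \<bullet> x)) summable_on UNIV"
  proof (rule summable_expect)
    fix m :: "'d \<Rightarrow> nat"
    show "\<bar>ivec m \<bullet> x\<bar> \<le> (norm x * (1 / \<epsilon>)) * exp (\<epsilon> * msize m)"
      using order_trans[OF le mult_left_mono[OF msize_le_exp norm_ge_zero]] by (simp only: mult.assoc)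
  qed
  show "(\<lambda>m. p m * (ivec m \<bullet> x)\<^sup>2) summable_on UNIV"
  proof (rule summable_expect)
    fix m :: "'d \<Rightarrow> nat"
    have "\<bar>(ivec m \<bullet> x)\<^sup>2\<bar> \<le> (norm x)\<^sup>2 * (msize m)\<^sup>2"
      using power_mono[OF le, of m 2] by (simp add: power_mult_distrib)
    also have "\<dots> \<le> (norm x)\<^sup>2 * (2 / \<epsilon>\<^sup>2 * exp (\<epsilon> * msize m))"
      by (intro mult_left_mono msize2_le_exp) auto
    finally show "\<bar>(ivec m \<bullet> x)\<^sup>2\<bar> \<le> ((norm x)\<^sup>2 * (2 / \<epsilon>\<^sup>2)) * exp (\<epsilon> * msize m)" by (simp only: mult.assoc)
  qed
qed

lemma summable_component: "(\<lambda>m. p m * real (m j)) summable_on UNIV"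
  using summable_linear[of "axis j 1"] by (simp add: ivec_def inner_axis)

lemma summable_components: "(\<lambda>m. p m * (real (m i) * real (m j))) summable_on UNIV"
proof (rule summable_expect)
  fix m :: "'d \<Rightarrow> nat"
  have le: "real (m j) \<le> msize m" for j unfolding msize_def by (rule member_le_sum) auto
  have "real (m i) * real (m j) \<le> msize m * msize m" by (intro mult_mono le) auto
  then show "\<bar>real (m i) * real (m j)\<bar> \<le> 2 / \<epsilon>\<^sup>2 * exp (\<epsilon> * msize m)"
    using msize2_le_exp[of m] by (simp add: power2_eq_square)
qed

lemma infsum_finite_sum:
  fixes f :: "'i \<Rightarrow> 'b \<Rightarrow> 'c::{topological_comm_monoid_add,t2_space}"
  assumes "finite A" "\<And>i. i \<in> A \<Longrightarrow> f i summable_on B"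
  shows "(\<Sum>\<^sub>\<infinity>x\<in>B. \<Sum>i\<in>A. f i x) = (\<Sum>i\<in>A. infsum (f i) B)"
    and "(\<lambda>x. \<Sum>i\<in>A. f i x) summable_on B"
  using assms by (induction rule: finite_induct) (auto simp: infsum_add summable_on_add)

lemma expect_linear: "expect (\<lambda>m. ivec m \<bullet> x) = lam \<bullet> x"
proof -
  have "expect (\<lambda>m. ivec m \<bullet> x) = (\<Sum>\<^sub>\<infinity>m. \<Sum>j\<in>UNIV. p m * real (m j) * x $ j)"
    by (simp add: expect_def inner_vec_def ivec_def sum_distrib_left mult_ac)
  also have "\<dots> = (\<Sum>j\<in>UNIV. (\<Sum>\<^sub>\<infinity>m. p m * real (m j) * x $ j))"
    by (rule infsum_finite_sum) (auto intro!: summable_on_cmult_left summable_component)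
  also have "\<dots> = lam \<bullet> x"
    by (simp add: inner_vec_def lam infsum_cmult_left')
  finally show ?thesis .
qed

lemma expect_quadratic: "expect (\<lambda>m. (ivec m \<bullet> x)\<^sup>2) = x \<bullet> (cov *v x) + (lam \<bullet> x)\<^sup>2"
proof -
  have "expect (\<lambda>m. (ivec m \<bullet> x)\<^sup>2) = (\<Sum>\<^sub>\<infinity>m. \<Sum>i\<in>UNIV. \<Sum>j\<in>UNIV. p m * (real (m i) * real (m j)) * (x $ i * x $ j))"
    by (simp add: expect_def inner_vec_def ivec_def power2_eq_square sum_product sum_distrib_left mult_ac)
  also have "\<dots> = (\<Sum>i\<in>UNIV. \<Sum>j\<in>UNIV. (\<Sum>\<^sub>\<infinity>m. p m * (real (m i) * real (m j)) * (x $ i * x $ j)))"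
    by (subst infsum_finite_sum; (intro infsum_finite_sum sum.cong refl summable_on_cmult_left summable_components finite)?)
  also have "\<dots> = (\<Sum>i\<in>UNIV. \<Sum>j\<in>UNIV. (cov $ i $ j + lam $ i * lam $ j) * (x $ i * x $ j))"
    by (simp add: infsum_cmult_left' cov_def expect_def)
  also have "\<dots> = x \<bullet> (cov *v x) + (lam \<bullet> x)\<^sup>2"
    by (simp add: inner_vec_def matrix_vector_mult_def power2_eq_square sum_product sum_distrib_left sum.distrib algebra_simps)
  finally show ?thesis .
qed

lemma cov_sym: "transpose cov = cov"
  by (simp add: transpose_def cov_def vec_eq_iff mult.commute)

lemma p_summable: "p summable_on UNIV" and p_infsum: "infsum p UNIV = 1"
  using p_sum by (auto simp: has_sum_iff)

text \<open>The form is the variance of \<open>ivec m \<bullet> x\<close> under \<open>p\<close>. If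
  it vanished, this product would be constant on the support, which full rank excludes.\<close>

lemma cov_pd:
  assumes "x \<noteq> 0" shows "x \<bullet> (cov *v x) > 0"
proof -
  \<comment> \<open>The expanded square of the deviation from the mean, arranged so that the
    infinite sum can be taken term by term.\<close>
  let ?f = "\<lambda>m. p m * (ivec m \<bullet> x)\<^sup>2 + (- 2 * (lam \<bullet> x)) * (p m * (ivec m \<bullet> x)) + (lam \<bullet> x)\<^sup>2 * p m"
  have f: "p m * (ivec m \<bullet> x - lam \<bullet> x)\<^sup>2 = ?f m" for m
    by (simp add: power2_eq_square algebra_simps)
  have s: "?f summable_on UNIV"
    by (intro summable_on_add summable_on_cmult_right summable_linear summable_quadratic p_summable)
  have "infsum ?f UNIV = expect (\<lambda>m. (ivec m \<bullet> x)\<^sup>2) + (- 2 * (lam \<bullet> x)) * expect (\<lambda>m. ivec m \<bullet> x) + (lam \<bullet> x)\<^sup>2 * infsum p UNIV"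
    unfolding expect_def
    by (subst infsum_add infsum_cmult_right'; (intro summable_on_add summable_on_cmult_right summable_linear summable_quadratic p_summable)?)+ simp
  then have inf: "infsum ?f UNIV = x \<bullet> (cov *v x)"
    by (simp add: expect_linear expect_quadratic p_infsum) (simp add: power2_eq_square)
  have nn: "?f m \<ge> 0" for m unfolding f[symmetric] using p_nonneg by simp
  have "x \<bullet> (cov *v x) \<ge> 0" unfolding inf[symmetric] by (rule infsum_nonneg) (rule nn)
  moreover have "x \<bullet> (cov *v x) \<noteq> 0"
  proof
    assume "x \<bullet> (cov *v x) = 0"
    then have z: "?f m = 0" for m
      using nonneg_infsum_le_0D[of ?f UNIV m] inf s nn by simp
    have "ivec m \<bullet> x = lam \<bullet> x" if "m \<in> support p" for m
      using z[of m] that unfolding f[symmetric] by (simp add: support_def)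
    then have "x \<bullet> (ivec n - ivec m) = 0" if "m \<in> support p" "n \<in> support p" for m n
      using that by (simp add: inner_diff_right inner_commute)
    then show False using full_rank_separates[OF fr assms] by metis
  qed
  ultimately show ?thesis by simp
qed

text \<open>The value of the tilted series at the positive real point of the shrunk torus, which is
  what the triangle inequality gives as a bound on that torus.\<close>

definition shifted_mgf :: "real \<Rightarrow> real" where "shifted_mgf h = (\<Sum>\<^sub>\<infinity>m. p m * exp (- h * (ivec m \<bullet> crit_ind)))"

lemma crit_ind_bounds: "0 \<le> ivec m \<bullet> crit_ind" "ivec m \<bullet> crit_ind \<le> msize m"
  unfolding inner_vec_def msize_def
  by (intro sum_nonneg sum_mono; simp add: ivec_def crit_ind_def)+

lemma exp_crit_ind_le_1: "h \<ge> 0 \<Longrightarrow> exp (- h * (ivec m \<bullet> crit_ind)) \<le> 1"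
  using mult_nonneg_nonneg[OF _ crit_ind_bounds(1), of h m] by simp

lemma shifted_mgf_summable: "h \<ge> 0 \<Longrightarrow> (\<lambda>m. p m * exp (- h * (ivec m \<bullet> crit_ind))) summable_on UNIV"
  by (rule summable_on_comparison_test[OF p_summable])
     (intro mult_left_le exp_crit_ind_le_1 p_nonneg mult_nonneg_nonneg exp_ge_zero | assumption)+

lemma shifted_mgf_nonneg: "shifted_mgf h \<ge> 0"
  unfolding shifted_mgf_def by (rule infsum_nonneg) (simp add: p_nonneg)

lemma shifted_mgf_le_1: "h \<ge> 0 \<Longrightarrow> shifted_mgf h \<le> 1"
  unfolding shifted_mgf_def p_infsum[symmetric]
  by (rule infsum_mono) (intro mult_left_le exp_crit_ind_le_1 p_nonneg shifted_mgf_summable p_summable | assumption)+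

definition C2 :: real where "C2 = expect (\<lambda>m. (ivec m \<bullet> crit_ind)\<^sup>2) / 2"

text \<open>The first-order term is kept exactly because it will cancel against the factor with
  exponent \<open>- h * cinner lam w\<close>. What remains of the cost of the shift is
  \<open>h\<^sup>2 * C2\<close> per factor, hence \<open>C2\<close> for \<open>n\<close>
  factors.\<close>

lemma shifted_mgf_le:
  assumes "h \<ge> 0" shows "shifted_mgf h \<le> exp (- h * (lam \<bullet> crit_ind) + h\<^sup>2 * C2)"
proof -
  let ?f = "\<lambda>m. p m + (- h) * (p m * (ivec m \<bullet> crit_ind)) + (h\<^sup>2 / 2) * (p m * (ivec m \<bullet> crit_ind)\<^sup>2)"
  have "shifted_mgf h \<le> infsum ?f UNIV"
    unfolding shifted_mgf_def
  proof (rule infsum_mono)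
    fix m
    have "exp (- (h * (ivec m \<bullet> crit_ind))) \<le> 1 - (h * (ivec m \<bullet> crit_ind)) + (h * (ivec m \<bullet> crit_ind))\<^sup>2 / 2"
      using assms crit_ind_bounds by (intro exp_minus_le_quadratic) auto
    from mult_left_mono[OF this p_nonneg[of m]]
    show "p m * exp (- h * (ivec m \<bullet> crit_ind)) \<le> ?f m"
      by (simp add: algebra_simps power_mult_distrib)
  qed (intro shifted_mgf_summable assms summable_on_add summable_on_cmult_right summable_linear summable_quadratic p_summable)+
  also have "\<dots> = infsum p UNIV + (- h) * expect (\<lambda>m. ivec m \<bullet> crit_ind) + (h\<^sup>2 / 2) * expect (\<lambda>m. (ivec m \<bullet> crit_ind)\<^sup>2)"
    unfolding expect_def
    by (subst infsum_add infsum_cmult_right'; (intro summable_on_add summable_on_cmult_right summable_linear summable_quadratic p_summable)?)+ simp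
  also have "\<dots> = 1 + (- h * (lam \<bullet> crit_ind) + h\<^sup>2 * C2)"
    by (simp add: expect_linear p_infsum C2_def)
  also have "\<dots> \<le> exp (- h * (lam \<bullet> crit_ind) + h\<^sup>2 * C2)" by (rule exp_ge_add_one_self)
  finally show ?thesis .
qed

text \<open>After rotation by its own phase the series is real, so \<open>shifted_mgf h\<close>
  minus its modulus is a sum of nonnegative terms with factors \<open>1 - cos\<close>. Two of these
  terms, for the pair supplied by \<open>aperiodic_quadratic_bound\<close>, already give the
  quadratic gain.\<close>

lemma norm_char_le:
  obtains c where "c > 0" "\<And>h (\<theta>::real^'d). \<lbrakk>0 \<le> h; h \<le> 1; \<And>j. \<bar>\<theta> $ j\<bar> \<le> pi\<rbrakk> \<Longrightarrow>
    norm (exp_series pc (\<lambda>j. Complex (- h * crit_ind $ j) (\<theta> $ j))) \<le> shifted_mgf h - c * (norm \<theta>)\<^sup>2"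
proof -
  \<comment> \<open>For all \<open>h\<close> between 0 and 1 this lies below the weight
    \<open>p m * exp (- h * (ivec m \<bullet> crit_ind))\<close>, so the constant does not depend on
    \<open>h\<close>.\<close>
  let ?e = "\<lambda>m. p m * exp (- msize m)"
  have "?e m > 0" if "m \<in> support p" for m
    using that p_nonneg[of m] by (simp add: support_def less_le)
  from aperiodic_quadratic_bound[OF fr ap, of ?e, OF this]
  obtain c where c: "c > 0" "\<And>\<theta>::real^'d. (\<And>j. \<bar>\<theta> $ j\<bar> \<le> pi) \<Longrightarrow>
    \<exists>m\<in>support p. \<exists>n\<in>support p. c * (norm \<theta>)\<^sup>2 \<le> min (?e m) (?e n) * (1 - cos (\<theta> \<bullet> (ivec n - ivec m)))"
    by metis
  show ?thesis
  proof
    \<comment> \<open>The constant is halved because of the factor 2 in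
      \<open>one_minus_cos_diff_le\<close>.\<close>
    show "c / 2 > 0" using c by simp
    fix h :: real and \<theta> :: "real^'d" assume h: "0 \<le> h" "h \<le> 1" and \<theta>: "\<And>j. \<bar>\<theta> $ j\<bar> \<le> pi"
    let ?w = "\<lambda>j. Complex (- h * crit_ind $ j) (\<theta> $ j)"
    let ?z = "exp_series pc ?w"
    define \<phi> where "\<phi> = Arg ?z"
    have \<phi>: "?z = of_real (norm ?z) * exp (\<i> * of_real \<phi>)"
      using rcis_cmod_Arg[of ?z] by (simp add: rcis_def cis_conv_exp \<phi>_def)
    have w: "pc m * exp (mdot m ?w) * exp (- \<i> * of_real \<phi>) =
       of_real (p m * exp (- h * (ivec m \<bullet> crit_ind))) * exp (\<i> * of_real (\<theta> \<bullet> ivec m - \<phi>))" for m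
    proof -
      have "mdot m ?w = of_real (- h * (ivec m \<bullet> crit_ind)) + \<i> * of_real (\<theta> \<bullet> ivec m)"
        unfolding mdot_def inner_vec_def ivec_def sum_distrib_left of_real_sum sum.distrib[symmetric]
        by (intro sum.cong refl) (simp add: complex_eq_iff)
      then have "exp (mdot m ?w) * exp (- \<i> * of_real \<phi>) = exp (of_real (- h * (ivec m \<bullet> crit_ind))) * exp (\<i> * of_real (\<theta> \<bullet> ivec m - \<phi>))"
        by (simp only: exp_add[symmetric]) (simp add: algebra_simps)
      then show ?thesis unfolding exp_of_real by (simp only: mult.assoc of_real_mult)
    qed
    have "exp_abs_summable pc ?w"
      by (rule exp_summable_exp_abs_summable[OF exp_summable_mono[OF p_exp, of 0]]) (use eps h in \<open>auto simp: crit_ind_def\<close>)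
    then have sm: "(\<lambda>m. pc m * exp (mdot m ?w)) summable_on UNIV"
      unfolding exp_abs_summable_def by (rule abs_summable_summable)
    have "of_real (norm ?z) = ?z * exp (- \<i> * of_real \<phi>)"
      by (subst (2) \<phi>) (simp add: exp_minus)
    also have "\<dots> = (\<Sum>\<^sub>\<infinity>m. pc m * exp (mdot m ?w) * exp (- \<i> * of_real \<phi>))"
      unfolding exp_series_def infsum_cmult_left' ..
    finally have "complex_of_real (norm ?z) = (\<Sum>\<^sub>\<infinity>m. of_real (p m * exp (- h * (ivec m \<bullet> crit_ind))) * exp (\<i> * of_real (\<theta> \<bullet> ivec m - \<phi>)))"
      unfolding w .
    moreover have sm': "(\<lambda>m. of_real (p m * exp (- h * (ivec m \<bullet> crit_ind))) * exp (\<i> * of_real (\<theta> \<bullet> ivec m - \<phi>))) summable_on UNIV"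
      using summable_on_cmult_left[OF sm, of "exp (- \<i> * of_real \<phi>)"] unfolding w .
    ultimately have "norm ?z = (\<Sum>\<^sub>\<infinity>m. Re (of_real (p m * exp (- h * (ivec m \<bullet> crit_ind))) * exp (\<i> * of_real (\<theta> \<bullet> ivec m - \<phi>))))"
      unfolding infsum_Re[OF sm'] by (metis Re_complex_of_real)
    then have nz: "norm ?z = (\<Sum>\<^sub>\<infinity>m. p m * exp (- h * (ivec m \<bullet> crit_ind)) * cos (\<theta> \<bullet> ivec m - \<phi>))"
      by (simp add: Re_exp)
    have smr: "(\<lambda>m. p m * exp (- h * (ivec m \<bullet> crit_ind)) * cos (\<theta> \<bullet> ivec m - \<phi>)) summable_on UNIV"
      using summable_on_Re[OF sm'] by (simp add: Re_exp)
    let ?g = "\<lambda>m. p m * exp (- h * (ivec m \<bullet> crit_ind)) * (1 - cos (\<theta> \<bullet> ivec m - \<phi>))"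
    have g: "?g m = p m * exp (- h * (ivec m \<bullet> crit_ind)) + (-1) * (p m * exp (- h * (ivec m \<bullet> crit_ind)) * cos (\<theta> \<bullet> ivec m - \<phi>))" for m
      by (simp add: algebra_simps)
    have gs: "?g summable_on UNIV"
      unfolding g by (intro summable_on_add summable_on_cmult_right smr shifted_mgf_summable h)
    have "infsum ?g UNIV = shifted_mgf h + (-1) * norm ?z"
      unfolding g nz shifted_mgf_def
      by (subst infsum_add infsum_cmult_right'; (intro summable_on_add summable_on_cmult_right smr shifted_mgf_summable h)?)+ simp
    then have Ig: "infsum ?g UNIV = shifted_mgf h - norm ?z" by simp
    have g0: "?g m \<ge> 0" for m by (intro mult_nonneg_nonneg p_nonneg) auto
    obtain m n where mn: "m \<in> support p" "n \<in> support p"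
       "c * (norm \<theta>)\<^sup>2 \<le> min (?e m) (?e n) * (1 - cos (\<theta> \<bullet> (ivec n - ivec m)))"
      using c(2)[OF \<theta>] by blast
    have "c / 2 * (norm \<theta>)\<^sup>2 \<le> infsum ?g UNIV"
    \<comment> \<open>The sum over \<open>{m, n}\<close> has two terms only for distinct indices;
      for equal ones the bound for the pair says that \<open>\<theta>\<close> contributes
      nothing.\<close>
    proof (cases "m = n")
      case True
      then have "c * (norm \<theta>)\<^sup>2 \<le> 0" using mn(3) by simp
      then show ?thesis using infsum_nonneg[of UNIV ?g] g0 by simp
    next
      case False
      let ?a = "\<theta> \<bullet> ivec m - \<phi>" and ?b = "\<theta> \<bullet> ivec n - \<phi>"
      have e: "?e m \<le> p m * exp (- h * (ivec m \<bullet> crit_ind))" for m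
      proof -
        have "h * (ivec m \<bullet> crit_ind) \<le> 1 * msize m" using h crit_ind_bounds[of m] by (intro mult_mono) auto
        then show ?thesis using p_nonneg by (intro mult_left_mono) auto
      qed
      have "1 - cos (?b - ?a) \<le> 2 * ((1 - cos ?b) + (1 - cos ?a))" by (rule one_minus_cos_diff_le)
      moreover have "?b - ?a = \<theta> \<bullet> (ivec n - ivec m)" by (simp add: inner_diff_right)
      ultimately have cos: "1 - cos (\<theta> \<bullet> (ivec n - ivec m)) \<le> 2 * ((1 - cos ?b) + (1 - cos ?a))" by simp
      have "c / 2 * (norm \<theta>)\<^sup>2 \<le> min (?e m) (?e n) * ((1 - cos ?b) + (1 - cos ?a))"
      proof -
        have half: "c / 2 * N \<le> E * K" if "c * N \<le> E * (2 * K)" for N E K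
          using that by simp
        show ?thesis
          by (rule half, rule order_trans[OF mn(3) mult_left_mono[OF cos]]) (simp add: p_nonneg)
      qed
      also have "\<dots> \<le> ?g n + ?g m"
        unfolding distrib_left
        using e[of m] e[of n] by (intro add_mono mult_right_mono) auto
      also have "\<dots> = sum ?g {m, n}" using False by simp
      also have "\<dots> \<le> infsum ?g UNIV"
        by (rule finite_sum_le_infsum[OF gs]) (use g0 in auto)
      finally show ?thesis .
    qed
    then show "norm ?z \<le> shifted_mgf h - c / 2 * (norm \<theta>)\<^sup>2" unfolding Ig by simp
  qed
qed

text \<open>Turns the subtracted gain into an exponential factor, so that raising to the power
  \<open>n\<close> becomes multiplication of the exponent.\<close>

lemma norm_pgf_le:
  obtains c where "c > 0" "\<And>h x. \<lbrakk>0 < h; h \<le> 1; \<And>j. \<bar>x $ j\<bar> \<le> pi / h\<rbrakk> \<Longrightarrow>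
    norm (exp_series pc (\<lambda>j. of_real h * wv x j)) \<le> exp (- h * (lam \<bullet> crit_ind) + h\<^sup>2 * (C2 - c * (norm x)\<^sup>2))"
proof -
  obtain c where c: "c > 0" "\<And>h (\<theta>::real^'d). \<lbrakk>0 \<le> h; h \<le> 1; \<And>j. \<bar>\<theta> $ j\<bar> \<le> pi\<rbrakk> \<Longrightarrow>
    norm (exp_series pc (\<lambda>j. Complex (- h * crit_ind $ j) (\<theta> $ j))) \<le> shifted_mgf h - c * (norm \<theta>)\<^sup>2"
    using norm_char_le by blast
  show ?thesis
  proof
    show "c > 0" by fact
    fix h and x :: "real^'d" assume h: "0 < h" "h \<le> 1" and x: "\<And>j. \<bar>x $ j\<bar> \<le> pi / h"
    have eq: "of_real h * wv x j = Complex (- h * crit_ind $ j) ((h *\<^sub>R x) $ j)" for j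
      by (simp add: wv_def complex_eq_iff)
    have "norm (exp_series pc (\<lambda>j. of_real h * wv x j)) \<le> shifted_mgf h - c * (norm (h *\<^sub>R x))\<^sup>2"
      unfolding eq using h x by (intro c(2)) (auto simp: abs_mult field_simps)
    \<comment> \<open>Inserting the factor \<open>shifted_mgf h\<close>, which is at most 1, weakens
      the subtraction and lets the factor be pulled out; then \<open>1 - t \<le> exp (- t)\<close>
      applies.\<close>
    also have "\<dots> \<le> shifted_mgf h - c * h\<^sup>2 * (norm x)\<^sup>2 * shifted_mgf h"
      using shifted_mgf_le_1[of h] h c(1) by (simp add: power_mult_distrib mult_left_le)
    also have "\<dots> = shifted_mgf h * (1 + (- (c * h\<^sup>2 * (norm x)\<^sup>2)))" by (simp add: algebra_simps)
    also have "\<dots> \<le> exp (- h * (lam \<bullet> crit_ind) + h\<^sup>2 * C2) * exp (- (c * h\<^sup>2 * (norm x)\<^sup>2))"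
    proof (rule order_trans[OF mult_left_mono[OF exp_ge_add_one_self shifted_mgf_nonneg] mult_right_mono])
      show "shifted_mgf h \<le> exp (- h * (lam \<bullet> crit_ind) + h\<^sup>2 * C2)" using h by (intro shifted_mgf_le) auto
    qed auto
    also have "\<dots> = exp (- h * (lam \<bullet> crit_ind) + h\<^sup>2 * (C2 - c * (norm x)\<^sup>2))"
      by (simp add: exp_add[symmetric] algebra_simps)
    finally show "norm (exp_series pc (\<lambda>j. of_real h * wv x j)) \<le> exp (- h * (lam \<bullet> crit_ind) + h\<^sup>2 * (C2 - c * (norm x)\<^sup>2))" .
  qed
qed

end

section \<open>Local and global bounds for the integrand\<close>

context saddle
begin

definition W :: "real^'d \<Rightarrow> real" where "W x = 1 + norm x"

text \<open>\<open>cinner\<close> and \<open>cquad\<close> extend the real forms without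
  conjugation, so replacing \<open>w\<close> by \<open>\<eta> w\<close> multiplies them by
  \<open>\<eta>\<close> and \<open>\<eta>^2\<close>.\<close>

definition cinner :: "real^'d \<Rightarrow> ('d \<Rightarrow> complex) \<Rightarrow> complex" where
  "cinner v w = (\<Sum>j\<in>UNIV. of_real (v $ j) * w j)"

definition cquad :: "('d \<Rightarrow> complex) \<Rightarrow> complex" where
  "cquad w = (\<Sum>i\<in>UNIV. \<Sum>j\<in>UNIV. of_real (cov $ i $ j) * (w i * w j))"

definition psi :: "real^'d \<Rightarrow> complex \<Rightarrow> complex" where
  "psi x \<eta> = exp_series pc (\<lambda>j. \<eta> * wv x j)"

text \<open>The part of the integrand that is not raised to the power \<open>n\<close>: the
  deviation of the multi-index from \<open>n \<lambda>\<close>, the series \<open>A\<close>, and the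
  geometric factors freed of their poles. The poles come back as \<open>pole_prod\<close>.\<close>

definition rest :: "real^'d \<Rightarrow> real^'d \<Rightarrow> complex \<Rightarrow> complex" where
  "rest \<delta> x \<eta> = exp (- (\<eta> * cinner \<delta> (wv x))) * exp_series \<alpha> (\<lambda>j. \<eta> * wv x j) * (\<Prod>j\<in>UNIV. geo_fac (\<zeta> j) (\<eta> * wv x j))"

text \<open>The exponent is \<open>O(\<eta>)\<close>, so the value at \<open>0\<close> is the continuous one; for \<open>\<eta> = 1 / sqrt n\<close>
  the exponential is \<open>(psi * exp (- \<eta> lam w))^n\<close> divided by the Gaussian factor.\<close>

definition germ :: "real^'d \<Rightarrow> real^'d \<Rightarrow> complex \<Rightarrow> complex" where
  "germ \<delta> x \<eta> = (if \<eta> = 0 then 1 else exp ((Ln (psi x \<eta>) - \<eta> * cinner lam (wv x) - \<eta>\<^sup>2 * cquad (wv x) / 2) / \<eta>\<^sup>2)) * rest \<delta> x \<eta>"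

definition germ_coeff :: "nat \<Rightarrow> real^'d \<Rightarrow> real^'d \<Rightarrow> complex" where
  "germ_coeff k \<delta> x = (deriv ^^ k) (germ \<delta> x) 0 / fact k"

definition hh :: "nat \<Rightarrow> real" where "hh n = 1 / sqrt (real n)"

definition box_n :: "nat \<Rightarrow> (real^'d) set" where "box_n n = {x. \<forall>j. \<bar>x $ j\<bar> \<le> pi * sqrt (real n)}"

text \<open>Written in the stretched angle \<open>x = sqrt n * \<theta>\<close> and set to 0 outside
  the stretched torus, so that it can be compared with a Gaussian on the whole space.\<close>

definition integrand :: "nat \<Rightarrow> real^'d \<Rightarrow> real^'d \<Rightarrow> complex" where
  "integrand n \<delta> x = indicator (box_n n) x *\<^sub>R ((psi x (hh n) * exp (- (hh n * cinner lam (wv x)))) ^ n * rest \<delta> x (hh n))"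

definition gauss :: "real^'d \<Rightarrow> complex" where "gauss x = exp (cquad (wv x) / 2)"

lemma W_ge_1: "W x \<ge> 1" by (simp add: W_def)

lemma norm_wv: "norm (wv x j) \<le> W x"
proof -
  have "norm (wv x j) \<le> \<bar>- crit_ind $ j\<bar> + \<bar>x $ j\<bar>" unfolding wv_def using cmod_le[of "Complex (- crit_ind $ j) (x $ j)"] by simp
  also have "\<dots> \<le> 1 + norm x" by (intro add_mono component_le_norm_cart) (simp add: crit_ind_def)
  finally show ?thesis by (simp add: W_def)
qed

lemma norm_scaled_wv: "norm \<eta> * W x < e \<Longrightarrow> norm (\<eta> * wv x j) < e"
  unfolding norm_mult by (rule order_le_less_trans[OF mult_left_mono[OF norm_wv]]) auto

lemma Re_scaled_wv: "norm \<eta> * W x < e \<Longrightarrow> Re (\<eta> * wv x j) \<le> e"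
  using norm_scaled_wv[of \<eta> x e j] complex_Re_le_cmod[of "\<eta> * wv x j"] by linarith

lemma norm_cinner: "norm (cinner v (wv x)) \<le> CARD('d) * norm v * W x"
proof -
  have "norm (cinner v (wv x)) \<le> (\<Sum>j\<in>UNIV. \<bar>v $ j\<bar> * norm (wv x j))"
    unfolding cinner_def by (rule order_trans[OF norm_sum]) (simp add: norm_mult)
  also have "\<dots> \<le> (\<Sum>j\<in>(UNIV::'d set). norm v * W x)"
    by (intro sum_mono mult_mono component_le_norm_cart norm_wv) auto
  finally show ?thesis by simp
qed

lemma infsum_pc_mdot: "(\<Sum>\<^sub>\<infinity>m. pc m * mdot m w) = cinner lam w"
proof -
  have hs: "((\<lambda>m. complex_of_real (p m * real (m j))) has_sum of_real (lam $ j)) UNIV" for j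
    unfolding lam by (intro has_sum_of_real has_sum_infsum summable_component)
  have "(\<Sum>\<^sub>\<infinity>m. pc m * mdot m w) = (\<Sum>\<^sub>\<infinity>m. \<Sum>j\<in>UNIV. complex_of_real (p m * real (m j)) * w j)"
    by (simp add: mdot_def sum_distrib_left mult_ac)
  also have "\<dots> = (\<Sum>j\<in>UNIV. (\<Sum>\<^sub>\<infinity>m. complex_of_real (p m * real (m j)) * w j))"
    by (rule infsum_finite_sum) (auto intro!: summable_on_cmult_left has_sum_imp_summable[OF hs, simplified])
  also have "\<dots> = cinner lam w"
    unfolding cinner_def infsum_cmult_left' infsumI[OF hs] ..
  finally show ?thesis .
qed

lemma infsum_pc_mdot2: "(\<Sum>\<^sub>\<infinity>m. pc m * mdot m w * mdot m w) = cquad w + (cinner lam w)\<^sup>2"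
proof -
  have hs: "((\<lambda>m. complex_of_real (p m * (real (m i) * real (m j)))) has_sum of_real (cov $ i $ j + lam $ i * lam $ j)) UNIV" for i j
    unfolding cov_def expect_def by (simp only: vec_lambda_beta diff_add_cancel) (intro has_sum_of_real has_sum_infsum summable_components)
  have sm: "(\<lambda>m. complex_of_real (p m * (real (m i) * real (m j))) * (w i * w j)) summable_on UNIV" for i j
    by (intro summable_on_cmult_left has_sum_imp_summable[OF hs])
  have "(\<Sum>\<^sub>\<infinity>m. pc m * mdot m w * mdot m w) = (\<Sum>\<^sub>\<infinity>m. \<Sum>i\<in>UNIV. \<Sum>j\<in>UNIV. complex_of_real (p m * (real (m i) * real (m j))) * (w i * w j))"
    by (simp add: mdot_def sum_product mult.assoc) (simp add: sum_distrib_left mult_ac)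
  also have "\<dots> = (\<Sum>i\<in>UNIV. (\<Sum>\<^sub>\<infinity>m. \<Sum>j\<in>UNIV. complex_of_real (p m * (real (m i) * real (m j))) * (w i * w j)))"
    by (intro infsum_finite_sum(1) infsum_finite_sum(2) sm finite)
  also have "\<dots> = (\<Sum>i\<in>UNIV. \<Sum>j\<in>UNIV. (\<Sum>\<^sub>\<infinity>m. complex_of_real (p m * (real (m i) * real (m j))) * (w i * w j)))"
    by (intro sum.cong refl infsum_finite_sum(1) sm finite)
  also have "\<dots> = (\<Sum>i\<in>UNIV. \<Sum>j\<in>UNIV. of_real (cov $ i $ j + lam $ i * lam $ j) * (w i * w j))"
    unfolding infsum_cmult_left' infsumI[OF hs] ..
  also have "\<dots> = cquad w + (cinner lam w)\<^sup>2"
    by (simp add: cquad_def cinner_def power2_eq_square sum_product sum.distrib algebra_simps)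
  finally show ?thesis .
qed

lemma psi_0: "psi x 0 = 1"
proof -
  have "((\<lambda>m. pc m) has_sum of_real 1) UNIV" by (rule has_sum_of_real[OF p_sum])
  then show ?thesis by (simp add: psi_def exp_series_def mdot_def infsumI)
qed

lemma psi_holomorphic: "psi x holomorphic_on ball 0 (\<epsilon> / W x)"
  unfolding psi_def[abs_def] using W_ge_1[of x] by (intro holomorphic_on_exp_series[OF p_exp norm_wv]) auto

lemma deriv_psi:
  assumes "norm \<eta> * W x < \<epsilon>"
  shows "(psi x has_field_derivative exp_series (\<lambda>m. pc m * mdot m (wv x)) (\<lambda>j. \<eta> * wv x j)) (at \<eta>)"
  unfolding psi_def[abs_def] using W_ge_1[of x] by (intro exp_series_has_field_derivative[OF p_exp norm_wv assms]) auto

lemma deriv2_psi: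
  "((\<lambda>\<eta>. exp_series (\<lambda>m. pc m * mdot m (wv x)) (\<lambda>j. \<eta> * wv x j)) has_field_derivative cquad (wv x) + (cinner lam (wv x))\<^sup>2) (at 0)"
proof -
  have "exp_summable (\<lambda>m. pc m * mdot m (wv x)) (\<epsilon> / 2)"
    using eps by (intro exp_summable_mdot[OF p_exp]) auto
  from exp_series_has_field_derivative[where w = "wv x" and W = "W x" and \<eta> = 0, OF this norm_wv] show ?thesis
    using eps W_ge_1[of x] by (simp add: exp_series_def mdot_def[where w = "\<lambda>_. 0"] infsum_pc_mdot2)
qed

text \<open>Boundedness on the disc of radius \<open>\<epsilon> / W x\<close> and a first-order
  Taylor quotient give \<open>norm (psi x \<eta> - 1) \<le> 4 * S / \<epsilon> * (norm \<eta> * W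
  x)\<close>, so one threshold for \<open>norm \<eta> * W x\<close> serves all
  \<open>x\<close>.\<close>

lemma psi_near_1:
  obtains e where "e > 0" "e \<le> 1" "e \<le> \<epsilon>" "\<And>x \<eta>. norm \<eta> * W x < e \<Longrightarrow> norm (psi x \<eta> - 1) < 1 / 4"
proof -
  define S where "S = (\<Sum>\<^sub>\<infinity>m. norm (pc m) * exp (\<epsilon> * msize m))"
  have S0: "S \<ge> 0" unfolding S_def by (rule infsum_nonneg) auto
  \<comment> \<open>The 16 makes \<open>4 * S / \<epsilon> * e\<close> less than
    \<open>1 / 4\<close>; the added 1 covers small \<open>S\<close> and also gives
    \<open>4 * e \<le> \<epsilon>\<close>, the disc on which the Taylor quotient is bounded.\<close>
  define e where "e = min 1 (\<epsilon> / (16 * (S + 1)))"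
  have "e \<le> \<epsilon> / (16 * (S + 1))" unfolding e_def by simp
  moreover have "16 * (S + 1) > 0" using S0 by simp
  ultimately have "e * (16 * (S + 1)) \<le> \<epsilon>" by (simp only: pos_le_divide_eq)
  then have e: "e > 0" "e \<le> 1" "e * (16 * (S + 1)) \<le> \<epsilon>"
    using eps S0 by (simp_all add: e_def)
  have e4: "4 * e \<le> \<epsilon>" "e \<le> \<epsilon>"
  proof -
    have "e * 1 \<le> e * (S + 1)" using e(1) S0 by (intro mult_left_mono) auto
    then show "4 * e \<le> \<epsilon>" "e \<le> \<epsilon>" using e by linarith+
  qed
  show ?thesis
  proof
    fix x :: "real^'d" and \<eta> :: complex assume \<eta>: "norm \<eta> * W x < e"
    have W0: "W x > 0" using W_ge_1[of x] by linarith
    have bd: "norm (psi x z) \<le> S" if "norm z < \<epsilon> / W x" for z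
      unfolding psi_def S_def
      by (rule norm_exp_series_le[OF p_exp Re_scaled_wv]) (use that W0 in \<open>simp add: field_simps\<close>)
    have "\<epsilon> / W x > 0" using eps W0 by simp
    then obtain q where q: "q holomorphic_on ball 0 (\<epsilon> / W x)" "\<And>z. norm z < \<epsilon> / W x \<Longrightarrow> psi x z = (\<Sum>k<1. (deriv ^^ k) (psi x) 0 / fact k * z ^ k) + z ^ 1 * q z"
      "\<And>z. norm z \<le> \<epsilon> / W x / 4 \<Longrightarrow> norm (q z) \<le> 2 * S * (2 / (\<epsilon> / W x)) ^ 1"
      using taylor_quotient[OF psi_holomorphic bd, where r = 1] by blast
    have \<eta>1: "norm \<eta> < \<epsilon> / W x" "norm \<eta> \<le> \<epsilon> / W x / 4"
      using \<eta> e4 W0 by (auto simp: field_simps)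
    have "psi x \<eta> - 1 = \<eta> * q \<eta>" using q(2)[OF \<eta>1(1)] by (simp add: psi_0)
    then have "norm (psi x \<eta> - 1) = norm \<eta> * norm (q \<eta>)" by (simp add: norm_mult)
    also have "\<dots> \<le> norm \<eta> * (2 * S * (2 / (\<epsilon> / W x)) ^ 1)"
      by (intro mult_left_mono q(3) \<eta>1) auto
    also have "\<dots> = (norm \<eta> * W x) * (4 * S / \<epsilon>)" by simp
    also have "\<dots> \<le> e * (4 * S / \<epsilon>)" using \<eta> S0 eps by (intro mult_right_mono) auto
    also have "\<dots> < 1 / 4"
    proof -
      have "e * (16 * S) < e * (16 * (S + 1))" using e by simp
      also have "\<dots> \<le> \<epsilon>" by (rule e(3))
      finally show ?thesis using eps by (simp add: field_simps)
    qed
    finally show "norm (psi x \<eta> - 1) < 1 / 4" .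
  qed (use e e4 in auto)
qed

text \<open>Near 1 the logarithm is holomorphic and bounded by \<open>1 / 2\<close>, so its
  third-order Taylor quotient is at most \<open>(2 * W x / e) ^ 3\<close>. This is where the radius
  proportional to \<open>1 / W x ^ 3\<close> comes from: there \<open>\<eta> * q \<eta>\<close>, the
  error in the exponent after division by \<open>\<eta>\<^sup>2\<close>, is at most 1.\<close>

lemma Ln_psi_expansion:
  obtains e where "e > 0" "e \<le> 1" "e \<le> \<epsilon>" "\<And>x \<eta>. norm \<eta> * W x < e \<Longrightarrow> psi x \<eta> \<noteq> 0"
    "\<And>x. \<exists>q. q holomorphic_on ball 0 (e / W x ^ 3) \<and> (\<forall>\<eta>. norm \<eta> < e / W x ^ 3 \<longrightarrow>
       Ln (psi x \<eta>) = \<eta> * cinner lam (wv x) + \<eta>\<^sup>2 * cquad (wv x) / 2 + \<eta> ^ 3 * q \<eta> \<and> norm (\<eta> * q \<eta>) \<le> 1)"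
proof -
  obtain e where e: "e > 0" "e \<le> 1" "e \<le> \<epsilon>" "\<And>x \<eta>. norm \<eta> * W x < e \<Longrightarrow> norm (psi x \<eta> - 1) < 1 / 4"
    using psi_near_1 by blast
  have nz: "psi x \<eta> \<noteq> 0" "psi x \<eta> \<notin> \<real>\<^sub>\<le>\<^sub>0" "norm (Ln (psi x \<eta>)) \<le> 1 / 2" if "norm \<eta> * W x < e" for x \<eta>
  proof -
    have *: "norm (psi x \<eta> - 1) < 1 / 4" by (rule e(4)[OF that])
    have "\<bar>Re (psi x \<eta> - 1)\<bar> < 1 / 4" using * abs_Re_le_cmod[of "psi x \<eta> - 1"] by linarith
    then have "Re (psi x \<eta>) > 0" unfolding minus_complex.sel one_complex.sel by linarith
    then show "psi x \<eta> \<noteq> 0" "psi x \<eta> \<notin> \<real>\<^sub>\<le>\<^sub>0" by (auto simp: complex_nonpos_Reals_iff)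
    show "norm (Ln (psi x \<eta>)) \<le> 1 / 2"
      using norm_Ln_le[of "psi x \<eta> - 1"] * by simp
  qed
  \<comment> \<open>Chosen so that \<open>e2 / W x ^ 3\<close> times the bound for the quotient is
    exactly 1.\<close>
  define e2 where "e2 = e ^ 3 / 8"
  have "e ^ 3 \<le> e ^ 1" using e by (intro power_decreasing) auto
  then have e2: "e2 > 0" "e2 \<le> e / 4" using e by (auto simp: e2_def)
  show ?thesis
  proof
    show "e2 > 0" "e2 \<le> 1" "e2 \<le> \<epsilon>" using e e2 by auto
    have W3: "W x \<le> W x ^ 3" for x
      using power_increasing[of 1 3 "W x"] W_ge_1[of x] by simp
    have small: "norm \<eta> < e / W x / 4" if "norm \<eta> < e2 / W x ^ 3" for x \<eta>
    proof -
      have "e2 / W x ^ 3 \<le> (e / 4) / W x"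
        using e2 e W3[of x] W_ge_1[of x] by (intro frac_le) auto
      then show ?thesis using that by simp
    qed
    show "psi x \<eta> \<noteq> 0" if "norm \<eta> * W x < e2" for x \<eta>
      using that e2 e(1) by (intro nz(1)) linarith
    fix x
    have W0: "W x > 0" using W_ge_1[of x] by linarith
    let ?\<rho> = "e / W x"
    let ?f = "\<lambda>\<eta>. Ln (psi x \<eta>)"
    have in_ball: "norm \<eta> * W x < e" if "norm \<eta> < ?\<rho>" for \<eta> using that W0 by (simp add: field_simps)
    have hf: "?f holomorphic_on ball 0 ?\<rho>"
    proof (rule holomorphic_on_Ln')
      show "psi x holomorphic_on ball 0 ?\<rho>"
        by (rule holomorphic_on_subset[OF psi_holomorphic]) (use e W0 in \<open>auto simp: field_simps\<close>)
    qed (use nz(2) in_ball in auto)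
    have bf: "norm (?f z) \<le> 1 / 2" if "norm z < ?\<rho>" for z using nz(3) in_ball that by blast
    have \<rho>0: "?\<rho> > 0" using e W0 by simp
    have "\<exists>q. q holomorphic_on ball 0 ?\<rho> \<and>
      (\<forall>z. norm z < ?\<rho> \<longrightarrow> ?f z = (\<Sum>k<3. (deriv ^^ k) ?f 0 / fact k * z ^ k) + z ^ 3 * q z) \<and>
      (\<forall>z. norm z \<le> ?\<rho> / 4 \<longrightarrow> norm (q z) \<le> 2 * (1 / 2) * (2 / ?\<rho>) ^ 3)"
      by (rule taylor_quotient[OF hf bf \<rho>0])
    then obtain q where q: "q holomorphic_on ball 0 ?\<rho>"
      "\<And>z. norm z < ?\<rho> \<Longrightarrow> ?f z = (\<Sum>k<3. (deriv ^^ k) ?f 0 / fact k * z ^ k) + z ^ 3 * q z"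
      "\<And>z. norm z \<le> ?\<rho> / 4 \<Longrightarrow> norm (q z) \<le> 2 * (1 / 2) * (2 / ?\<rho>) ^ 3" by blast
    let ?p1 = "\<lambda>\<eta>. exp_series (\<lambda>m. pc m * mdot m (wv x)) (\<lambda>j. \<eta> * wv x j)"
    have d1: "(?f has_field_derivative ?p1 \<eta> / psi x \<eta>) (at \<eta>)" if "norm \<eta> < ?\<rho>" for \<eta>
    proof -
      have "norm \<eta> * W x < \<epsilon>" using in_ball[OF that] e by linarith
      then show ?thesis
        using nz(2)[OF in_ball[OF that]] by (auto intro!: derivative_eq_intros deriv_psi simp: field_simps)
    qed
    have p10: "?p1 0 = cinner lam (wv x)" by (simp add: exp_series_def mdot_def[where w = "\<lambda>_. 0"] infsum_pc_mdot)
    have D1: "deriv ?f 0 = cinner lam (wv x)"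
      using DERIV_imp_deriv[OF d1[of 0]] \<rho>0 unfolding p10 by (simp add: psi_0)
    \<comment> \<open>The second derivative of \<open>psi\<close> is the variance form plus the
      square of the mean form; the logarithm subtracts that square.\<close>
    have D2: "deriv (deriv ?f) 0 = cquad (wv x)"
    proof -
      have "((\<lambda>\<eta>. ?p1 \<eta> / psi x \<eta>) has_field_derivative cquad (wv x)) (at 0)"
      proof -
        have "(psi x has_field_derivative ?p1 0) (at 0)" using eps by (intro deriv_psi) simp
        from DERIV_divide[OF deriv2_psi[of x] this] show ?thesis
          unfolding p10 psi_0 by (simp add: power2_eq_square)
      qed
      moreover have "eventually (\<lambda>\<eta>. \<eta> \<in> ball 0 ?\<rho>) (nhds 0)"
        using \<rho>0 by (intro eventually_nhds_in_open) auto
      then have "eventually (\<lambda>\<eta>. deriv ?f \<eta> = ?p1 \<eta> / psi x \<eta>) (nhds 0)"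
        by eventually_elim (use d1 in \<open>auto intro!: DERIV_imp_deriv\<close>)
      ultimately have "(deriv ?f has_field_derivative cquad (wv x)) (at 0)"
        by (subst DERIV_cong_ev[OF refl _ refl]) auto
      then show ?thesis by (rule DERIV_imp_deriv)
    qed
    have sum3: "(\<Sum>k<3. (deriv ^^ k) ?f 0 / fact k * z ^ k) = z * cinner lam (wv x) + z\<^sup>2 * cquad (wv x) / 2" for z
      by (simp add: eval_nat_numeral psi_0 D1 D2)
    show "\<exists>q. q holomorphic_on ball 0 (e2 / W x ^ 3) \<and> (\<forall>\<eta>. norm \<eta> < e2 / W x ^ 3 \<longrightarrow>
       Ln (psi x \<eta>) = \<eta> * cinner lam (wv x) + \<eta>\<^sup>2 * cquad (wv x) / 2 + \<eta> ^ 3 * q \<eta> \<and> norm (\<eta> * q \<eta>) \<le> 1)"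
    proof (intro exI[of _ q] conjI allI impI)
      have sm: "norm \<eta> < ?\<rho>" if "norm \<eta> < e2 / W x ^ 3" for \<eta> :: complex
        by (rule less_le_trans[OF small[OF that]]) (use \<rho>0 in simp)
      show "q holomorphic_on ball 0 (e2 / W x ^ 3)"
        by (rule holomorphic_on_subset[OF q(1)]) (use sm in auto)
      fix \<eta> :: complex assume \<eta>: "norm \<eta> < e2 / W x ^ 3"
      show "Ln (psi x \<eta>) = \<eta> * cinner lam (wv x) + \<eta>\<^sup>2 * cquad (wv x) / 2 + \<eta> ^ 3 * q \<eta>"
        using q(2)[OF sm[OF \<eta>]] unfolding sum3 .
      have "norm (\<eta> * q \<eta>) \<le> (e2 / W x ^ 3) * (2 * (1 / 2) * (2 / ?\<rho>) ^ 3)"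
        unfolding norm_mult using \<eta> small[OF \<eta>] e2 W0 by (intro mult_mono q(3)) auto
      also have "\<dots> = 1" using e W0 by (simp add: e2_def field_simps power_divide)
      finally show "norm (\<eta> * q \<eta>) \<le> 1" .
    qed
  qed
qed

text \<open>No power of \<open>n\<close> is involved, so a bound on \<open>norm \<eta> * W x\<close>
  is enough: it keeps all arguments of the series and of the geometric factors in fixed small discs
  and bounds the exponent with \<open>\<delta>\<close>.\<close>

lemma rest_local:
  obtains e where "e > 0" "e \<le> 1"
    "\<And>\<delta> x. rest \<delta> x holomorphic_on ball 0 (e / W x)"
    "\<And>D. \<exists>M. \<forall>\<delta> x \<eta>. norm \<delta> \<le> D \<longrightarrow> norm \<eta> * W x < e \<longrightarrow> norm (rest \<delta> x \<eta>) \<le> M"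
proof -
  have "\<exists>e M. e > 0 \<and> geo_fac (\<zeta> j) holomorphic_on ball 0 e \<and> (\<forall>u. norm u < e \<longrightarrow> norm (geo_fac (\<zeta> j) u) \<le> M)" for j
    using geo_fac_local[of "\<zeta> j"] by metis
  then obtain ef Mf where ef: "\<And>j. ef j > 0" "\<And>j. geo_fac (\<zeta> j) holomorphic_on ball 0 (ef j)"
     "\<And>j u. norm u < ef j \<Longrightarrow> norm (geo_fac (\<zeta> j) u) \<le> Mf j" by metis
  define e where "e = Min (insert 1 (insert \<epsilon> (range ef)))"
  have e: "e > 0" "e \<le> 1" "e \<le> \<epsilon>"
    using eps ef(1) unfolding e_def by (auto simp: Min_le_iff)
  have e4: "e \<le> ef j" for j unfolding e_def by (rule Min_le) auto
  define S where "S = (\<Sum>\<^sub>\<infinity>m. norm (\<alpha> m) * exp (\<epsilon> * msize m))"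
  show ?thesis
  proof
    show "e > 0" "e \<le> 1" by fact+
    fix \<delta> x
    have W0: "W x > 0" using W_ge_1[of x] by linarith
    have "(\<lambda>\<eta>. exp_series \<alpha> (\<lambda>j. \<eta> * wv x j)) holomorphic_on ball 0 (e / W x)"
      by (rule holomorphic_on_subset[OF holomorphic_on_exp_series[OF alpha_exp norm_wv W0]])
         (use e W0 in \<open>auto simp: field_simps\<close>)
    moreover have "(\<lambda>\<eta>. geo_fac (\<zeta> j) (\<eta> * wv x j)) holomorphic_on ball 0 (e / W x)" for j
    proof (rule holomorphic_on_compose_gen[OF _ ef(2), unfolded o_def])
      show "(\<lambda>\<eta>. \<eta> * wv x j) ` ball 0 (e / W x) \<subseteq> ball 0 (ef j)"
      proof clarsimp
        fix z :: complex assume "norm z < e / W x"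
        then have "norm z * W x < e" using W0 by (simp add: field_simps)
        from norm_scaled_wv[OF this, of j] show "norm (z * wv x j) < ef j" using e4[of j] by linarith
      qed
    qed (intro holomorphic_intros)
    ultimately show "rest \<delta> x holomorphic_on ball 0 (e / W x)"
      unfolding rest_def[abs_def] by (intro holomorphic_intros)
  next
    fix D
    show "\<exists>M. \<forall>\<delta> x \<eta>. norm \<delta> \<le> D \<longrightarrow> norm \<eta> * W x < e \<longrightarrow> norm (rest \<delta> x \<eta>) \<le> M"
    proof (intro exI allI impI)
      fix \<delta> x :: "real^'d" and \<eta> :: complex assume \<delta>: "norm \<delta> \<le> D" and \<eta>: "norm \<eta> * W x < e"
      have 1: "norm (exp (- (\<eta> * cinner \<delta> (wv x)))) \<le> exp (CARD('d) * D)"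
      proof -
        have "norm (exp (- (\<eta> * cinner \<delta> (wv x)))) \<le> exp (norm (- (\<eta> * cinner \<delta> (wv x))))"
          by (rule norm_exp)
        also have "norm (- (\<eta> * cinner \<delta> (wv x))) \<le> norm \<eta> * (CARD('d) * norm \<delta> * W x)"
          using norm_cinner[of \<delta> x] by (simp add: norm_mult mult_left_mono)
        also have "\<dots> = (norm \<eta> * W x) * (CARD('d) * norm \<delta>)" by simp
        also have "\<dots> \<le> 1 * (CARD('d) * D)"
          using \<eta> e \<delta> by (intro mult_mono) auto
        finally show ?thesis by simp
      qed
      have 2: "norm (exp_series \<alpha> (\<lambda>j. \<eta> * wv x j)) \<le> S"
        unfolding S_def using \<eta> e by (intro norm_exp_series_le[OF alpha_exp] Re_scaled_wv) auto
      have 3: "norm (\<Prod>j\<in>UNIV. geo_fac (\<zeta> j) (\<eta> * wv x j)) \<le> (\<Prod>j\<in>UNIV. Mf j)"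
        unfolding prod_norm[symmetric]
      proof (rule prod_mono, safe)
        fix j
        show "norm (geo_fac (\<zeta> j) (\<eta> * wv x j)) \<le> Mf j"
          using \<eta> e4[of j] by (intro ef(3) norm_scaled_wv) auto
      qed auto
      show "norm (rest \<delta> x \<eta>) \<le> exp (CARD('d) * D) * S * (\<Prod>j\<in>UNIV. Mf j)"
        unfolding rest_def norm_mult
        by (intro mult_mono 1 2 3 mult_nonneg_nonneg norm_ge_zero order_trans[OF norm_ge_zero 2] exp_ge_zero)
    qed
  qed
qed

text \<open>The expansion of the logarithm shows that the exponent in \<open>germ\<close> is
  \<open>\<eta> * q \<eta>\<close>, so the point \<open>\<eta> = 0\<close> is harmless and the
  bounds are uniform in \<open>x\<close>. At \<open>\<eta> = hh n\<close> the quadratic term of the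
  logarithm becomes the Gaussian factor.\<close>

lemma germ_local:
  obtains e where "e > 0"
    "\<And>\<delta> x. germ \<delta> x holomorphic_on ball 0 (e / W x ^ 3)"
    "\<And>D. \<exists>M\<ge>0. \<forall>\<delta> x \<eta>. norm \<delta> \<le> D \<longrightarrow> norm \<eta> < e / W x ^ 3 \<longrightarrow> norm (germ \<delta> x \<eta>) \<le> M"
    "\<And>\<delta> x n. \<lbrakk>n \<ge> 1; hh n < e / W x ^ 3\<rbrakk> \<Longrightarrow> integrand n \<delta> x = gauss x * germ \<delta> x (hh n)"
proof -
  obtain e1 where e1: "e1 > 0" "e1 \<le> 1" "e1 \<le> \<epsilon>" "\<And>x \<eta>. norm \<eta> * W x < e1 \<Longrightarrow> psi x \<eta> \<noteq> 0"
    "\<And>x. \<exists>q. q holomorphic_on ball 0 (e1 / W x ^ 3) \<and> (\<forall>\<eta>. norm \<eta> < e1 / W x ^ 3 \<longrightarrow>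
       Ln (psi x \<eta>) = \<eta> * cinner lam (wv x) + \<eta>\<^sup>2 * cquad (wv x) / 2 + \<eta> ^ 3 * q \<eta> \<and> norm (\<eta> * q \<eta>) \<le> 1)"
    using Ln_psi_expansion by blast
  obtain e2 where e2: "e2 > 0" "e2 \<le> 1"
    "\<And>\<delta> x. rest \<delta> x holomorphic_on ball 0 (e2 / W x)"
    "\<And>D. \<exists>M. \<forall>\<delta> x \<eta>. norm \<delta> \<le> D \<longrightarrow> norm \<eta> * W x < e2 \<longrightarrow> norm (rest \<delta> x \<eta>) \<le> M"
    using rest_local by blast
  define e where "e = min e1 e2"
  have e: "e > 0" "e \<le> 1" "e \<le> e1" "e \<le> e2" using e1 e2 by (auto simp: e_def)
  have W3: "W x \<le> W x ^ 3" for x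
    using power_increasing[of 1 3 "W x"] W_ge_1[of x] by simp
  have Wp: "W x > 0" "W x ^ 3 > 0" for x using W_ge_1[of x] by auto
  have sm: "norm \<eta> * W x < e" "norm \<eta> < e1 / W x ^ 3" "norm \<eta> < e2 / W x" if "norm \<eta> < e / W x ^ 3" for \<eta> :: complex and x
  proof -
    have "norm \<eta> * W x \<le> norm \<eta> * W x ^ 3" by (intro mult_left_mono W3) auto
    also have "\<dots> < e" using that Wp[of x] by (simp add: field_simps)
    finally show 1: "norm \<eta> * W x < e" .
    show "norm \<eta> < e1 / W x ^ 3" using that Wp[of x] e by (auto simp: field_simps)
    show "norm \<eta> < e2 / W x" using 1 Wp[of x] e by (simp add: field_simps)
  qed
  have fac: "\<exists>q. q holomorphic_on ball 0 (e / W x ^ 3) \<and> (\<forall>\<eta>. norm \<eta> < e / W x ^ 3 \<longrightarrow>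
       germ \<delta> x \<eta> = exp (\<eta> * q \<eta>) * rest \<delta> x \<eta> \<and> norm (\<eta> * q \<eta>) \<le> 1 \<and>
       Ln (psi x \<eta>) = \<eta> * cinner lam (wv x) + \<eta>\<^sup>2 * cquad (wv x) / 2 + \<eta> ^ 3 * q \<eta>)" for \<delta> x
  proof -
    obtain q where q: "q holomorphic_on ball 0 (e1 / W x ^ 3)" "\<And>\<eta>. norm \<eta> < e1 / W x ^ 3 \<Longrightarrow>
       Ln (psi x \<eta>) = \<eta> * cinner lam (wv x) + \<eta>\<^sup>2 * cquad (wv x) / 2 + \<eta> ^ 3 * q \<eta>"
       "\<And>\<eta>. norm \<eta> < e1 / W x ^ 3 \<Longrightarrow> norm (\<eta> * q \<eta>) \<le> 1"
      using e1(5)[of x] by blast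
    show ?thesis
    proof (intro exI[of _ q] conjI allI impI)
      show "q holomorphic_on ball 0 (e / W x ^ 3)"
        by (rule holomorphic_on_subset[OF q(1)]) (use sm(2) in auto)
      fix \<eta> :: complex assume \<eta>: "norm \<eta> < e / W x ^ 3"
      note q' = q(2)[OF sm(2)[OF \<eta>]]
      show "Ln (psi x \<eta>) = \<eta> * cinner lam (wv x) + \<eta>\<^sup>2 * cquad (wv x) / 2 + \<eta> ^ 3 * q \<eta>" by (rule q')
      show "norm (\<eta> * q \<eta>) \<le> 1" by (rule q(3)[OF sm(2)[OF \<eta>]])
      show "germ \<delta> x \<eta> = exp (\<eta> * q \<eta>) * rest \<delta> x \<eta>"
        unfolding germ_def q' by (simp add: field_simps power2_eq_square power3_eq_cube)
    qed
  qed
  show ?thesis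
  proof
    show "e > 0" by fact
  next
    fix \<delta> x
    obtain q where q: "q holomorphic_on ball 0 (e / W x ^ 3)" "\<And>\<eta>. norm \<eta> < e / W x ^ 3 \<Longrightarrow> germ \<delta> x \<eta> = exp (\<eta> * q \<eta>) * rest \<delta> x \<eta>"
      using fac[of x \<delta>] by blast
    have "(\<lambda>\<eta>. exp (\<eta> * q \<eta>) * rest \<delta> x \<eta>) holomorphic_on ball 0 (e / W x ^ 3)"
      by (intro holomorphic_intros q(1) holomorphic_on_subset[OF e2(3)]) (use sm(3) in auto)
    then show "germ \<delta> x holomorphic_on ball 0 (e / W x ^ 3)"
      by (rule holomorphic_transform) (use q(2) in auto)
  next
    fix D
    obtain M where M: "\<And>\<delta> x \<eta>. norm \<delta> \<le> D \<Longrightarrow> norm \<eta> * W x < e2 \<Longrightarrow> norm (rest \<delta> x \<eta>) \<le> M"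
      using e2(4) by blast
    show "\<exists>M\<ge>0. \<forall>\<delta> x \<eta>. norm \<delta> \<le> D \<longrightarrow> norm \<eta> < e / W x ^ 3 \<longrightarrow> norm (germ \<delta> x \<eta>) \<le> M"
    proof (intro exI[of _ "exp 1 * \<bar>M\<bar>"] conjI allI impI)
      fix \<delta> x :: "real^'d" and \<eta> :: complex assume \<delta>: "norm \<delta> \<le> D" and \<eta>: "norm \<eta> < e / W x ^ 3"
      obtain q where q: "germ \<delta> x \<eta> = exp (\<eta> * q \<eta>) * rest \<delta> x \<eta>" "norm (\<eta> * q \<eta>) \<le> 1"
        using fac[of x \<delta>] \<eta> by blast
      have "norm (exp (\<eta> * q \<eta>)) \<le> exp 1" using norm_exp[of "\<eta> * q \<eta>"] q(2) by (meson exp_le_cancel_iff order_trans)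
      moreover have "norm (rest \<delta> x \<eta>) \<le> \<bar>M\<bar>" using M[OF \<delta>, of \<eta> x] sm(1)[OF \<eta>] e by linarith
      ultimately show "norm (germ \<delta> x \<eta>) \<le> exp 1 * \<bar>M\<bar>"
        unfolding q(1) norm_mult by (intro mult_mono) auto
    qed auto
  next
    fix n :: nat and \<delta> x :: "real^'d" assume n: "(n::nat) \<ge> 1" and h: "hh n < e / W x ^ 3"
    have hp: "hh n > 0" and hn: "real n * (hh n)\<^sup>2 = 1" using n by (auto simp: hh_def power_divide)
    let ?h = "complex_of_real (hh n)"
    have \<eta>: "norm ?h < e / W x ^ 3" using h hp by simp
    obtain q where q: "germ \<delta> x ?h = exp (?h * q ?h) * rest \<delta> x ?h"
       "Ln (psi x ?h) = ?h * cinner lam (wv x) + ?h\<^sup>2 * cquad (wv x) / 2 + ?h ^ 3 * q ?h"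
      using fac[of x \<delta>] \<eta> by blast
    have psi: "psi x ?h = exp (?h * cinner lam (wv x) + ?h\<^sup>2 * cquad (wv x) / 2 + ?h ^ 3 * q ?h)"
      using exp_Ln[OF e1(4), of ?h x] sm(1)[OF \<eta>] e unfolding q(2) by simp
    \<comment> \<open>Raising to the power \<open>n\<close> therefore removes the factor
      \<open>?h\<^sup>2\<close> from the exponent.\<close>
    have chn: "of_nat n * ?h\<^sup>2 = 1" using hn by (metis of_real_1 of_real_mult of_real_of_nat_eq of_real_power)
    \<comment> \<open>Small \<open>hh n * W x\<close> means \<open>W x \<le> sqrt n\<close>, so the
      cut-off in \<open>integrand\<close> is invisible here.\<close>
    have "x \<in> box_n n"
    proof -
      have "\<bar>x $ j\<bar> \<le> pi * sqrt (real n)" for j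
      proof -
        have "hh n * W x \<le> 1" using sm(1)[OF \<eta>] e hp by simp
        then have "W x \<le> sqrt (real n)" using n by (simp add: hh_def field_simps)
        moreover have "sqrt (real n) \<le> pi * sqrt (real n)" using mult_right_mono[of 1 pi "sqrt (real n)"] pi_ge_two by simp
        moreover have "\<bar>x $ j\<bar> \<le> W x" using component_le_norm_cart[of x j] by (simp add: W_def)
        ultimately show ?thesis by linarith
      qed
      then show ?thesis by (simp add: box_n_def)
    qed
    then have "integrand n \<delta> x = (psi x ?h * exp (- (?h * cinner lam (wv x)))) ^ n * rest \<delta> x ?h"
      by (simp add: integrand_def)
    also have "psi x ?h * exp (- (?h * cinner lam (wv x))) = exp (?h\<^sup>2 * (cquad (wv x) / 2 + ?h * q ?h))"
      unfolding psi exp_add[symmetric] by (simp add: algebra_simps power2_eq_square power3_eq_cube)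
    also have "\<dots> ^ n = exp ((of_nat n * ?h\<^sup>2) * (cquad (wv x) / 2 + ?h * q ?h))"
      by (simp add: exp_of_nat_mult[symmetric] mult.assoc)
    also have "\<dots> = gauss x * exp (?h * q ?h)"
      unfolding chn by (simp add: gauss_def exp_add)
    finally show "integrand n \<delta> x = gauss x * germ \<delta> x (hh n)" unfolding q(1) by simp
  qed
qed

lemma cquad_wv: "cquad (wv x) = complex_of_real (crit_ind \<bullet> (cov *v crit_ind) - x \<bullet> (cov *v x)) - 2 * \<i> * complex_of_real (x \<bullet> (cov *v crit_ind))"
proof -
  have sym: "cov $ i $ j = cov $ j $ i" for i j by (simp add: cov_def mult.commute)
  have dot: "u \<bullet> (cov *v v) = (\<Sum>i\<in>UNIV. \<Sum>j\<in>UNIV. cov $ i $ j * (u $ i * v $ j))" for u v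
    by (simp add: inner_vec_def matrix_vector_mult_def sum_distrib_left mult_ac)
  have 1: "x \<bullet> (cov *v crit_ind) = crit_ind \<bullet> (cov *v x)"
    unfolding dot by (subst sum.swap, subst sym) (simp only: mult.commute)
  define a where "a i j = cov $ i $ j * (crit_ind $ i * crit_ind $ j) - cov $ i $ j * (x $ i * x $ j)" for i j
  define b where "b i j = cov $ i $ j * (x $ i * crit_ind $ j) + cov $ i $ j * (crit_ind $ i * x $ j)" for i j
  have "complex_of_real (cov $ i $ j) * (wv x i * wv x j) = complex_of_real (a i j) - \<i> * complex_of_real (b i j)" for i j
    by (simp add: wv_def a_def b_def complex_eq_iff algebra_simps)
  then have "cquad (wv x) = complex_of_real (\<Sum>i\<in>UNIV. \<Sum>j\<in>UNIV. a i j) - \<i> * complex_of_real (\<Sum>i\<in>UNIV. \<Sum>j\<in>UNIV. b i j)"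
    unfolding cquad_def by (simp only: sum_subtractf of_real_sum sum_distrib_left)
  also have "(\<Sum>i\<in>UNIV. \<Sum>j\<in>UNIV. a i j) = crit_ind \<bullet> (cov *v crit_ind) - x \<bullet> (cov *v x)"
    unfolding a_def dot by (simp only: sum_subtractf)
  also have "(\<Sum>i\<in>UNIV. \<Sum>j\<in>UNIV. b i j) = x \<bullet> (cov *v crit_ind) + crit_ind \<bullet> (cov *v x)"
    unfolding b_def dot by (simp only: sum.distrib)
  finally show ?thesis unfolding 1[symmetric] by simp
qed

lemma norm_gauss: "norm (gauss x) = exp ((crit_ind \<bullet> (cov *v crit_ind) - x \<bullet> (cov *v x)) / 2)"
  by (simp add: gauss_def cquad_wv norm_exp_eq_Re)

text \<open>For real \<open>h\<close> the points lie on the shifted contour, where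
  \<open>geo_fac_global\<close> holds for every \<open>x\<close>. Each coordinate costs at most one
  factor \<open>W x\<close>.\<close>

lemma rest_global:
  obtains K where "K \<ge> 0" "\<And>n \<delta> x. \<lbrakk>n \<ge> 1; norm \<delta> \<le> D\<rbrakk> \<Longrightarrow> norm (rest \<delta> x (hh n)) \<le> K * W x ^ CARD('d)"
proof -
  define S where "S = (\<Sum>\<^sub>\<infinity>m. norm (\<alpha> m) * exp (\<epsilon> * msize m))"
  define Kf where "Kf j = (if \<zeta> j = 1 then 2 else 1 / (1 - \<zeta> j))" for j
  have Kf: "Kf j \<ge> 0" for j using zeta(2)[of j] by (simp add: Kf_def)
  have S0: "S \<ge> 0" unfolding S_def by (rule infsum_nonneg) auto
  show ?thesis
  proof
    show "exp (D * norm crit_ind) * S * (\<Prod>j\<in>UNIV. Kf j) \<ge> 0" using S0 Kf by (intro mult_nonneg_nonneg prod_nonneg) auto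
    fix n :: nat and \<delta> x :: "real^'d" assume n: "(n::nat) \<ge> 1" and \<delta>: "norm \<delta> \<le> D"
    have h: "hh n > 0" "hh n \<le> 1" using n by (auto simp: hh_def)
    have 1: "norm (exp (- (of_real (hh n) * cinner \<delta> (wv x)))) \<le> exp (D * norm crit_ind)"
    proof -
      have "Re (cinner \<delta> (wv x)) = - (\<delta> \<bullet> crit_ind)"
        by (simp add: cinner_def wv_def inner_vec_def sum_negf)
      then have "norm (exp (- (of_real (hh n) * cinner \<delta> (wv x)))) = exp (hh n * (\<delta> \<bullet> crit_ind))"
        by (simp add: norm_exp_eq_Re)
      also have "hh n * (\<delta> \<bullet> crit_ind) \<le> 1 * (norm \<delta> * norm crit_ind)"
        using h norm_cauchy_schwarz[of \<delta> crit_ind] by (intro order_trans[OF mult_left_mono[OF norm_cauchy_schwarz] mult_right_mono]) auto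
      also have "\<dots> \<le> D * norm crit_ind" using \<delta> by (simp add: mult_right_mono)
      finally show ?thesis by simp
    qed
    have Re0: "Re (of_real (hh n) * wv x j) = - hh n * of_bool (\<zeta> j = 1)" for j by (simp add: wv_def crit_ind_def)
    have 2: "norm (exp_series \<alpha> (\<lambda>j. of_real (hh n) * wv x j)) \<le> S"
      unfolding S_def using h eps by (intro norm_exp_series_le[OF alpha_exp]) (simp add: Re0 del: times_complex.sel)
    have 3: "norm (\<Prod>j\<in>UNIV. geo_fac (\<zeta> j) (of_real (hh n) * wv x j)) \<le> (\<Prod>j\<in>UNIV. Kf j * W x)"
      unfolding prod_norm[symmetric]
    proof (rule prod_mono, safe)
      fix j
      have "norm (geo_fac (\<zeta> j) (of_real (hh n) * wv x j)) \<le>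
        (if \<zeta> j = 1 then 2 * norm (of_real (hh n) * wv x j) / hh n else 1 / (1 - \<zeta> j))"
        by (intro geo_fac_global h Re0 zeta less_imp_le[OF zeta(1)])
      also have "\<dots> \<le> Kf j * W x"
        using h norm_wv[of x j] W_ge_1[of x] zeta(2)[of j] mult_left_mono[OF W_ge_1 Kf, of j x] by (auto simp: norm_mult Kf_def)
      finally show "norm (geo_fac (\<zeta> j) (of_real (hh n) * wv x j)) \<le> Kf j * W x" .
    qed auto
    have "norm (rest \<delta> x (hh n)) \<le> exp (D * norm crit_ind) * S * (\<Prod>j\<in>UNIV. Kf j * W x)"
      unfolding rest_def norm_mult
      by (intro mult_mono 1 2 3 mult_nonneg_nonneg norm_ge_zero S0 exp_ge_zero)
    then show "norm (rest \<delta> x (hh n)) \<le> exp (D * norm crit_ind) * S * (\<Prod>j\<in>UNIV. Kf j) * W x ^ CARD('d)"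
      by (simp add: prod.distrib)
  qed
qed

text \<open>In the n-th power the linear cost of the shift cancels and
  \<open>n * h\<^sup>2 = 1\<close>, so the bound for one factor becomes
  \<open>exp (C2 - c2 * (norm x)\<^sup>2)\<close>. The constant \<open>c\<close> is the smaller of
  this decay rate and that of the Gaussian.\<close>

lemma gaussian_bounds:
  obtains c where "c > 0" "\<exists>C\<ge>0. \<forall>x. norm (gauss x) \<le> C * exp (- c * (norm x)\<^sup>2)"
    "\<And>D. \<exists>C\<ge>0. \<forall>n \<delta> x. n \<ge> 1 \<longrightarrow> norm \<delta> \<le> D \<longrightarrow> norm (integrand n \<delta> x) \<le> C * W x ^ CARD('d) * exp (- c * (norm x)\<^sup>2)"
proof -
  obtain c1 where c1: "c1 > 0" "\<And>x. c1 * (norm x)\<^sup>2 \<le> x \<bullet> (cov *v x)"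
    using positive_definite_lower_bound[OF cov_pd] by blast
  obtain c2 where c2: "c2 > 0" "\<And>h x. \<lbrakk>0 < h; h \<le> 1; \<And>j. \<bar>x $ j\<bar> \<le> pi / h\<rbrakk> \<Longrightarrow>
    norm (exp_series pc (\<lambda>j. of_real h * wv x j)) \<le> exp (- h * (lam \<bullet> crit_ind) + h\<^sup>2 * (C2 - c2 * (norm x)\<^sup>2))"
    using norm_pgf_le by blast
  define c where "c = min (c1 / 2) c2"
  have c: "c > 0" "c \<le> c1 / 2" "c \<le> c2" using c1 c2 by (auto simp: c_def)
  show ?thesis
  proof
    show "c > 0" by fact
    show "\<exists>C\<ge>0. \<forall>x. norm (gauss x) \<le> C * exp (- c * (norm x)\<^sup>2)"
    proof (intro exI[of _ "exp ((crit_ind \<bullet> (cov *v crit_ind)) / 2)"] conjI allI)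
      fix x :: "real^'d"
      have "c * (norm x)\<^sup>2 \<le> (c1 / 2) * (norm x)\<^sup>2" by (intro mult_right_mono c) auto
      then have "(crit_ind \<bullet> (cov *v crit_ind) - x \<bullet> (cov *v x)) / 2 \<le> (crit_ind \<bullet> (cov *v crit_ind)) / 2 + - c * (norm x)\<^sup>2"
        using c1(2)[of x] by (simp add: field_simps)
      then show "norm (gauss x) \<le> exp ((crit_ind \<bullet> (cov *v crit_ind)) / 2) * exp (- c * (norm x)\<^sup>2)"
        unfolding norm_gauss exp_add[symmetric] by (simp only: exp_le_cancel_iff)
    qed auto
    fix D
    obtain K where K: "K \<ge> 0" "\<And>n \<delta> x. \<lbrakk>n \<ge> 1; norm \<delta> \<le> D\<rbrakk> \<Longrightarrow> norm (rest \<delta> x (hh n)) \<le> K * W x ^ CARD('d)"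
      using rest_global[of D] by blast
    show "\<exists>C\<ge>0. \<forall>n \<delta> x. n \<ge> 1 \<longrightarrow> norm \<delta> \<le> D \<longrightarrow> norm (integrand n \<delta> x) \<le> C * W x ^ CARD('d) * exp (- c * (norm x)\<^sup>2)"
    proof (intro exI[of _ "exp C2 * K"] conjI allI impI)
      show "exp C2 * K \<ge> 0" using K by simp
      fix n :: nat and \<delta> x :: "real^'d" assume n: "(n::nat) \<ge> 1" and \<delta>: "norm \<delta> \<le> D"
      have W0: "W x ^ CARD('d) \<ge> 0" using W_ge_1[of x] by simp
      show "norm (integrand n \<delta> x) \<le> exp C2 * K * W x ^ CARD('d) * exp (- c * (norm x)\<^sup>2)"
      proof (cases "x \<in> box_n n")
        case True
        have h: "hh n > 0" "hh n \<le> 1" "pi / hh n = pi * sqrt (real n)" "real n * (hh n)\<^sup>2 = 1"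
          using n by (auto simp: hh_def power_divide)
        have psi: "norm (psi x (hh n)) \<le> exp (- hh n * (lam \<bullet> crit_ind) + (hh n)\<^sup>2 * (C2 - c2 * (norm x)\<^sup>2))"
          unfolding psi_def using h True by (intro c2(2)) (auto simp: box_n_def)
        have "Re (cinner lam (wv x)) = - (lam \<bullet> crit_ind)"
          by (simp add: cinner_def wv_def inner_vec_def sum_negf)
        then have "norm (psi x (hh n) * exp (- (hh n * cinner lam (wv x)))) = norm (psi x (hh n)) * exp (hh n * (lam \<bullet> crit_ind))"
          by (simp add: norm_mult norm_exp_eq_Re)
        also have "\<dots> \<le> exp (- hh n * (lam \<bullet> crit_ind) + (hh n)\<^sup>2 * (C2 - c2 * (norm x)\<^sup>2)) * exp (hh n * (lam \<bullet> crit_ind))"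
          by (intro mult_right_mono psi) auto
        also have "\<dots> = exp ((hh n)\<^sup>2 * (C2 - c2 * (norm x)\<^sup>2))" by (simp flip: exp_add)
        finally have "norm (psi x (hh n) * exp (- (hh n * cinner lam (wv x)))) ^ n \<le> exp ((hh n)\<^sup>2 * (C2 - c2 * (norm x)\<^sup>2)) ^ n"
          by (intro power_mono) auto
        also have "\<dots> = exp ((real n * (hh n)\<^sup>2) * (C2 - c2 * (norm x)\<^sup>2))"
          by (simp add: exp_of_nat_mult[symmetric] mult.assoc)
        also have "\<dots> = exp (C2 - c2 * (norm x)\<^sup>2)" unfolding h(4) by simp
        also have "\<dots> \<le> exp C2 * exp (- c * (norm x)\<^sup>2)"
          using mult_right_mono[OF c(3), of "(norm x)\<^sup>2"] by (simp flip: exp_add)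
        finally have "norm (integrand n \<delta> x) \<le> (exp C2 * exp (- c * (norm x)\<^sup>2)) * (K * W x ^ CARD('d))"
          using True unfolding integrand_def by (simp add: norm_mult norm_power del: of_real_exp) (intro mult_mono K n \<delta>; simp add: norm_mult)
        then show ?thesis by (simp add: mult_ac)
      next
        case False
        then show ?thesis using K W0 by (simp add: integrand_def)
      qed
    qed
  qed
qed

text \<open>Both regimes are expressed through \<open>T = 4 * hh n * W x ^ 3 / e\<close>. For
  \<open>T \<le> 1\<close> Taylor's formula gives an error of order \<open>T ^ r\<close>; for
  \<open>T > 1\<close> the integrand and all Taylor terms are themselves at most a constant times
  \<open>T ^ r\<close>, up to the common Gaussian and polynomial factors.\<close>

lemma integrand_expansion:
  obtains c where "c > 0" "\<And>D r. \<exists>C N. C \<ge> 0 \<and> (\<forall>n \<delta> x. n \<ge> 1 \<longrightarrow> norm \<delta> \<le> D \<longrightarrow>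
    norm (integrand n \<delta> x - gauss x * (\<Sum>k<r. germ_coeff k \<delta> x * of_real (hh n ^ k))) \<le> C * hh n ^ r * (W x ^ N * exp (- c * (norm x)\<^sup>2)))"
proof -
  obtain c where c: "c > 0" "\<exists>C\<ge>0. \<forall>x. norm (gauss x) \<le> C * exp (- c * (norm x)\<^sup>2)"
    "\<And>D. \<exists>C\<ge>0. \<forall>n \<delta> x. n \<ge> 1 \<longrightarrow> norm \<delta> \<le> D \<longrightarrow> norm (integrand n \<delta> x) \<le> C * W x ^ CARD('d) * exp (- c * (norm x)\<^sup>2)"
    using gaussian_bounds by blast
  obtain e where e: "e > 0" "\<And>\<delta> x. germ \<delta> x holomorphic_on ball 0 (e / W x ^ 3)"
    "\<And>D. \<exists>M\<ge>0. \<forall>\<delta> x \<eta>. norm \<delta> \<le> D \<longrightarrow> norm \<eta> < e / W x ^ 3 \<longrightarrow> norm (germ \<delta> x \<eta>) \<le> M"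
    "\<And>\<delta> x n. \<lbrakk>n \<ge> 1; hh n < e / W x ^ 3\<rbrakk> \<Longrightarrow> integrand n \<delta> x = gauss x * germ \<delta> x (hh n)"
    using germ_local by blast
  show ?thesis
  proof
    show "c > 0" by fact
    fix D and r :: nat
    obtain Cg where Cg: "Cg \<ge> 0" "\<And>x. norm (gauss x) \<le> Cg * exp (- c * (norm x)\<^sup>2)" using c(2) by blast
    obtain CG where CG: "CG \<ge> 0" "\<And>n \<delta> x. n \<ge> 1 \<Longrightarrow> norm \<delta> \<le> D \<Longrightarrow> norm (integrand n \<delta> x) \<le> CG * W x ^ CARD('d) * exp (- c * (norm x)\<^sup>2)"
      using c(3)[of D] by blast
    obtain M where M: "M \<ge> 0" "\<And>\<delta> x \<eta>. norm \<delta> \<le> D \<Longrightarrow> norm \<eta> < e / W x ^ 3 \<Longrightarrow> norm (germ \<delta> x \<eta>) \<le> M"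
      using e(3)[of D] by blast
    \<comment> \<open>The three summands account for the integrand itself, the \<open>r\<close>
      Taylor terms and the Taylor remainder; \<open>(4 / e) ^ r\<close> is the constant part of
      \<open>T ^ r\<close>.\<close>
    define C where "C = (CG + Cg * r * M + 2 * Cg * M) * (4 / e) ^ r"
    show "\<exists>C N. C \<ge> 0 \<and> (\<forall>n \<delta> x. n \<ge> 1 \<longrightarrow> norm \<delta> \<le> D \<longrightarrow>
      norm (integrand n \<delta> x - gauss x * (\<Sum>k<r. germ_coeff k \<delta> x * of_real (hh n ^ k))) \<le> C * hh n ^ r * (W x ^ N * exp (- c * (norm x)\<^sup>2)))"
    proof (intro exI[of _ C] exI[of _ "3 * r + CARD('d)"] conjI allI impI)
      show "C \<ge> 0" unfolding C_def using Cg(1) CG(1) M(1) e(1) by simp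
      fix n :: nat and \<delta> x :: "real^'d" assume n: "(n::nat) \<ge> 1" and \<delta>: "norm \<delta> \<le> D"
      let ?E = "exp (- c * (norm x)\<^sup>2)" and ?\<rho> = "e / W x ^ 3"
      let ?S = "\<Sum>k<r. germ_coeff k \<delta> x * of_real (hh n ^ k)"
      have W1: "W x ^ 3 > 0" "W x ^ CARD('d) \<ge> 1" using W_ge_1[of x] by (auto simp: one_le_power)
      have \<rho>: "?\<rho> > 0" using e W1 by simp
      have h: "hh n > 0" using n by (simp add: hh_def)
      define T where "T = 4 * hh n / ?\<rho>"
      have T0: "T \<ge> 0" unfolding T_def using h \<rho> by (intro divide_nonneg_pos) auto
      have Tr: "C * hh n ^ r * (W x ^ (3 * r + CARD('d)) * ?E) = (CG + Cg * r * M + 2 * Cg * M) * T ^ r * (W x ^ CARD('d) * ?E)"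
        unfolding C_def T_def by (simp add: power_add power_mult power_mult_distrib power_divide)
      show "norm (integrand n \<delta> x - gauss x * ?S) \<le> C * hh n ^ r * (W x ^ (3 * r + CARD('d)) * ?E)"
      \<comment> \<open>The threshold is the disc on which \<open>taylor_quotient\<close> bounds the
        quotient, that is, \<open>T \<le> 1\<close>.\<close>
      proof (cases "hh n \<le> ?\<rho> / 4")
        case True
        obtain q where q0: "q holomorphic_on ball 0 ?\<rho>" and q: "\<And>z. norm z < ?\<rho> \<Longrightarrow> germ \<delta> x z = (\<Sum>k<r. (deriv ^^ k) (germ \<delta> x) 0 / fact k * z ^ k) + z ^ r * q z"
          "\<And>z. norm z \<le> ?\<rho> / 4 \<Longrightarrow> norm (q z) \<le> 2 * M * (2 / ?\<rho>) ^ r"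
          using taylor_quotient[OF e(2) M(2)[OF \<delta>] \<rho>, where r = r] by blast
        have hr: "hh n < ?\<rho>" by (rule le_less_trans[OF True]) (use \<rho> in simp)
        have "germ \<delta> x (hh n) = ?S + of_real (hh n) ^ r * q (hh n)"
          using q(1)[of "of_real (hh n)"] hr h by (simp add: germ_coeff_def)
        then have "integrand n \<delta> x - gauss x * ?S = gauss x * (of_real (hh n) ^ r * q (hh n))"
          using e(4)[OF n hr] by (simp add: algebra_simps)
        also have "norm \<dots> \<le> (Cg * ?E) * (hh n ^ r * (2 * M * (2 / ?\<rho>) ^ r))"
          unfolding norm_mult norm_power using True h Cg(1)
          by (intro mult_mono Cg(2) q(2)) auto
        also have "\<dots> = (2 * Cg * M) * (T / 2) ^ r * (1 * ?E)"
          unfolding T_def by (simp add: power_mult_distrib power_divide)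
        also have "\<dots> \<le> (CG + Cg * r * M + 2 * Cg * M) * T ^ r * (W x ^ CARD('d) * ?E)"
          using W1 T0 Cg(1) CG(1) M(1) by (intro mult_mono power_mono mult_nonneg_nonneg) auto
        finally show ?thesis unfolding Tr .
      next
        case False
        have "1 \<le> 4 * y / a" if "\<not> y \<le> a / 4" "a > 0" for y a :: real
          using that by (simp add: field_simps)
        from this[OF False \<rho>] have T1: "T \<ge> 1" unfolding T_def .
        have ck: "norm (germ_coeff k \<delta> x * of_real (hh n ^ k)) \<le> M * T ^ r" if "k < r" for k
        proof -
          have "0 \<le> 2 / ?\<rho>" using \<rho> by (intro divide_nonneg_pos) auto
          then have "0 \<le> M * (2 / ?\<rho>) ^ k" by (intro mult_nonneg_nonneg M zero_le_power)
          then have "norm (germ_coeff k \<delta> x * of_real (hh n ^ k)) \<le> (M * (2 / ?\<rho>) ^ k) * hh n ^ k"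
            unfolding norm_mult germ_coeff_def using h
            by (intro mult_mono norm_taylor_coeff_le[OF e(2) M(2)[OF \<delta>] \<rho>]) (simp_all add: norm_power)
          also have "\<dots> = M * (T / 2) ^ k" by (simp add: T_def power_mult_distrib power_divide)
          also have "\<dots> \<le> M * T ^ k" using T0 M(1) by (intro mult_left_mono power_mono) auto
          also have "\<dots> \<le> M * T ^ r" using T1 that M(1) by (intro mult_left_mono power_increasing) auto
          finally show ?thesis .
        qed
        have "norm ?S \<le> (\<Sum>k<r. M * T ^ r)"
          by (rule order_trans[OF norm_sum sum_mono]) (use ck in auto)
        then have S: "norm ?S \<le> r * M * T ^ r" by simp
        have "norm (integrand n \<delta> x - gauss x * ?S) \<le> norm (integrand n \<delta> x) + norm (gauss x) * norm ?S"
          by (rule order_trans[OF norm_triangle_ineq4]) (simp add: norm_mult)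
        also have "\<dots> \<le> CG * W x ^ CARD('d) * ?E + (Cg * ?E) * (r * M * T ^ r)"
          by (intro add_mono mult_mono CG Cg S n \<delta> mult_nonneg_nonneg) auto
        also have "\<dots> \<le> CG * (T ^ r * (W x ^ CARD('d) * ?E)) + Cg * r * M * (T ^ r * (W x ^ CARD('d) * ?E))"
        proof (rule add_mono)
          have "1 * (W x ^ CARD('d) * ?E) \<le> T ^ r * (W x ^ CARD('d) * ?E)"
            using T1 W1 by (intro mult_right_mono one_le_power) auto
          from mult_left_mono[OF this CG(1)] show "CG * W x ^ CARD('d) * ?E \<le> CG * (T ^ r * (W x ^ CARD('d) * ?E))"
            by (simp add: mult_ac)
          have "T ^ r * (1 * ?E) \<le> T ^ r * (W x ^ CARD('d) * ?E)"
            using W1 T0 by (intro mult_left_mono mult_right_mono) auto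
          then have "Cg * r * M * (T ^ r * (1 * ?E)) \<le> Cg * r * M * (T ^ r * (W x ^ CARD('d) * ?E))"
            by (rule mult_left_mono) (use Cg(1) M(1) in auto)
          then show "(Cg * ?E) * (r * M * T ^ r) \<le> Cg * r * M * (T ^ r * (W x ^ CARD('d) * ?E))"
            by (simp add: mult_ac)
        qed
        also have "\<dots> \<le> (CG + Cg * r * M + 2 * Cg * M) * T ^ r * (W x ^ CARD('d) * ?E)"
        proof -
          have "0 \<le> 2 * Cg * M * (T ^ r * (W x ^ CARD('d) * ?E))"
            using Cg(1) M(1) T0 W1 by simp
          then show ?thesis by (simp add: algebra_simps)
        qed
        finally show ?thesis unfolding Tr .
      qed
    qed
  qed
qed

end

section \<open>The coefficients of the expansion\<close>

lemma matrix_inv_det: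
  fixes A :: "real^'n::finite^'n" assumes "det A \<noteq> 0"
  shows "A ** matrix_inv A = mat 1" "matrix_inv A ** A = mat 1"
proof -
  have "\<exists>X. A ** X = mat 1 \<and> X ** A = mat 1"
    using assms invertible_det_nz[of A] unfolding invertible_def by blast
  then have "A ** matrix_inv A = mat 1 \<and> matrix_inv A ** A = mat 1"
    unfolding matrix_inv_def by (rule someI_ex)
  then show "A ** matrix_inv A = mat 1" "matrix_inv A ** A = mat 1" by auto
qed

lemma
  fixes w :: complex assumes w: "Re w < 0"
  shows integrable_laplace_exp: "integrable lborel (\<lambda>u. indicator {0<..} u *\<^sub>R exp (w * of_real u))"
    and integral_laplace_exp: "(\<integral>u. indicator {0<..} u *\<^sub>R exp (w * of_real u) \<partial>lborel) = - (1 / w)"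
proof -
  have e: "einterval 0 \<infinity> = {0<..}" by (auto simp: einterval_def zero_ereal_def)
  have "set_integrable lborel (einterval 0 \<infinity>) (\<lambda>u. exp (Re w * u))"
  proof (rule interval_integral_FTC_nonneg)
    show "((\<lambda>u. exp (Re w * u) / Re w) has_field_derivative exp (Re w * x)) (at x)" for x
      using w by (auto intro!: derivative_eq_intros)
    show "(((\<lambda>u. exp (Re w * u) / Re w) \<circ> real_of_ereal) \<longlongrightarrow> 1 / Re w) (at_right 0)"
      unfolding zero_ereal_def ereal_tendsto_simps
      by (rule tendsto_eq_intros filterlim_ident | use w in simp)+ 
    show "(((\<lambda>u. exp (Re w * u) / Re w) \<circ> real_of_ereal) \<longlongrightarrow> 0) (at_left \<infinity>)"
      unfolding ereal_tendsto_simps using w by real_asymp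
  qed (auto intro!: continuous_intros)
  then have si: "set_integrable lborel (einterval 0 \<infinity>) (\<lambda>u. exp (w * of_real u))"
    unfolding set_integrable_def
    by (rule Bochner_Integration.integrable_bound) (auto simp: indicator_def)
  then show "integrable lborel (\<lambda>u. indicator {0<..} u *\<^sub>R exp (w * of_real u))"
    unfolding set_integrable_def e .
  have w0: "w \<noteq> 0" using w by auto
  have "(LBINT u=0..\<infinity>. exp (w * of_real u)) = 0 - 1 / w"
  proof (rule interval_integral_FTC_integrable)
    fix x :: real
    have "((\<lambda>u. exp (w * u) / w) has_field_derivative exp (w * of_real x)) (at (of_real x))"
      using w0 by (auto intro!: derivative_eq_intros)
    then show "((\<lambda>u. exp (w * of_real u) / w) has_vector_derivative exp (w * of_real x)) (at x)"
      by (rule has_vector_derivative_real_field)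
    have "((\<lambda>u. exp (w * of_real u) / w) \<longlongrightarrow> exp (w * of_real 0) / w) (at_right 0)"
      using w0 by (intro tendsto_intros) auto
    then show "(((\<lambda>u. exp (w * of_real u) / w) \<circ> real_of_ereal) \<longlongrightarrow> 1 / w) (at_right 0)"
      unfolding zero_ereal_def ereal_tendsto_simps by simp
    have "((\<lambda>u. exp (w * of_real u) / w) \<longlongrightarrow> 0) at_top"
    proof (rule tendsto_norm_zero_cancel)
      show "((\<lambda>u. norm (exp (w * of_real u) / w)) \<longlongrightarrow> 0) at_top"
        unfolding norm_divide norm_exp_eq_Re using w w0 by simp real_asymp
    qed
    then show "(((\<lambda>u. exp (w * of_real u) / w) \<circ> real_of_ereal) \<longlongrightarrow> 0) (at_left \<infinity>)"
      unfolding ereal_tendsto_simps .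
  qed (use si in \<open>auto intro!: continuous_intros\<close>)
  then show "(\<integral>u. indicator {0<..} u *\<^sub>R exp (w * of_real u) \<partial>lborel) = - (1 / w)"
    unfolding interval_lebesgue_integral_def set_lebesgue_integral_def e by simp
qed

context saddle
begin

text \<open>The poles taken out of the geometric factors, in the scaled variable: a factor
  \<open>- 1 / (h * w)\<close> is split into this one and \<open>1 / h = sqrt n\<close>.\<close>

definition pole_prod :: "real^'d \<Rightarrow> complex" where
  "pole_prod x = (\<Prod>j\<in>UNIV. if \<zeta> j = 1 then - (1 / wv x j) else 1)"

definition exp_coeff :: "nat \<Rightarrow> real^'d \<Rightarrow> complex" where
  "exp_coeff k \<delta> = (1 / (2 * pi) ^ CARD('d)) *\<^sub>R (\<integral>x. gauss x * germ_coeff k \<delta> x * pole_prod x \<partial>lborel)"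

lemma continuous_on_wv [continuous_intros]: "continuous_on A (\<lambda>x. wv x j)"
  unfolding wv_def Complex_eq by (intro continuous_intros)

lemma wv_measurable [measurable]: "(\<lambda>x. wv x j) \<in> borel_measurable borel"
  by (intro borel_measurable_continuous_onI continuous_intros)

lemma exp_series_wv_measurable:
  assumes "exp_summable f \<epsilon>" "h \<ge> 0"
  shows "(\<lambda>x. exp_series f (\<lambda>j. of_real h * wv x j)) \<in> borel_measurable borel"
proof (rule borel_measurable_continuous_onI, rule continuous_on_exp_series[OF assms(1)])
  fix x j
  show "Re (of_real h * wv x j) \<le> \<epsilon>" using assms(2) eps by (simp add: wv_def crit_ind_def)
qed (intro continuous_intros)

lemma geo_fac_measurable [measurable]: "geo_fac z \<in> borel_measurable borel"
  unfolding geo_fac_def[abs_def] by measurable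

lemma box_n_measurable [measurable]: "box_n n \<in> sets borel"
proof -
  have "box_n n = cbox (\<chi> j. - (pi * sqrt (real n))) (\<chi> j. pi * sqrt (real n))"
    by (auto simp: box_n_def mem_box_cart abs_le_iff minus_le_iff)
  then show ?thesis by simp
qed

lemma hh_nonneg: "hh n \<ge> 0" by (simp add: hh_def)

lemma integrand_measurable [measurable]: "integrand n \<delta> \<in> borel_measurable borel"
proof -
  note [measurable] = exp_series_wv_measurable[OF p_exp hh_nonneg] exp_series_wv_measurable[OF alpha_exp hh_nonneg]
  show ?thesis unfolding integrand_def[abs_def] psi_def rest_def cinner_def by measurable
qed

lemma gauss_measurable [measurable]: "gauss \<in> borel_measurable borel"
  unfolding gauss_def[abs_def] cquad_def by measurable

lemma pole_prod_measurable [measurable]: "pole_prod \<in> borel_measurable borel"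
  unfolding pole_prod_def[abs_def] by measurable

lemma hh_tendsto: "hh \<longlonglongrightarrow> 0"
  unfolding hh_def[abs_def] by real_asymp

text \<open>By the expansion of order \<open>k + 1\<close>, the coefficient is the pointwise limit
  of \<open>integrand / gauss\<close> minus the lower terms, divided by \<open>hh n ^ k\<close>.
  These functions are measurable by induction.\<close>

lemma germ_coeff_measurable [measurable]: "germ_coeff k \<delta> \<in> borel_measurable borel"
proof (induction k rule: less_induct)
  case (less k)
  obtain c where c: "c > 0" "\<And>D r. \<exists>C N. C \<ge> 0 \<and> (\<forall>n \<delta> x. n \<ge> 1 \<longrightarrow> norm \<delta> \<le> D \<longrightarrow>
    norm (integrand n \<delta> x - gauss x * (\<Sum>k<r. germ_coeff k \<delta> x * of_real (hh n ^ k))) \<le> C * hh n ^ r * (W x ^ N * exp (- c * (norm x)\<^sup>2)))"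
    using integrand_expansion by blast
  obtain C N where CN: "\<And>n x. n \<ge> 1 \<Longrightarrow>
    norm (integrand n \<delta> x - gauss x * (\<Sum>k<Suc k. germ_coeff k \<delta> x * of_real (hh n ^ k))) \<le> C * hh n ^ Suc k * (W x ^ N * exp (- c * (norm x)\<^sup>2))"
    using c(2)[of "norm \<delta>" "Suc k"] by blast
  let ?f = "\<lambda>n x. (integrand n \<delta> x / gauss x - (\<Sum>j<k. germ_coeff j \<delta> x * of_real (hh n ^ j))) / of_real (hh n ^ k)"
  show ?case
  proof (rule borel_measurable_LIMSEQ_metric)
    fix n
    have "(\<lambda>x. \<Sum>j<k. germ_coeff j \<delta> x * of_real (hh n ^ j)) \<in> borel_measurable borel"
      using less by (intro borel_measurable_sum borel_measurable_times) auto
    then show "?f n \<in> borel_measurable borel" by measurable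
  next
    fix x
    have g0: "gauss x \<noteq> 0" by (simp add: gauss_def)
    let ?K = "C * (W x ^ N * exp (- c * (norm x)\<^sup>2)) / norm (gauss x)"
    have "(\<lambda>n. ?f n x - germ_coeff k \<delta> x) \<longlonglongrightarrow> 0"
    proof (rule Lim_null_comparison)
      show "(\<lambda>n. ?K * hh n) \<longlonglongrightarrow> 0" by (rule tendsto_mult_right_zero[OF hh_tendsto])
      show "\<forall>\<^sub>F n in sequentially. norm (?f n x - germ_coeff k \<delta> x) \<le> ?K * hh n"
      proof (rule eventually_sequentiallyI[of 1])
        fix n :: nat assume n: "1 \<le> n"
        have h: "hh n > 0" using n by (simp add: hh_def)
        have "?f n x - germ_coeff k \<delta> x = (integrand n \<delta> x - gauss x * (\<Sum>k<Suc k. germ_coeff k \<delta> x * of_real (hh n ^ k))) / (gauss x * of_real (hh n ^ k))"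
          using g0 h by (simp add: field_simps)
        also have "norm \<dots> \<le> C * hh n ^ Suc k * (W x ^ N * exp (- c * (norm x)\<^sup>2)) / (norm (gauss x) * hh n ^ k)"
        proof -
          have "norm (gauss x * of_real (hh n ^ k)) = norm (gauss x) * hh n ^ k"
            using h by (simp add: norm_mult norm_power)
          then show ?thesis
            unfolding norm_divide using h by (simp only:) (intro divide_right_mono CN[OF n] mult_nonneg_nonneg; simp)
        qed
        also have "\<dots> = ?K * hh n" using h by (simp add: field_simps)
        finally show "norm (?f n x - germ_coeff k \<delta> x) \<le> ?K * hh n" .
      qed
    qed
    then show "(\<lambda>n. ?f n x) \<longlonglongrightarrow> germ_coeff k \<delta> x" by (rule LIM_zero_cancel)
  qed
qed

lemma norm_pole_prod: "norm (pole_prod x) \<le> 1"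
  unfolding pole_prod_def prod_norm[symmetric]
proof (rule prod_le_1, safe)
  fix j
  have "norm (wv x j) \<ge> 1" if "\<zeta> j = 1"
    using abs_Re_le_cmod[of "wv x j"] that by (simp add: wv_def crit_ind_def)
  then show "norm (if \<zeta> j = 1 then - (1 / wv x j) else 1) \<le> 1" by (auto simp: norm_divide divide_le_eq)
qed auto

text \<open>The case \<open>n = 1\<close> of the expansion, for two consecutive orders, bounds the single terms.\<close>

lemma expansion_bounds:
  obtains c where "c > 0"
    "\<And>D r. \<exists>C N. C \<ge> 0 \<and> (\<forall>n \<delta> x. n \<ge> 1 \<longrightarrow> norm \<delta> \<le> D \<longrightarrow>
      norm (integrand n \<delta> x - gauss x * (\<Sum>k<r. germ_coeff k \<delta> x * of_real (hh n ^ k))) \<le> C * hh n ^ r * (W x ^ N * exp (- c * (norm x)\<^sup>2)))"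
    "\<And>D k. \<exists>C N. C \<ge> 0 \<and> (\<forall>\<delta> x. norm \<delta> \<le> D \<longrightarrow> norm (gauss x * germ_coeff k \<delta> x) \<le> C * (W x ^ N * exp (- c * (norm x)\<^sup>2)))"
proof -
  obtain c where c: "c > 0" "\<And>D r. \<exists>C N. C \<ge> 0 \<and> (\<forall>n \<delta> x. n \<ge> 1 \<longrightarrow> norm \<delta> \<le> D \<longrightarrow>
    norm (integrand n \<delta> x - gauss x * (\<Sum>k<r. germ_coeff k \<delta> x * of_real (hh n ^ k))) \<le> C * hh n ^ r * (W x ^ N * exp (- c * (norm x)\<^sup>2)))"
    using integrand_expansion by blast
  show ?thesis
  proof (rule that[OF c])
    fix D and k :: nat
    obtain C1 N1 where 1: "C1 \<ge> 0" "\<And>n \<delta> x. n \<ge> 1 \<Longrightarrow> norm \<delta> \<le> D \<Longrightarrow>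
      norm (integrand n \<delta> x - gauss x * (\<Sum>k<k. germ_coeff k \<delta> x * of_real (hh n ^ k))) \<le> C1 * hh n ^ k * (W x ^ N1 * exp (- c * (norm x)\<^sup>2))"
      using c(2)[of D k] by blast
    obtain C2 N2 where 2: "C2 \<ge> 0" "\<And>n \<delta> x. n \<ge> 1 \<Longrightarrow> norm \<delta> \<le> D \<Longrightarrow>
      norm (integrand n \<delta> x - gauss x * (\<Sum>k<Suc k. germ_coeff k \<delta> x * of_real (hh n ^ k))) \<le> C2 * hh n ^ Suc k * (W x ^ N2 * exp (- c * (norm x)\<^sup>2))"
      using c(2)[of D "Suc k"] by blast
    show "\<exists>C N. C \<ge> 0 \<and> (\<forall>\<delta> x. norm \<delta> \<le> D \<longrightarrow> norm (gauss x * germ_coeff k \<delta> x) \<le> C * (W x ^ N * exp (- c * (norm x)\<^sup>2)))"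
    proof (intro exI[of _ "C1 + C2"] exI[of _ "N1 + N2"] conjI allI impI)
      show "C1 + C2 \<ge> 0" using 1(1) 2(1) by simp
      fix \<delta> x :: "real^'d" assume \<delta>: "norm \<delta> \<le> D"
      have h1: "hh 1 = 1" "hh (Suc 0) = 1" by (simp_all add: hh_def)
      let ?S = "\<lambda>r. gauss x * (\<Sum>k<r. germ_coeff k \<delta> x * of_real (hh 1 ^ k))" and ?E = "exp (- c * (norm x)\<^sup>2)"
      have "gauss x * germ_coeff k \<delta> x = (integrand 1 \<delta> x - ?S k) - (integrand 1 \<delta> x - ?S (Suc k))"
        by (simp add: h1 algebra_simps)
      also have "norm \<dots> \<le> C1 * hh 1 ^ k * (W x ^ N1 * ?E) + C2 * hh 1 ^ Suc k * (W x ^ N2 * ?E)"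
        by (rule order_trans[OF norm_triangle_ineq4 add_mono[OF 1(2) 2(2)]]) (use \<delta> in auto)
      also have "\<dots> \<le> C1 * (W x ^ (N1 + N2) * ?E) + C2 * (W x ^ (N1 + N2) * ?E)"
        unfolding h1 using 1(1) 2(1) W_ge_1[of x] by (intro add_mono mult_mono power_increasing) auto
      finally show "norm (gauss x * germ_coeff k \<delta> x) \<le> (C1 + C2) * (W x ^ (N1 + N2) * ?E)" by (simp add: algebra_simps)
    qed
  qed
qed

lemma integrable_dominator: "c > 0 \<Longrightarrow> integrable lborel (\<lambda>x. W x ^ N * exp (- c * (norm x)\<^sup>2))"
  unfolding W_def by (rule integrable_poly_gauss_vec)

lemma exp_coeff_term_integrable: "integrable lborel (\<lambda>x. gauss x * germ_coeff k \<delta> x * pole_prod x)"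
proof -
  obtain c where c0: "c > 0" and "\<And>D r. \<exists>C N. C \<ge> 0 \<and> (\<forall>n \<delta> x. n \<ge> 1 \<longrightarrow> norm \<delta> \<le> D \<longrightarrow>
      norm (integrand n \<delta> x - gauss x * (\<Sum>k<r. germ_coeff k \<delta> x * of_real (hh n ^ k))) \<le> C * hh n ^ r * (W x ^ N * exp (- c * (norm x)\<^sup>2)))"
    and c2: "\<And>D k. \<exists>C N. C \<ge> 0 \<and> (\<forall>\<delta> x. norm \<delta> \<le> D \<longrightarrow> norm (gauss x * germ_coeff k \<delta> x) \<le> C * (W x ^ N * exp (- c * (norm x)\<^sup>2)))"
    using expansion_bounds by blast
  note c = c0 c2
  obtain C N where C: "C \<ge> 0" "\<And>x. norm (gauss x * germ_coeff k \<delta> x) \<le> C * (W x ^ N * exp (- c * (norm x)\<^sup>2))"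
    using c(2)[of "norm \<delta>" k] by blast
  show ?thesis
  proof (rule Bochner_Integration.integrable_bound)
    show "integrable lborel (\<lambda>x. C * (W x ^ N * exp (- c * (norm x)\<^sup>2)))"
      by (intro integrable_mult_right integrable_dominator c(1))
    have "norm (gauss x * germ_coeff k \<delta> x * pole_prod x) \<le> norm (C * (W x ^ N * exp (- c * (norm x)\<^sup>2)))" for x
    proof -
      have "norm (gauss x * germ_coeff k \<delta> x * pole_prod x) \<le> (C * (W x ^ N * exp (- c * (norm x)\<^sup>2))) * 1"
        unfolding norm_mult[of _ "pole_prod x"] using C W_ge_1[of x] by (intro mult_mono norm_pole_prod C(2)) auto
      then show ?thesis by simp
    qed
    then show "AE x in lborel. norm (gauss x * germ_coeff k \<delta> x * pole_prod x) \<le> norm (C * (W x ^ N * exp (- c * (norm x)\<^sup>2)))" by simp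
  qed measurable
qed

lemma exp_coeff_bounded: "\<exists>B. \<forall>\<delta>. norm \<delta> \<le> D \<longrightarrow> norm (exp_coeff k \<delta>) \<le> B"
proof -
  obtain c where c0: "c > 0" and "\<And>D r. \<exists>C N. C \<ge> 0 \<and> (\<forall>n \<delta> x. n \<ge> 1 \<longrightarrow> norm \<delta> \<le> D \<longrightarrow>
      norm (integrand n \<delta> x - gauss x * (\<Sum>k<r. germ_coeff k \<delta> x * of_real (hh n ^ k))) \<le> C * hh n ^ r * (W x ^ N * exp (- c * (norm x)\<^sup>2)))"
    and c2: "\<And>D k. \<exists>C N. C \<ge> 0 \<and> (\<forall>\<delta> x. norm \<delta> \<le> D \<longrightarrow> norm (gauss x * germ_coeff k \<delta> x) \<le> C * (W x ^ N * exp (- c * (norm x)\<^sup>2)))"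
    using expansion_bounds by blast
  note c = c0 c2
  obtain C N where C: "C \<ge> 0" "\<And>\<delta> x. norm \<delta> \<le> D \<Longrightarrow> norm (gauss x * germ_coeff k \<delta> x) \<le> C * (W x ^ N * exp (- c * (norm x)\<^sup>2))"
    using c(2)[of D k] by blast
  show ?thesis
  proof (intro exI allI impI)
    fix \<delta> :: "real^'d" assume \<delta>: "norm \<delta> \<le> D"
    have "norm (\<integral>x. gauss x * germ_coeff k \<delta> x * pole_prod x \<partial>lborel) \<le> (\<integral>x. C * (W x ^ N * exp (- c * (norm x)\<^sup>2)) \<partial>lborel)"
    proof (rule order_trans[OF integral_norm_bound integral_mono])
      show "integrable lborel (\<lambda>x. norm (gauss x * germ_coeff k \<delta> x * pole_prod x))" using exp_coeff_term_integrable by (rule integrable_norm)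
      show "integrable lborel (\<lambda>x. C * (W x ^ N * exp (- c * (norm x)\<^sup>2)))"
        by (intro integrable_mult_right integrable_dominator c(1))
      fix x
      have "norm (gauss x * germ_coeff k \<delta> x * pole_prod x) \<le> (C * (W x ^ N * exp (- c * (norm x)\<^sup>2))) * 1"
        unfolding norm_mult[of _ "pole_prod x"] using C W_ge_1[of x] \<delta> by (intro mult_mono norm_pole_prod C(2)) auto
      then show "norm (gauss x * germ_coeff k \<delta> x * pole_prod x) \<le> C * (W x ^ N * exp (- c * (norm x)\<^sup>2))" by simp
    qed
    then show "norm (exp_coeff k \<delta>) \<le> (1 / (2 * pi) ^ CARD('d)) * (\<integral>x. C * (W x ^ N * exp (- c * (norm x)\<^sup>2)) \<partial>lborel)"
      unfolding exp_coeff_def norm_scaleR by (simp add: divide_right_mono)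
  qed
qed

lemma integral_expansion:
  "\<exists>C. \<forall>n \<delta>. n \<ge> 1 \<longrightarrow> norm \<delta> \<le> D \<longrightarrow>
    norm ((1 / (2 * pi) ^ CARD('d)) *\<^sub>R (\<integral>x. integrand n \<delta> x * pole_prod x \<partial>lborel) - (\<Sum>k<r. exp_coeff k \<delta> * of_real (hh n ^ k))) \<le> C * hh n ^ r"
proof -
  obtain c where c: "c > 0" "\<And>D r. \<exists>C N. C \<ge> 0 \<and> (\<forall>n \<delta> x. n \<ge> 1 \<longrightarrow> norm \<delta> \<le> D \<longrightarrow>
    norm (integrand n \<delta> x - gauss x * (\<Sum>k<r. germ_coeff k \<delta> x * of_real (hh n ^ k))) \<le> C * hh n ^ r * (W x ^ N * exp (- c * (norm x)\<^sup>2)))"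
    using integrand_expansion by blast
  obtain C N where C: "C \<ge> 0" "\<And>n \<delta> x. n \<ge> 1 \<Longrightarrow> norm \<delta> \<le> D \<Longrightarrow>
    norm (integrand n \<delta> x - gauss x * (\<Sum>k<r. germ_coeff k \<delta> x * of_real (hh n ^ k))) \<le> C * hh n ^ r * (W x ^ N * exp (- c * (norm x)\<^sup>2))"
    using c(2)[of D r] by blast
  \<comment> \<open>At order 0 the sum is empty, so this bounds \<open>integrand\<close> itself and
    yields its integrability.\<close>
  obtain C0 N0 where C0: "C0 \<ge> 0" "\<And>n \<delta> x. n \<ge> 1 \<Longrightarrow> norm \<delta> \<le> D \<Longrightarrow>
    norm (integrand n \<delta> x - gauss x * (\<Sum>k<0. germ_coeff k \<delta> x * of_real (hh n ^ k))) \<le> C0 * hh n ^ 0 * (W x ^ N0 * exp (- c * (norm x)\<^sup>2))"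
    using c(2)[of D 0] by blast
  let ?E = "\<lambda>N x. W x ^ N * exp (- c * (norm x)\<^sup>2)"
  have E0: "?E N x \<ge> 0" for N x using W_ge_1[of x] by simp
  show ?thesis
  proof (intro exI allI impI)
    fix n :: nat and \<delta> :: "real^'d" assume n: "n \<ge> 1" and \<delta>: "norm \<delta> \<le> D"
    have "norm (integrand n \<delta> x * pole_prod x) \<le> norm (C0 * ?E N0 x)" for x
    proof -
      have "norm (integrand n \<delta> x * pole_prod x) \<le> (C0 * ?E N0 x) * 1"
        unfolding norm_mult[of _ "pole_prod x"] using C0(2)[OF n \<delta>, of x] C0(1) E0[where x = x] by (intro mult_mono norm_pole_prod) auto
      then show ?thesis by simp
    qed
    then have bd: "AE x in lborel. norm (integrand n \<delta> x * pole_prod x) \<le> norm (C0 * ?E N0 x)" by simp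
    have iG: "integrable lborel (\<lambda>x. integrand n \<delta> x * pole_prod x)"
      by (rule Bochner_Integration.integrable_bound[OF integrable_mult_right[OF integrable_dominator[OF c(1)]] _ bd]) measurable
    let ?s = "\<lambda>x. \<Sum>k<r. (gauss x * germ_coeff k \<delta> x * pole_prod x) * of_real (hh n ^ k)"
    have iS: "integrable lborel ?s"
      by (rule Bochner_Integration.integrable_sum, rule integrable_mult_left, rule exp_coeff_term_integrable)
    have "(\<Sum>k<r. exp_coeff k \<delta> * of_real (hh n ^ k)) = (1 / (2 * pi) ^ CARD('d)) *\<^sub>R (\<integral>x. ?s x \<partial>lborel)"
    proof -
      have "(\<integral>x. ?s x \<partial>lborel) = (\<Sum>k<r. \<integral>x. (gauss x * germ_coeff k \<delta> x * pole_prod x) * of_real (hh n ^ k) \<partial>lborel)"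
        by (rule Bochner_Integration.integral_sum) (rule integrable_mult_left, rule exp_coeff_term_integrable)
      also have "\<dots> = (\<Sum>k<r. (\<integral>x. gauss x * germ_coeff k \<delta> x * pole_prod x \<partial>lborel) * of_real (hh n ^ k))"
        by (simp only: integral_mult_left_zero)
      finally have "(\<integral>x. ?s x \<partial>lborel) = (\<Sum>k<r. (\<integral>x. gauss x * germ_coeff k \<delta> x * pole_prod x \<partial>lborel) * of_real (hh n ^ k))" .
      then show ?thesis by (simp only: exp_coeff_def scaleR_sum_right mult_scaleR_left)
    qed
    then have eq: "(1 / (2 * pi) ^ CARD('d)) *\<^sub>R (\<integral>x. integrand n \<delta> x * pole_prod x \<partial>lborel) - (\<Sum>k<r. exp_coeff k \<delta> * of_real (hh n ^ k))
       = (1 / (2 * pi) ^ CARD('d)) *\<^sub>R (\<integral>x. integrand n \<delta> x * pole_prod x - ?s x \<partial>lborel)"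
      by (simp only: Bochner_Integration.integral_diff[OF iG iS] scaleR_diff_right)
    have "norm (\<integral>x. integrand n \<delta> x * pole_prod x - ?s x \<partial>lborel) \<le> (\<integral>x. C * hh n ^ r * ?E N x \<partial>lborel)"
    proof (rule order_trans[OF integral_norm_bound integral_mono])
      show "integrable lborel (\<lambda>x. norm (integrand n \<delta> x * pole_prod x - ?s x))" by (rule integrable_norm[OF Bochner_Integration.integrable_diff[OF iG iS]])
      show "integrable lborel (\<lambda>x. C * hh n ^ r * ?E N x)"
        by (intro integrable_mult_right integrable_dominator c(1))
      fix x
      have "integrand n \<delta> x * pole_prod x - ?s x = (integrand n \<delta> x - gauss x * (\<Sum>k<r. germ_coeff k \<delta> x * of_real (hh n ^ k))) * pole_prod x"
        by (simp only: left_diff_distrib sum_distrib_left sum_distrib_right) (simp add: mult_ac)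
      also have "norm \<dots> \<le> (C * hh n ^ r * ?E N x) * 1"
        unfolding norm_mult[of _ "pole_prod x"] using C(1) hh_nonneg E0[where x = x] W_ge_1[of x] by (intro mult_mono C(2) n \<delta> norm_pole_prod mult_nonneg_nonneg) auto
      finally show "norm (integrand n \<delta> x * pole_prod x - ?s x) \<le> C * hh n ^ r * ?E N x" by simp
    qed
    also have "\<dots> = (C * (\<integral>x. ?E N x \<partial>lborel)) * hh n ^ r" by simp
    finally show "norm ((1 / (2 * pi) ^ CARD('d)) *\<^sub>R (\<integral>x. integrand n \<delta> x * pole_prod x \<partial>lborel) - (\<Sum>k<r. exp_coeff k \<delta> * of_real (hh n ^ k)))
       \<le> ((1 / (2 * pi) ^ CARD('d)) * (C * (\<integral>x. ?E N x \<partial>lborel))) * hh n ^ r"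
      unfolding eq norm_scaleR by (simp add: divide_right_mono)
  qed
qed

text \<open>The target coefficient times \<open>\<zeta>^\<kappa>\<close> and divided by
  \<open>B(\<zeta>)^n\<close>. The last series has constant coefficients 1 before tilting.\<close>

definition tilted_coeff :: "nat \<Rightarrow> ('d \<Rightarrow> nat) \<Rightarrow> complex" where
  "tilted_coeff n = mconv (mconv \<alpha> (mpow pc n)) (\<lambda>m. \<Prod>j\<in>UNIV. complex_of_real (\<zeta> j) ^ m j)"

text \<open>The powers of \<open>sqrt n\<close> are counted here: Fourier inversion on the stretched
  torus gives one for each coordinate, each pole gives one back, and those of the coordinates with
  \<open>\<zeta> j < 1\<close> remain.\<close>

lemma tilted_coeff_integral:
  assumes n: "n \<ge> 1"
  shows "of_real (sqrt (real n) ^ card {j. \<zeta> j < 1}) * tilted_coeff n \<kappa>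
     = (1 / (2 * pi) ^ CARD('d)) *\<^sub>R (\<integral>x. integrand n (ivec \<kappa> - real n *\<^sub>R lam) x * pole_prod x \<partial>lborel)"
proof -
  let ?R = "sqrt (real n)" and ?\<delta> = "ivec \<kappa> - real n *\<^sub>R lam"
  have R: "?R > 0" using n by simp
  have h: "hh n > 0" "real n * (hh n)\<^sup>2 = 1" using n by (auto simp: hh_def power_divide)
  \<comment> \<open>Shrinking the radius in the critical coordinates brings the torus into the
    domain of convergence of the geometric series.\<close>
  define u where "u j = - crit_ind $ j * hh n" for j
  have w: "(\<lambda>j. Complex (u j) (x $ j / ?R)) = (\<lambda>j. of_real (hh n) * wv x j)" for x
    by (auto simp: u_def wv_def hh_def complex_eq_iff)
  have lt1: "norm (complex_of_real (\<zeta> j) * exp (of_real (hh n) * wv x j)) < 1" for x j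
  proof (cases "\<zeta> j = 1")
    case True
    then show ?thesis using h by (simp add: wv_def crit_ind_def)
  next
    case False
    then have "\<zeta> j < 1" using zeta(2)[of j] by simp
    then show ?thesis using False zeta(1)[of j] by (simp add: norm_mult wv_def crit_ind_def)
  qed
  have re: "Re (of_real (hh n) * wv x j) \<le> \<epsilon>" for x j using h eps by (simp add: wv_def crit_ind_def)
  note aa = exp_summable_exp_abs_summable[OF alpha_exp re] and ap' = exp_summable_exp_abs_summable[OF p_exp re]
  note ag = exp_abs_summable_mgeometric[OF lt1] exp_series_mgeometric[OF lt1]
  have as: "exp_abs_summable (tilted_coeff n) (\<lambda>j. of_real (hh n) * wv x j)" for x
    unfolding tilted_coeff_def by (intro exp_abs_summable_mconv exp_abs_summable_mpow aa ap' ag)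
  have es: "exp_series (tilted_coeff n) (\<lambda>j. of_real (hh n) * wv x j) = exp_series \<alpha> (\<lambda>j. of_real (hh n) * wv x j) * psi x (hh n) ^ n *
     (\<Prod>j\<in>UNIV. 1 / (1 - complex_of_real (\<zeta> j) * exp (of_real (hh n) * wv x j)))" for x
    unfolding tilted_coeff_def psi_def
    by (subst exp_series_mconv; (intro exp_abs_summable_mconv exp_abs_summable_mpow aa ap' ag)?)+ (simp only: exp_series_mpow[OF ap'] ag(2))
  have geo: "1 / (1 - complex_of_real (\<zeta> j) * exp (of_real (hh n) * wv x j)) =
      geo_fac (\<zeta> j) (of_real (hh n) * wv x j) * (if \<zeta> j = 1 then - (1 / wv x j) else 1) * (if \<zeta> j = 1 then of_real ?R else 1)" for x j
  proof (cases "\<zeta> j = 1")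
    case True
    have w0: "wv x j \<noteq> 0" using True by (simp add: wv_def crit_ind_def complex_eq_iff)
    have "norm (exp (of_real (hh n) * wv x j)) < 1" using lt1[of j x] True by simp
    then have e1: "exp (of_real (hh n) * wv x j) \<noteq> 1" by (metis norm_one less_irrefl)
    have hR: "complex_of_real (hh n) * of_real ?R = 1" using R by (simp add: hh_def of_real_mult[symmetric] del: of_real_mult)
    have "(of_real (hh n) * wv x j / (exp (of_real (hh n) * wv x j) - 1)) * (- (1 / wv x j)) * of_real ?R
        = (complex_of_real (hh n) * of_real ?R) * (1 / (1 - exp (of_real (hh n) * wv x j)))"
      using w0 e1 by (simp add: divide_simps) (simp add: algebra_simps)
    then show ?thesis using True h w0 by (simp add: geo_fac_def hR)
  qed (simp add: geo_fac_def)
  have prodR: "(\<Prod>j\<in>UNIV. if \<zeta> j = 1 then complex_of_real ?R else 1) = of_real ?R ^ card {j. \<zeta> j = 1}"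
    by (simp add: prod.If_cases)
  \<comment> \<open>Splits \<open>\<kappa>\<close> into \<open>n \<lambda>\<close>, which is
    absorbed into the n-th power, and the bounded deviation, which goes into
    \<open>rest\<close>.\<close>
  have mk: "mdot \<kappa> (\<lambda>j. of_real (hh n) * wv x j) = of_real (hh n) * cinner ?\<delta> (wv x) + of_nat n * (of_real (hh n) * cinner lam (wv x))" for x
    by (simp add: mdot_scale) (simp add: mdot_def cinner_def ivec_def sum_distrib_left sum.distrib[symmetric] algebra_simps)
  have int: "indicator {x. \<forall>j. \<bar>x $ j\<bar> \<le> pi * ?R} x *\<^sub>R (exp_series (tilted_coeff n) (\<lambda>j. Complex (u j) (x $ j / ?R)) * exp (- mdot \<kappa> (\<lambda>j. Complex (u j) (x $ j / ?R))))
     = of_real ?R ^ card {j. \<zeta> j = 1} * (integrand n ?\<delta> x * pole_prod x)" for x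
    unfolding w es mk geo prod.distrib prodR
    by (simp add: integrand_def rest_def pole_prod_def box_n_def power_mult_distrib exp_of_nat_mult[symmetric] exp_add exp_minus exp_diff field_simps
          flip: pole_prod_def)
  have as0: "exp_abs_summable (tilted_coeff n) (\<lambda>j. of_real (u j))"
    using as[of 0] w[of 0] by (simp add: complex_of_real_def)
  have meas: "(\<lambda>x::real^'d. exp_series (tilted_coeff n) (\<lambda>j. Complex (u j) (x $ j / ?R))) \<in> borel_measurable borel"
  proof -
    note [measurable] = exp_series_wv_measurable[OF p_exp hh_nonneg] exp_series_wv_measurable[OF alpha_exp hh_nonneg]
    show ?thesis unfolding w es psi_def by measurable
  qed
  from fourier_inversion[OF as0 R meas, of \<kappa>]
  have main: "of_real ?R ^ card {j. \<zeta> j = 1} * (\<integral>x. integrand n ?\<delta> x * pole_prod x \<partial>lborel) = complex_of_real ((2 * pi * ?R) ^ CARD('d)) * tilted_coeff n \<kappa>"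
    unfolding int by simp
  have cd: "CARD('d) = card {j. \<zeta> j < 1} + card {j. \<zeta> j = 1}"
  proof -
    have "UNIV = {j. \<zeta> j < 1} \<union> {j. \<zeta> j = 1}" using zeta(2) by (auto simp: less_le)
    then show ?thesis by (metis (mono_tags, lifting) card_Un_disjoint disjoint_iff finite mem_Collect_eq less_irrefl)
  qed
  have "complex_of_real ((2 * pi * ?R) ^ CARD('d)) = of_real ?R ^ card {j. \<zeta> j = 1} * (of_real ((2 * pi) ^ CARD('d)) * of_real (?R ^ card {j. \<zeta> j < 1}))"
    unfolding power_mult_distrib by (subst (2) cd) (simp add: power_add)
  then have "of_real ?R ^ card {j. \<zeta> j = 1} * (\<integral>x. integrand n ?\<delta> x * pole_prod x \<partial>lborel) = of_real ?R ^ card {j. \<zeta> j = 1} *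
      (of_real ((2 * pi) ^ CARD('d)) * (of_real (?R ^ card {j. \<zeta> j < 1}) * tilted_coeff n \<kappa>))"
    using main by (simp only: mult.assoc)
  then have "(\<integral>x. integrand n ?\<delta> x * pole_prod x \<partial>lborel) = of_real ((2 * pi) ^ CARD('d)) * (of_real (?R ^ card {j. \<zeta> j < 1}) * tilted_coeff n \<kappa>)"
    using R n by (simp only: mult_cancel_left power_eq_0_iff of_real_eq_0_iff) auto
  then show ?thesis by (simp add: scaleR_conv_of_real)
qed

text \<open>Without critical coordinates there is no shift, so \<open>wv x\<close> is purely
  imaginary and odd in \<open>x\<close>, and the sign can be moved to \<open>\<eta>\<close>.\<close>

lemma germ_uminus:
  assumes C: "{j. \<zeta> j = 1} = {}" shows "germ \<delta> (- x) \<eta> = germ \<delta> x (- \<eta>)"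
proof -
  have cc0: "crit_ind = 0" using C by (auto simp: crit_ind_def vec_eq_iff)
  have w: "wv (- x) j = - wv x j" for j by (simp add: wv_def cc0 complex_eq_iff)
  have l: "cinner v (wv (- x)) = - cinner v (wv x)" for v by (simp add: cinner_def w sum_negf)
  have q: "cquad (wv (- x)) = cquad (wv x)" by (simp add: cquad_def w)
  show ?thesis unfolding germ_def rest_def psi_def by (simp add: l q w)
qed

lemma germ_coeff_uminus:
  assumes C: "{j. \<zeta> j = 1} = {}" shows "germ_coeff k \<delta> (- x) = (- 1) ^ k * germ_coeff k \<delta> x"
proof -
  obtain e where e: "e > 0" "\<And>\<delta> x. germ \<delta> x holomorphic_on ball 0 (e / W x ^ 3)"
    using germ_local by metis
  have W0: "e / W x ^ 3 > 0" using e(1) W_ge_1[of x] by simp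
  have "germ \<delta> (- x) = (\<lambda>\<eta>. germ \<delta> x (- 1 * \<eta>))" using germ_uminus[OF C] by auto
  moreover have "(deriv ^^ k) (\<lambda>\<eta>. germ \<delta> x (- 1 * \<eta>)) 0 = (- 1) ^ k * (deriv ^^ k) (germ \<delta> x) (- 1 * 0)"
    by (rule higher_deriv_compose_linear[OF e(2), where S = "ball 0 (e / W x ^ 3)"]) (use W0 in auto)
  ultimately show ?thesis by (simp add: germ_coeff_def)
qed

lemma exp_coeff_odd:
  assumes C: "{j. \<zeta> j = 1} = {}" and k: "odd k" shows "exp_coeff k \<delta> = 0"
proof -
  have cc0: "crit_ind = 0" using C by (auto simp: crit_ind_def vec_eq_iff)
  have w: "wv (- x) j = - wv x j" for x j by (simp add: wv_def cc0 complex_eq_iff)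
  have q: "gauss (- x) = gauss x" for x by (simp add: gauss_def cquad_def w)
  have V: "pole_prod x = 1" for x using C by (simp add: pole_prod_def)
  let ?f = "\<lambda>x. gauss x * germ_coeff k \<delta> x * pole_prod x"
  have f: "?f (- x) = - ?f x" for x using k by (simp add: q V germ_coeff_uminus[OF C])
  \<comment> \<open>The reflection of the integration variable is the linear substitution with the
    negative identity matrix.\<close>
  have "det (mat (-1) :: real^'d^'d) \<noteq> 0"
    by (subst det_diagonal) (auto simp: mat_def)
  moreover have "\<bar>det (mat (-1) :: real^'d^'d)\<bar> = 1"
    by (subst det_diagonal) (auto simp: mat_def abs_prod)
  moreover have "mat (-1) *v x = - x" for x :: "real^'d"
    by (simp add: vec_eq_iff matrix_vector_mult_def mat_def if_distrib[of "\<lambda>a. a * _"] cong: if_cong)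
  moreover have "?f \<in> borel_measurable borel" by measurable
  ultimately have "(\<integral>x. ?f x \<partial>lborel) = (\<integral>x. ?f (- x) \<partial>lborel)"
    using integral_matrix_vector[of "mat (-1) :: real^'d^'d" ?f] by simp
  also have "\<dots> = - (\<integral>x. ?f x \<partial>lborel)" unfolding f by simp
  finally have "(\<integral>x. ?f x \<partial>lborel) = 0" by simp
  then show ?thesis by (simp add: exp_coeff_def)
qed


section \<open>The leading coefficient\<close>

abbreviation crit :: "'d set" where "crit \<equiv> {j. \<zeta> j = 1}"

lemma gauss_integrable: "integrable lborel gauss"
proof -
  obtain c where c: "c > 0" "\<exists>C\<ge>0. \<forall>x. norm (gauss x) \<le> C * exp (- c * (norm x)\<^sup>2)"
    using gaussian_bounds by metis
  then obtain C where C: "C \<ge> 0" "\<And>x. norm (gauss x) \<le> C * exp (- c * (norm x)\<^sup>2)" by blast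
  show ?thesis
  proof (rule Bochner_Integration.integrable_bound)
    show "integrable lborel (\<lambda>x. C * (W x ^ 0 * exp (- c * (norm x)\<^sup>2)))"
      by (rule integrable_mult_right[OF integrable_dominator[OF c(1)]])
    show "AE x in lborel. norm (gauss x) \<le> norm (C * (W x ^ 0 * exp (- c * (norm x)\<^sup>2)))"
      using C by simp
  qed measurable
qed

text \<open>The exponents combine to a Gaussian Fourier integral at frequency
  \<open>u - cov *v crit_ind\<close> times a constant. Multiplying out, all terms with
  \<open>crit_ind\<close> cancel: the value does not remember the shift of the contour.\<close>

lemma gauss_shift_integral:
  fixes u :: "real^'d"
  assumes u: "\<And>j. \<zeta> j \<noteq> 1 \<Longrightarrow> u $ j = 0"
  shows "(\<integral>x. gauss x * exp (\<Sum>j\<in>UNIV. wv x j * of_real (u $ j)) \<partial>lborel)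
    = of_real (sqrt ((2 * pi) ^ CARD('d) / det cov) * exp (- (u \<bullet> (matrix_inv cov *v u)) / 2))"
proof -
  let ?M = "matrix_inv cov" and ?v = "u - cov *v crit_ind"
  have d: "det cov \<noteq> 0" using det_positive_definite[OF cov_sym cov_pd] by simp
  have MH: "?M *v (cov *v y) = y" "cov *v (?M *v y) = y" for y
    by (simp_all add: matrix_vector_mul_assoc matrix_inv_det[OF d])
  have sym: "(cov *v y) \<bullet> z = y \<bullet> (cov *v z)" for y z
    by (metis cov_sym dot_lmul_matrix transpose_matrix_vector)
  have G: "(\<integral>x. exp (complex_of_real (- (x \<bullet> (cov *v x)) / 2) + \<i> * complex_of_real (?v \<bullet> x)) \<partial>lborel)
      = complex_of_real (sqrt ((2 * pi) ^ CARD('d) / det cov) * exp (- (?v \<bullet> (?M *v ?v)) / 2))"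
    by (rule integral_gauss_char_vec[OF cov_sym]) (rule cov_pd)
  have v: "?v \<bullet> (?M *v ?v) = u \<bullet> (?M *v u) - 2 * (u \<bullet> crit_ind) + crit_ind \<bullet> (cov *v crit_ind)"
    by (simp add: matrix_vector_mult_diff_distrib MH inner_diff_left inner_diff_right sym inner_commute)
  have "(\<Sum>j\<in>UNIV. wv x j * of_real (u $ j)) = - of_real (u \<bullet> crit_ind) + \<i> * of_real (u \<bullet> x)" for x
    unfolding inner_vec_def of_real_sum sum_distrib_left sum_negf[symmetric] sum.distrib[symmetric]
    by (intro sum.cong refl) (simp add: wv_def complex_eq_iff mult.commute)
  note s = this
  have "gauss x * exp (\<Sum>j\<in>UNIV. wv x j * of_real (u $ j)) =
    exp (of_real ((crit_ind \<bullet> (cov *v crit_ind)) / 2 - u \<bullet> crit_ind)) * exp (of_real (- (x \<bullet> (cov *v x)) / 2) + \<i> * of_real (?v \<bullet> x))" for x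
    unfolding gauss_def cquad_wv s exp_add[symmetric]
    by (simp add: inner_diff_left inner_commute[of x] algebra_simps diff_divide_distrib add_divide_distrib)
  then have "(\<integral>x. gauss x * exp (\<Sum>j\<in>UNIV. wv x j * of_real (u $ j)) \<partial>lborel) =
    exp (of_real ((crit_ind \<bullet> (cov *v crit_ind)) / 2 - u \<bullet> crit_ind)) * of_real (sqrt ((2 * pi) ^ CARD('d) / det cov) * exp (- (?v \<bullet> (?M *v ?v)) / 2))"
    by (simp only: integral_mult_right_zero G)
  also have "\<dots> = of_real (sqrt ((2 * pi) ^ CARD('d) / det cov) * (exp ((crit_ind \<bullet> (cov *v crit_ind)) / 2 - u \<bullet> crit_ind) * exp (- (?v \<bullet> (?M *v ?v)) / 2)))"
    by (simp only: exp_of_real of_real_mult mult_ac)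
  also have "exp ((crit_ind \<bullet> (cov *v crit_ind)) / 2 - u \<bullet> crit_ind) * exp (- (?v \<bullet> (?M *v ?v)) / 2) = exp (- (u \<bullet> (?M *v u)) / 2)"
    unfolding exp_add[symmetric] v by (simp add: field_simps)
  finally show ?thesis .
qed

text \<open>Write \<open>-1/w = \<integral>exp (w u) du\<close> over \<open>u > 0\<close> and exchange the integrals.\<close>

lemma gauss_pole_prod_integral:
  "(\<integral>x. gauss x * pole_prod x \<partial>lborel) = of_real (sqrt ((2 * pi) ^ CARD('d) / det cov) *
     set_lebesgue_integral (Pi\<^sub>M crit (\<lambda>_. lborel)) {u \<in> space (Pi\<^sub>M crit (\<lambda>_. lborel)). \<forall>j\<in>crit. u j > 0}
       (\<lambda>u. exp (- (\<Sum>i\<in>crit. \<Sum>j\<in>crit. u i * matrix_inv cov $ i $ j * u j) / 2)))"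
proof -
  let ?P = "Pi\<^sub>M crit (\<lambda>_. lborel :: real measure)"
  interpret product_sigma_finite "\<lambda>_::'d. lborel :: real measure" ..
  interpret F: finite_product_sigma_finite "\<lambda>_::'d. lborel :: real measure" crit by standard simp
  interpret Q: pair_sigma_finite "lborel :: (real^'d) measure" ?P by standard
  let ?k = "\<lambda>x j u. indicator {0<..} u *\<^sub>R exp (wv x j * of_real u)"
  let ?K = "\<lambda>x u. gauss x * (\<Prod>j\<in>crit. ?k x j (u j))"
  have Re: "Re (wv x j) < 0" if "j \<in> crit" for x j using that by (simp add: wv_def crit_ind_def)
  have pole_prod: "pole_prod x = (\<Prod>j\<in>crit. - (1 / wv x j))" for x
    unfolding pole_prod_def by (simp add: prod.If_cases)
  have a: "gauss x * pole_prod x = (\<integral>u. ?K x u \<partial>?P)" for x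
  proof -
    have "(\<integral>u. (\<Prod>j\<in>crit. ?k x j (u j)) \<partial>?P) = (\<Prod>j\<in>crit. \<integral>u. ?k x j u \<partial>lborel)"
      by (rule product_integral_prod) (auto intro!: integrable_laplace_exp Re)
    also have "\<dots> = pole_prod x" unfolding pole_prod by (intro prod.cong refl integral_laplace_exp Re)
    finally show ?thesis by simp
  qed
  have comp: "(\<lambda>p. snd p j) \<in> borel_measurable (lborel \<Otimes>\<^sub>M ?P)" if "j \<in> crit" for j
  proof -
    have "(\<lambda>u. u j) \<in> borel_measurable ?P"
      using measurable_component_singleton[OF that, of "\<lambda>_. lborel :: real measure"] by simp
    then show ?thesis by (rule measurable_compose[OF measurable_snd])
  qed
  have meas: "(\<lambda>(x, u). ?K x u) \<in> borel_measurable ((lborel :: (real^'d) measure) \<Otimes>\<^sub>M ?P)"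
    unfolding case_prod_unfold
  proof (intro borel_measurable_times borel_measurable_prod)
    show "(\<lambda>p. gauss (fst p)) \<in> borel_measurable ((lborel :: (real^'d) measure) \<Otimes>\<^sub>M ?P)"
      by (rule measurable_compose[OF measurable_fst]) simp
    fix j assume j: "j \<in> crit"
    have [measurable]: "(\<lambda>p. wv (fst p) j) \<in> borel_measurable ((lborel :: (real^'d) measure) \<Otimes>\<^sub>M ?P)"
      by (rule measurable_compose[OF measurable_fst]) simp
    note [measurable] = comp[OF j]
    show "(\<lambda>p. ?k (fst p) j (snd p j)) \<in> borel_measurable ((lborel :: (real^'d) measure) \<Otimes>\<^sub>M ?P)"
      by measurable
  qed
  have int: "integrable (lborel \<Otimes>\<^sub>M ?P) (\<lambda>(x, u). ?K x u)"
  proof (rule Q.Fubini_integrable[OF meas])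
    \<comment> \<open>The real part of \<open>wv x j\<close> is \<open>- 1\<close> on the critical
      coordinates, so the modulus of the kernel does not depend on \<open>x\<close> and Fubini only
      needs integrability of the Gaussian.\<close>
    have "(\<integral>u. norm (?K x u) \<partial>?P) = norm (gauss x) * (\<Prod>j\<in>crit. \<integral>u. indicator {0<..} u *\<^sub>R exp (- u) \<partial>lborel)" for x
    proof -
      have n: "norm (?K x u) = norm (gauss x) * (\<Prod>j\<in>crit. indicator {0<..} (u j) *\<^sub>R exp (- u j))" for u
        unfolding norm_mult prod_norm[symmetric] by (intro arg_cong2[of _ _ _ _ "(*)"] prod.cong refl) (simp add: wv_def crit_ind_def)
      have "integrable lborel (\<lambda>u. norm (indicator {0<..} u *\<^sub>R exp ((-1) * complex_of_real u)))"
        by (rule integrable_norm[OF integrable_laplace_exp]) simp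
      then have "integrable lborel (\<lambda>u::real. indicator {0<..} u *\<^sub>R exp (- u))" by simp
      then have "(\<integral>u. (\<Prod>j\<in>crit. indicator {0<..} (u j) *\<^sub>R exp (- u j)) \<partial>?P) = (\<Prod>j\<in>crit. \<integral>u. indicator {0<..} u *\<^sub>R exp (- u) \<partial>lborel)"
        by (intro product_integral_prod[where f = "\<lambda>_ u. indicator {0<..} u *\<^sub>R exp (- u)"]) auto
      then show ?thesis unfolding n by simp
    qed
    then show "integrable lborel (\<lambda>x. \<integral>u. norm (case (x, u) of (x, u) \<Rightarrow> ?K x u) \<partial>?P)"
      using gauss_integrable by simp
    show "AE x in lborel. integrable ?P (\<lambda>u. case (x, u) of (x, u) \<Rightarrow> ?K x u)"
      unfolding prod.case
      by (intro AE_I2 integrable_mult_right product_integrable_prod integrable_laplace_exp Re) auto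
  qed
  have "(\<integral>x. gauss x * pole_prod x \<partial>lborel) = (\<integral>u. (\<integral>x. ?K x u \<partial>lborel) \<partial>?P)"
    unfolding a by (rule Q.Fubini_integral[OF int, symmetric])
  also have "\<dots> = (\<integral>u. of_real (sqrt ((2 * pi) ^ CARD('d) / det cov) * (indicator {u \<in> space ?P. \<forall>j\<in>crit. u j > 0} u *\<^sub>R
       exp (- (\<Sum>i\<in>crit. \<Sum>j\<in>crit. u i * matrix_inv cov $ i $ j * u j) / 2))) \<partial>?P)"
  proof (rule Bochner_Integration.integral_cong[OF refl])
    fix u assume sp: "u \<in> space ?P"
    \<comment> \<open>Extension by 0 off the critical coordinates: the quadratic form of the full
      inverse at \<open>v\<close> is that of its critical submatrix at \<open>u\<close>.\<close>
    define v :: "real^'d" where "v = (\<chi> j. if \<zeta> j = 1 then u j else 0)"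
    have ind: "(\<Prod>j\<in>crit. indicator {0<..} (u j)) = (indicator {u \<in> space ?P. \<forall>j\<in>crit. u j > 0} u :: real)"
      using sp by (auto simp: indicator_def prod_eq_1_iff)
    have s: "(\<Sum>j\<in>UNIV. wv x j * of_real (v $ j)) = (\<Sum>j\<in>crit. wv x j * of_real (u j))" for x
      by (simp add: v_def if_distrib[of "\<lambda>a. _ * complex_of_real a"] sum.If_cases cong: if_cong)
    have "?K x u = of_real (indicator {u \<in> space ?P. \<forall>j\<in>crit. u j > 0} u) * (gauss x * exp (\<Sum>j\<in>UNIV. wv x j * of_real (v $ j)))" for x
      unfolding ind[symmetric] s by (simp add: scaleR_conv_of_real prod.distrib exp_sum)
    then have "(\<integral>x. ?K x u \<partial>lborel) = of_real (indicator {u \<in> space ?P. \<forall>j\<in>crit. u j > 0} u) *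
      of_real (sqrt ((2 * pi) ^ CARD('d) / det cov) * exp (- (v \<bullet> (matrix_inv cov *v v)) / 2))"
      by (simp only: integral_mult_right_zero) (subst gauss_shift_integral, simp_all add: v_def)
    also have "v \<bullet> (matrix_inv cov *v v) = (\<Sum>i\<in>UNIV. \<Sum>j\<in>UNIV. v $ i * matrix_inv cov $ i $ j * v $ j)"
      by (simp add: inner_vec_def matrix_vector_mult_def sum_distrib_left mult.assoc)
    also have "\<dots> = (\<Sum>i\<in>crit. \<Sum>j\<in>crit. u i * matrix_inv cov $ i $ j * u j)"
      by (rule sum.mono_neutral_cong_right, simp, simp, simp add: v_def, rule sum.mono_neutral_cong_right) (auto simp: v_def)
    finally show "(\<integral>x. ?K x u \<partial>lborel) = of_real (sqrt ((2 * pi) ^ CARD('d) / det cov) * (indicator {u \<in> space ?P. \<forall>j\<in>crit. u j > 0} u *\<^sub>R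
       exp (- (\<Sum>i\<in>crit. \<Sum>j\<in>crit. u i * matrix_inv cov $ i $ j * u j) / 2)))"
      by simp
  qed
  also have "\<dots> = of_real (sqrt ((2 * pi) ^ CARD('d) / det cov) *
     set_lebesgue_integral ?P {u \<in> space ?P. \<forall>j\<in>crit. u j > 0} (\<lambda>u. exp (- (\<Sum>i\<in>crit. \<Sum>j\<in>crit. u i * matrix_inv cov $ i $ j * u j) / 2)))"
    unfolding integral_complex_of_real integral_mult_right_zero set_lebesgue_integral_def ..
  finally show ?thesis .
qed

text \<open>At \<open>\<eta> = 0\<close> only \<open>A\<close> and the noncritical geometric factors
  survive, so the zeroth Taylor coefficient depends neither on \<open>x\<close> nor on
  \<open>\<delta>\<close>. For empty \<open>crit\<close> the product measure lives on one point and
  the integral is 1, the convention for the empty integral.\<close>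

lemma exp_coeff_0:
  "exp_coeff 0 \<delta> = (\<Sum>\<^sub>\<infinity>m. \<alpha> m) / of_real (\<Prod>j\<in>{j. \<zeta> j < 1}. 1 - \<zeta> j) *
     of_real (1 / sqrt ((2 * pi) ^ CARD('d) * det cov)) *
     of_real (set_lebesgue_integral (Pi\<^sub>M crit (\<lambda>_. lborel)) {u \<in> space (Pi\<^sub>M crit (\<lambda>_. lborel)). \<forall>j\<in>crit. u j > 0}
       (\<lambda>u. exp (- (\<Sum>i\<in>crit. \<Sum>j\<in>crit. u i * matrix_inv cov $ i $ j * u j) / 2)))"
proof -
  have dpos: "det cov > 0" by (rule det_positive_definite[OF cov_sym cov_pd])
  have "(\<Prod>j\<in>UNIV. geo_fac (\<zeta> j) 0) = (\<Prod>j\<in>UNIV. if \<zeta> j < 1 then 1 / (1 - of_real (\<zeta> j)) else 1)"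
    using zeta(2) by (intro prod.cong refl) (auto simp: geo_fac_def less_le)
  also have "\<dots> = 1 / of_real (\<Prod>j\<in>{j. \<zeta> j < 1}. 1 - \<zeta> j)"
    by (simp add: prod.If_cases prod_dividef)
  finally have geo: "(\<Prod>j\<in>UNIV. geo_fac (\<zeta> j) 0) = 1 / of_real (\<Prod>j\<in>{j. \<zeta> j < 1}. 1 - \<zeta> j)" .
  have cf0: "germ_coeff 0 \<delta> x = (\<Sum>\<^sub>\<infinity>m. \<alpha> m) / of_real (\<Prod>j\<in>{j. \<zeta> j < 1}. 1 - \<zeta> j)" for x
    unfolding germ_coeff_def by (simp add: germ_def rest_def geo exp_series_def mdot_def)
  have I: "(\<integral>x. gauss x * germ_coeff 0 \<delta> x * pole_prod x \<partial>lborel) = ((\<Sum>\<^sub>\<infinity>m. \<alpha> m) / of_real (\<Prod>j\<in>{j. \<zeta> j < 1}. 1 - \<zeta> j)) * (\<integral>x. gauss x * pole_prod x \<partial>lborel)"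
    unfolding cf0 by (subst integral_mult_right_zero[symmetric]) (simp only: mult_ac)
  have t: "1 / (2 * pi) ^ CARD('d) * sqrt ((2 * pi) ^ CARD('d) / det cov) = 1 / sqrt ((2 * pi) ^ CARD('d) * det cov)"
  proof -
    have "sqrt ((2 * pi) ^ CARD('d)) * sqrt ((2 * pi) ^ CARD('d)) = (2 * pi) ^ CARD('d)" by simp
    moreover have "sqrt ((2 * pi) ^ CARD('d)) > 0" by simp
    ultimately show ?thesis unfolding real_sqrt_divide real_sqrt_mult using dpos by (simp add: divide_simps)
  qed
  show ?thesis
    unfolding exp_coeff_def scaleR_conv_of_real I gauss_pole_prod_integral t[symmetric] of_real_mult by (simp only: mult_ac)
qed

end

section \<open>The distribution attached to \<open>B\<close> at the minimum point\<close>

lemma mono_r_expvec: "mono_r (expvec t) m = exp (ivec m \<bullet> t)"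
  by (simp add: mono_r_def expvec_def inner_vec_def ivec_def exp_sum exp_of_nat_mult)

lemma inner_ivec_le:
  assumes "\<And>j. \<bar>t $ j\<bar> \<le> r" shows "\<bar>ivec m \<bullet> t\<bar> \<le> r * msize m"
proof -
  have "\<bar>ivec m \<bullet> t\<bar> \<le> (\<Sum>j\<in>UNIV. real (m j) * \<bar>t $ j\<bar>)"
    unfolding inner_vec_def ivec_def by (rule order_trans[OF sum_abs]) (simp add: abs_mult)
  also have "\<dots> \<le> (\<Sum>j\<in>UNIV. real (m j) * r)"
    by (intro sum_mono mult_left_mono assms) auto
  finally show ?thesis by (simp add: msize_def sum_distrib_left mult.commute)
qed

lemma open_Psi:
  fixes \<Omega> :: "(complex^'d::finite) set"
  assumes "open \<Omega>" shows "open (Psi \<Omega>)"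
proof -
  note assms
  moreover have "continuous_on UNIV (\<lambda>t :: real^'d. \<chi> j. complex_of_real (exp (t $ j)))"
    by (intro continuous_on_vec_lambda continuous_intros)
  ultimately have "open ((\<lambda>t :: real^'d. \<chi> j. complex_of_real (exp (t $ j))) -` \<Omega>)"
    by (intro open_vimage)
  then show "open (Psi \<Omega>)" by (simp add: Psi_def vimage_def)
qed

lemma Psi_summable:
  assumes "converges_on b \<Omega>" "t \<in> Psi \<Omega>" "\<And>m. b m \<ge> 0"
  shows "(\<lambda>m. b m * exp (ivec m \<bullet> t)) summable_on UNIV"
proof -
  have "mono_c (\<chi> j. complex_of_real (exp (t $ j))) m = of_real (exp (ivec m \<bullet> t))" for m
    unfolding mono_r_expvec[symmetric] by (simp add: mono_c_def mono_r_def expvec_def)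
  then have "norm (complex_of_real (b m) * mono_c (\<chi> j. complex_of_real (exp (t $ j))) m) = b m * exp (ivec m \<bullet> t)" for m
    using assms(3)[of m] by (simp add: norm_mult)
  then show ?thesis using assms(1,2) unfolding converges_on_def Psi_def by force
qed

text \<open>As \<open>Psi \<Omega>\<close> is open, it contains \<open>t\<close> moved slightly in
  the direction with all entries 1; convergence there is exactly the required margin.\<close>

lemma Psi_exp_summable:
  fixes t :: "real^'d::finite"
  assumes "open \<Omega>" "converges_on b \<Omega>" "t \<in> Psi \<Omega>" "\<And>m. b m \<ge> 0"
  obtains e where "e > 0" "exp_summable (\<lambda>m. complex_of_real (b m * exp (ivec m \<bullet> t))) e"
proof -
  obtain d where d: "d > 0" "ball t d \<subseteq> Psi \<Omega>"
    using open_contains_ball open_Psi[OF assms(1)] assms(3) by blast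
  define o1 :: "real^'d" where "o1 = (\<chi> j. 1)"
  have "norm o1 > 0" by (simp add: o1_def vec_eq_iff)
  define e where "e = d / (2 * norm o1)"
  have e: "e > 0" "norm (e *\<^sub>R o1) < d" using d \<open>norm o1 > 0\<close> by (auto simp: e_def)
  then have "t + e *\<^sub>R o1 \<in> Psi \<Omega>" using d(2) by (intro subsetD[OF d(2)]) (simp add: dist_norm)
  from Psi_summable[OF assms(2) this assms(4)]
  have "(\<lambda>m. b m * exp (ivec m \<bullet> (t + e *\<^sub>R o1))) summable_on UNIV" .
  moreover have "ivec m \<bullet> (t + e *\<^sub>R o1) = ivec m \<bullet> t + e * msize m" for m :: "'d \<Rightarrow> nat"
    unfolding inner_add_right inner_scaleR_right by (simp add: inner_vec_def o1_def ivec_def msize_def)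
  ultimately have "exp_summable (\<lambda>m. complex_of_real (b m * exp (ivec m \<bullet> t))) e"
    unfolding exp_summable_def using assms(4) by (simp add: exp_add norm_mult mult.assoc)
  then show ?thesis using that e(1) by blast
qed

lemma exp_summable_analytic:
  fixes t :: "real^'d::finite"
  assumes "\<exists>\<rho>::real^'d. (\<forall>j. \<rho> $ j > expvec t $ j) \<and> (\<lambda>m. norm (a m) * mono_r \<rho> m) summable_on UNIV"
  obtains e where "e > 0" "exp_summable (\<lambda>m. a m * complex_of_real (exp (ivec m \<bullet> t))) e"
proof -
  obtain \<rho> :: "real^'d" where \<rho>: "\<And>j. \<rho> $ j > exp (t $ j)" "(\<lambda>m. norm (a m) * mono_r \<rho> m) summable_on UNIV"
    using assms by (auto simp: expvec_def)
  have \<rho>0: "\<rho> $ j > 0" for j using \<rho>(1)[of j] exp_gt_zero[of "t $ j"] by linarith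
  \<comment> \<open>The smallest gap between the logarithms of the radii \<open>\<rho>\<close> and
    \<open>t\<close>: all coordinates can be raised by it without leaving the region of
    convergence.\<close>
  define e where "e = Min (range (\<lambda>j. ln (\<rho> $ j) - t $ j))"
  have "ln (\<rho> $ j) - t $ j > 0" for j
    using ln_less_cancel_iff[of "exp (t $ j)" "\<rho> $ j"] \<rho>(1)[of j] \<rho>0[of j] by simp
  then have e0: "e > 0" unfolding e_def by (subst Min_gr_iff) auto
  have e: "e \<le> ln (\<rho> $ j) - t $ j" for j unfolding e_def by (rule Min_le) auto
  have le: "exp (ivec m \<bullet> t) * exp (e * msize m) \<le> mono_r \<rho> m" for m
  proof -
    have "ivec m \<bullet> t + e * msize m = (\<Sum>j\<in>UNIV. real (m j) * t $ j + e * real (m j))"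
      unfolding sum.distrib by (simp only: inner_vec_def ivec_def msize_def sum_distrib_left vec_lambda_beta inner_real_def)
    also have "\<dots> = (\<Sum>j\<in>UNIV. real (m j) * (t $ j + e))"
      by (intro sum.cong refl) (simp add: algebra_simps)
    also have "\<dots> \<le> (\<Sum>j\<in>UNIV. real (m j) * ln (\<rho> $ j))"
      using e by (intro sum_mono mult_left_mono) (auto simp: algebra_simps)
    finally have "exp (ivec m \<bullet> t + e * msize m) \<le> exp (\<Sum>j\<in>UNIV. real (m j) * ln (\<rho> $ j))" by simp
    also have "\<dots> = mono_r \<rho> m" using \<rho>0 by (simp add: exp_sum exp_of_nat_mult mono_r_def)
    finally show ?thesis by (simp add: exp_add)
  qed
  have "exp_summable (\<lambda>m. a m * complex_of_real (exp (ivec m \<bullet> t))) e"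
    unfolding exp_summable_def
  proof (rule summable_on_comparison_test[OF \<rho>(2)])
    show "norm (a m * complex_of_real (exp (ivec m \<bullet> t))) * exp (e * msize m) \<le> norm (a m) * mono_r \<rho> m" for m
      using mult_left_mono[OF le[of m], of "norm (a m)"] by (simp add: norm_mult mult.assoc)
  qed auto
  then show ?thesis using that e0 by blast
qed

text \<open>The complex derivative along the coordinate direction \<open>j\<close>, restricted to
  real parameters; real parts give the real series.\<close>

lemma real_series_derivative:
  fixes F :: "('d::finite \<Rightarrow> nat) \<Rightarrow> real"
  assumes F: "exp_summable (\<lambda>m. complex_of_real (F m)) r" and r: "r > 0"
  shows "((\<lambda>s. \<Sum>\<^sub>\<infinity>m. F m * exp (s * real (m j))) has_real_derivative (\<Sum>\<^sub>\<infinity>m. F m * real (m j))) (at 0)"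
proof -
  define w :: "'d \<Rightarrow> complex" where "w i = of_bool (i = j)" for i
  have mw: "mdot m w = of_nat (m j)" for m by (simp add: mdot_def w_def of_bool_def if_distrib cong: if_cong)
  have w1: "norm (w i) \<le> 1" for i by (simp add: w_def)
  let ?D = "exp_series (\<lambda>m. complex_of_real (F m) * mdot m w) (\<lambda>j. 0 * w j)"
  have "((\<lambda>\<eta>. exp_series (\<lambda>m. complex_of_real (F m)) (\<lambda>j. \<eta> * w j)) has_field_derivative ?D) (at (of_real 0))"
    using exp_series_has_field_derivative[OF F w1, of 0] r by simp
  then have vd: "((\<lambda>s. exp_series (\<lambda>m. complex_of_real (F m)) (\<lambda>j. of_real s * w j)) has_vector_derivative ?D) (at 0)"
    by (rule has_vector_derivative_real_field)
  have sm: "\<bar>s\<bar> < r \<Longrightarrow> (\<lambda>m. F m * exp (s * real (m j))) summable_on UNIV" for s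
  proof -
    assume "\<bar>s\<bar> < r"
    then have "exp_abs_summable (\<lambda>m. complex_of_real (F m)) (\<lambda>j. of_real s * w j)"
      by (intro exp_summable_exp_abs_summable[OF F]) (auto simp: w_def)
    then show ?thesis unfolding exp_abs_summable_def mdot_scale mw
      by - (rule abs_summable_summable, simp add: norm_mult abs_mult)
  qed
  have e1: "Re (exp_series (\<lambda>m. complex_of_real (F m)) (\<lambda>j. of_real s * w j)) = (\<Sum>\<^sub>\<infinity>m. F m * exp (s * real (m j)))" if "\<bar>s\<bar> < r" for s
  proof -
    have "complex_of_real (F m) * exp (of_real s * of_nat (m j)) = of_real (F m * exp (s * real (m j)))" for m
      unfolding of_real_mult exp_of_real[symmetric] of_real_of_nat_eq ..
    then have "exp_series (\<lambda>m. complex_of_real (F m)) (\<lambda>j. of_real s * w j) = (\<Sum>\<^sub>\<infinity>m. of_real (F m * exp (s * real (m j))))"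
      by (simp only: exp_series_def mdot_scale mw)
    also have "\<dots> = of_real (\<Sum>\<^sub>\<infinity>m. F m * exp (s * real (m j)))"
      by (rule infsumI, rule has_sum_of_real, rule has_sum_infsum, rule sm, rule that)
    finally show ?thesis by simp
  qed
  have "exp_summable (\<lambda>m. complex_of_real (F m) * mdot m w) 0" by (rule exp_summable_mdot[OF F r])
  then have "(\<lambda>m. norm (F m * real (m j))) summable_on UNIV" by (simp add: exp_summable_def mw norm_mult abs_mult)
  then have "((\<lambda>m. complex_of_real (F m * real (m j))) has_sum of_real (\<Sum>\<^sub>\<infinity>m. F m * real (m j))) UNIV"
    by - (rule has_sum_of_real, rule has_sum_infsum, rule abs_summable_summable)
  then have e2: "Re ?D = (\<Sum>\<^sub>\<infinity>m. F m * real (m j))"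
    unfolding exp_series_def mw by (simp add: mdot_def infsumI)
  have D: "((\<lambda>s. Re (exp_series (\<lambda>m. complex_of_real (F m)) (\<lambda>j. of_real s * w j))) has_real_derivative Re ?D) (at 0)"
    unfolding has_real_derivative_iff_has_vector_derivative
    using bounded_linear.has_vector_derivative[OF bounded_linear_Re vd] .
  have "eventually (\<lambda>s. \<bar>s\<bar> < r) (nhds (0::real))"
    using r eventually_nhds_in_open[of "{-r<..<r}" 0] by (auto elim!: eventually_mono)
  then have ev: "eventually (\<lambda>s. Re (exp_series (\<lambda>m. complex_of_real (F m)) (\<lambda>j. of_real s * w j)) = (\<Sum>\<^sub>\<infinity>m. F m * exp (s * real (m j)))) (nhds 0)"
    by eventually_elim (rule e1)
  show ?thesis using D unfolding e2 DERIV_cong_ev[OF refl ev refl] .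
qed

text \<open>Gradient and Hessian of a logarithm of a sum of exponentials are the mean and the
  covariance under the normalised weights \<open>f\<close>.\<close>

lemma
  fixes b :: "('d::finite \<Rightarrow> nat) \<Rightarrow> real" and tau :: "real^'d" and e :: real
  defines "f \<equiv> \<lambda>m. b m * exp (ivec m \<bullet> tau)"
  assumes b: "\<And>m. b m \<ge> 0" and supp: "support b \<noteq> {}" and e: "e > 0" and f: "exp_summable (\<lambda>m. complex_of_real (f m)) e"
  shows Kfun_derivative: "((\<lambda>s. Kfun b (tau + s *\<^sub>R axis j 1)) has_real_derivative (\<Sum>\<^sub>\<infinity>m. f m * real (m j)) / (\<Sum>\<^sub>\<infinity>m. f m)) (at 0)"
    and hessian_Kfun: "hessian (Kfun b) tau $ i $ j = (\<Sum>\<^sub>\<infinity>m. f m * (real (m i) * real (m j))) / (\<Sum>\<^sub>\<infinity>m. f m)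
       - (\<Sum>\<^sub>\<infinity>m. f m * real (m i)) / (\<Sum>\<^sub>\<infinity>m. f m) * ((\<Sum>\<^sub>\<infinity>m. f m * real (m j)) / (\<Sum>\<^sub>\<infinity>m. f m))"
proof -
  define G where "G t = (\<Sum>\<^sub>\<infinity>m. f m * exp (ivec m \<bullet> t))" for t :: "real^'d"
  define G1 where "G1 i t = (\<Sum>\<^sub>\<infinity>m. f m * real (m i) * exp (ivec m \<bullet> t))" for i and t :: "real^'d"
  have K: "Kfun b (tau + t) = ln (G t)" for t
    by (simp add: Kfun_def Bval_def mono_r_expvec G_def f_def inner_add_right exp_add mult_ac)
  \<comment> \<open>A second partial derivative needs the first one on a neighbourhood, so half of
    the margin is spent on moving the base point.\<close>
  have es: "exp_summable (\<lambda>m. complex_of_real (f m * exp (ivec m \<bullet> t))) (e / 2)" if t: "\<And>j. \<bar>t $ j\<bar> \<le> e / 2" for t :: "real^'d"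
    unfolding exp_summable_def
  proof (rule summable_on_comparison_test[OF f[unfolded exp_summable_def]])
    fix m :: "'d \<Rightarrow> nat"
    have "ivec m \<bullet> t \<le> e / 2 * msize m" using inner_ivec_le[of t "e/2" m] t by auto
    then have "exp (ivec m \<bullet> t + e / 2 * msize m) \<le> exp (e * msize m)" by (subst exp_le_cancel_iff) linarith
    then have "\<bar>f m\<bar> * (exp (ivec m \<bullet> t) * exp (e / 2 * msize m)) \<le> \<bar>f m\<bar> * exp (e * msize m)"
      unfolding exp_add[symmetric] by (intro mult_left_mono) auto
    then show "norm (complex_of_real (f m * exp (ivec m \<bullet> t))) * exp (e / 2 * msize m) \<le> norm (complex_of_real (f m)) * exp (e * msize m)"
      by (simp add: norm_mult abs_mult mult.assoc)
  qed auto
  have line: "exp (ivec m \<bullet> (t + s *\<^sub>R axis j 1)) = exp (ivec m \<bullet> t) * exp (s * real (m j))" for m :: "'d \<Rightarrow> nat" and t s j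
    by (simp add: inner_add_right inner_axis ivec_def exp_add)
  have dG: "((\<lambda>s. G (t + s *\<^sub>R axis j 1)) has_real_derivative G1 j t) (at 0)" if t: "\<And>j. \<bar>t $ j\<bar> \<le> e / 2" for t j
    using real_series_derivative[OF es[OF t], of j] e unfolding G_def G1_def line by (simp add: mult_ac)
  have dG1: "((\<lambda>s. G1 j (0 + s *\<^sub>R axis i 1)) has_real_derivative (\<Sum>\<^sub>\<infinity>m. f m * (real (m i) * real (m j)))) (at 0)" for i j
  proof -
    have "exp_summable (\<lambda>m. complex_of_real (f m) * of_real (real (m j))) (e / 2)"
    proof (rule exp_summable_mult[OF f])
      show "norm (complex_of_real (real (m j))) \<le> 1 * msize m" for m
        unfolding msize_def by simp (rule member_le_sum, auto)
    qed (use e in auto)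
    then have "exp_summable (\<lambda>m. complex_of_real (f m * real (m j))) (e / 2)" by simp
    from real_series_derivative[OF this, of i] e show ?thesis
      unfolding G1_def line by (simp add: mult_ac)
  qed
  have Gpos: "G t > 0" if t: "\<And>j. \<bar>t $ j\<bar> \<le> e / 2" for t
  proof -
    have s: "(\<lambda>m. f m * exp (ivec m \<bullet> t)) summable_on UNIV"
    proof (rule abs_summable_summable)
      show "(\<lambda>m. norm (f m * exp (ivec m \<bullet> t))) summable_on UNIV"
        using exp_summable_mono[OF es[OF t], of 0] e by (simp add: exp_summable_def norm_mult abs_mult)
    qed
    obtain m0 where m0: "b m0 \<noteq> 0" using supp by (auto simp: support_def)
    have "0 < f m0 * exp (ivec m0 \<bullet> t)" using b[of m0] m0 by (simp add: f_def)
    also have "\<dots> = sum (\<lambda>m. f m * exp (ivec m \<bullet> t)) {m0}" by simp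
    also have "\<dots> \<le> G t" unfolding G_def
      by (rule finite_sum_le_infsum[OF s]) (auto simp: f_def b)
    finally show ?thesis .
  qed
  have G0: "G 0 = (\<Sum>\<^sub>\<infinity>m. f m)" "G1 k 0 = (\<Sum>\<^sub>\<infinity>m. f m * real (m k))" for k by (simp_all add: G_def G1_def)
  have dK: "((\<lambda>s. Kfun b (tau + t + s *\<^sub>R axis j 1)) has_real_derivative G1 j t / G t) (at 0)" if t: "\<And>j. \<bar>t $ j\<bar> \<le> e / 2" for t j
    unfolding add.assoc K using dG[OF t, of j] Gpos[OF t] by (auto intro!: derivative_eq_intros)
  show "((\<lambda>s. Kfun b (tau + s *\<^sub>R axis j 1)) has_real_derivative (\<Sum>\<^sub>\<infinity>m. f m * real (m j)) / (\<Sum>\<^sub>\<infinity>m. f m)) (at 0)"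
    using dK[of 0 j] e unfolding G0 by simp
  have pK: "partial (Kfun b) j (tau + t) = G1 j t / G t" if t: "\<And>j. \<bar>t $ j\<bar> \<le> e / 2" for t
    unfolding partial_def by (rule DERIV_imp_deriv[OF dK[OF t]])
  have small: "\<bar>(s *\<^sub>R axis i 1 :: real^'d) $ k\<bar> \<le> e / 2" if "\<bar>s\<bar> < e / 2" for s k
    using that e by (auto simp: axis_def)
  have D: "((\<lambda>s. G1 j (0 + s *\<^sub>R axis i 1) / G (0 + s *\<^sub>R axis i 1)) has_real_derivative
      ((\<Sum>\<^sub>\<infinity>m. f m * (real (m i) * real (m j))) * G 0 - G1 j 0 * G1 i 0) / (G 0 * G 0)) (at 0)"
    using DERIV_divide[OF dG1[of j i] dG[of 0 i]] Gpos[of 0] e by simp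
  have "eventually (\<lambda>s. \<bar>s\<bar> < e / 2) (nhds (0::real))"
    using e eventually_nhds_in_open[of "{-(e/2)<..<e/2}" 0] by (auto elim!: eventually_mono)
  then have ev: "eventually (\<lambda>s. G1 j (0 + s *\<^sub>R axis i 1) / G (0 + s *\<^sub>R axis i 1) = partial (Kfun b) j (tau + s *\<^sub>R axis i 1)) (nhds 0)"
  proof eventually_elim
    case (elim s)
    show ?case using pK[OF small[OF elim]] by simp
  qed
  have "((\<lambda>s. partial (Kfun b) j (tau + s *\<^sub>R axis i 1)) has_real_derivative
      ((\<Sum>\<^sub>\<infinity>m. f m * (real (m i) * real (m j))) * G 0 - G1 j 0 * G1 i 0) / (G 0 * G 0)) (at 0)"
    using D unfolding DERIV_cong_ev[OF refl ev refl] .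
  then have "hessian (Kfun b) tau $ i $ j = ((\<Sum>\<^sub>\<infinity>m. f m * (real (m i) * real (m j))) * G 0 - G1 j 0 * G1 i 0) / (G 0 * G 0)"
    by (simp add: hessian_def partial_def[of _ i] DERIV_imp_deriv)
  then show "hessian (Kfun b) tau $ i $ j = (\<Sum>\<^sub>\<infinity>m. f m * (real (m i) * real (m j))) / (\<Sum>\<^sub>\<infinity>m. f m)
       - (\<Sum>\<^sub>\<infinity>m. f m * real (m i)) / (\<Sum>\<^sub>\<infinity>m. f m) * ((\<Sum>\<^sub>\<infinity>m. f m * real (m j)) / (\<Sum>\<^sub>\<infinity>m. f m))"
    using Gpos[of 0] e unfolding G0 by (simp add: field_simps)
qed

lemma mconv_scale_right: "mconv f (\<lambda>m. c * g m) m = c * mconv f g m"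
  by (simp add: mconv_def sum_distrib_left mult_ac)

lemma mconv_scale_left: "mconv (\<lambda>m. c * f m) g m = c * mconv f g m"
  by (simp add: mconv_def sum_distrib_left mult_ac)

lemma mpow_scale: "mpow (\<lambda>m. c * f m) n = (\<lambda>m. c ^ n * mpow f n m)"
proof (induction n)
  case (Suc n)
  show ?case unfolding mpow.simps Suc
    by (rule ext) (simp add: mconv_scale_left mconv_scale_right mult.assoc)
qed simp

lemma full_rank_support: "full_rank b \<Longrightarrow> support b \<noteq> {}"
  by (auto simp: full_rank_def)

theorem theorem15:
  fixes b :: "('d::finite \<Rightarrow> nat) \<Rightarrow> real"
    and a :: "('d \<Rightarrow> nat) \<Rightarrow> complex"
    and \<Omega> :: "(complex^'d) set"
    and lam tau :: "real^'d"
    and kappa :: "nat \<Rightarrow> ('d \<Rightarrow> nat)"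
  assumes b_nonneg: "\<And>m. b m \<ge> 0"
    and b_full_rank: "full_rank b"
    and b_aperiodic: "aperiodic b"
    and \<Omega>_open: "open \<Omega>" and \<Omega>_zero: "0 \<in> \<Omega>"
    and b_conv: "converges_on b \<Omega>"
    and lam_pos: "\<And>j. lam $ j > 0"
    and not_boundary: "\<not> tends_to_inf_on_boundary (\<lambda>t. Kfun b t - lam \<bullet> t) (Psi \<Omega>)"
    and tau_in: "tau \<in> Psi \<Omega>"
    and tau_unique_min: "\<And>t. t \<in> Psi \<Omega> \<Longrightarrow> t \<noteq> tau \<Longrightarrow>
                             Kfun b tau - lam \<bullet> tau < Kfun b t - lam \<bullet> t"
    and zeta_le1: "\<And>j. expvec tau $ j \<le> 1"
    and A_analytic: "\<exists>\<rho>::real^'d. (\<forall>j. \<rho> $ j > expvec tau $ j) \<and>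
                       (\<lambda>m. norm (a m) * mono_r \<rho> m) summable_on UNIV"
    and A_nonzero: "Aval a (expvec tau) \<noteq> 0"
    and kappa_bounded: "bounded (range (\<lambda>n. ivec (kappa n) - real n *\<^sub>R lam))"
  shows "\<forall>r::nat. r \<ge> 1 \<longrightarrow>
    (\<exists>F :: nat \<Rightarrow> real^'d \<Rightarrow> complex.
      (\<forall>k<r. bounded (range (\<lambda>n. F k (ivec (kappa n) - real n *\<^sub>R lam)))) \<and>
      (\<lambda>n. norm (target_coeff a b n (kappa n) * complex_of_real (mono_r (expvec tau) (kappa n))
                  / complex_of_real (Bval b (expvec tau) ^ n)
                  * complex_of_real (real n powr (real (card {j. expvec tau $ j < 1}) / 2))
              - (\<Sum>k<r. F k (ivec (kappa n) - real n *\<^sub>R lam)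
                          * complex_of_real (real n powr (- real k / 2)))))
        \<in> O(\<lambda>n. real n powr (- real r / 2)) \<and>
      (\<forall>n. F 0 (ivec (kappa n) - real n *\<^sub>R lam) =
         Aval a (expvec tau) / complex_of_real (\<Prod>j\<in>{j. expvec tau $ j < 1}. 1 - expvec tau $ j)
         * complex_of_real (1 / sqrt ((2 * pi) ^ CARD('d) * det (hessian (Kfun b) tau)))
         * complex_of_real
             (set_lebesgue_integral (PiM {j. expvec tau $ j = 1} (\<lambda>_. lborel))
                {u \<in> space (PiM {j. expvec tau $ j = 1} (\<lambda>_. lborel)).
                   \<forall>j\<in>{j. expvec tau $ j = 1}. u j > 0}
                (\<lambda>u. exp (- (\<Sum>i\<in>{j. expvec tau $ j = 1}. \<Sum>j\<in>{j. expvec tau $ j = 1}.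
                         u i * matrix_inv (hessian (Kfun b) tau) $ i $ j * u j) / 2)))) \<and>
      ({j. expvec tau $ j = 1} = {} \<longrightarrow>
         (\<forall>k<r. odd k \<longrightarrow> (\<forall>n. F k (ivec (kappa n) - real n *\<^sub>R lam) = 0))))"
proof -
  define e where "e m = exp (ivec m \<bullet> tau)" for m :: "'d \<Rightarrow> nat"
  define f where "f m = b m * e m" for m
  define B0 where "B0 = Bval b (expvec tau)"
  define p where "p m = f m / B0" for m
  define \<alpha> where "\<alpha> m = a m * complex_of_real (e m)" for m
  define \<zeta> where "\<zeta> j = expvec tau $ j" for j
  have supp: "support b \<noteq> {}" by (rule full_rank_support[OF b_full_rank])
  obtain e1 where e1: "e1 > 0" "exp_summable (\<lambda>m. complex_of_real (f m)) e1"
    using Psi_exp_summable[OF \<Omega>_open b_conv tau_in b_nonneg] unfolding f_def e_def by blast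
  obtain e2 where e2: "e2 > 0" "exp_summable \<alpha> e2"
    using exp_summable_analytic[OF A_analytic] unfolding \<alpha>_def e_def by blast
  have f0: "f m \<ge> 0" for m using b_nonneg by (simp add: f_def e_def)
  have B0f: "B0 = (\<Sum>\<^sub>\<infinity>m. f m)" by (simp add: B0_def Bval_def mono_r_expvec f_def e_def)
  have fs: "f summable_on UNIV"
    by (rule abs_summable_summable) (use exp_summable_mono[OF e1(2), of 0] e1(1) in \<open>simp add: exp_summable_def\<close>)
  have B0: "B0 > 0"
  proof -
    obtain m0 where "b m0 \<noteq> 0" using supp by (auto simp: support_def)
    then have "0 < f m0" using b_nonneg[of m0] by (simp add: f_def e_def)
    also have "\<dots> = sum f {m0}" by simp
    also have "\<dots> \<le> B0" unfolding B0f by (rule finite_sum_le_infsum[OF fs]) (auto simp: f0)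
    finally show ?thesis .
  qed
  note Kd = Kfun_derivative[OF b_nonneg supp e1(1) e1(2)[unfolded f_def e_def], folded e_def, folded f_def, folded B0f]
  note Hs = hessian_Kfun[OF b_nonneg supp e1(1) e1(2)[unfolded f_def e_def], folded e_def, folded f_def, folded B0f]
  have pinf: "(\<Sum>\<^sub>\<infinity>m. p m * g m) = (\<Sum>\<^sub>\<infinity>m. f m * g m) / B0" for g
  proof -
    have "(\<Sum>\<^sub>\<infinity>m. p m * g m) = (\<Sum>\<^sub>\<infinity>m. (f m * g m) * inverse B0)"
      by (simp add: p_def divide_inverse mult_ac)
    also have "\<dots> = (\<Sum>\<^sub>\<infinity>m. f m * g m) * inverse B0" by (rule infsum_cmult_left')
    finally show ?thesis by (simp add: divide_inverse)
  qed
  \<comment> \<open>First-order condition: along each axis the minimum at \<open>tau\<close> is a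
    local one, because \<open>Psi \<Omega>\<close> is open, so the derivative of \<open>K\<close>
    there is \<open>lam $ j\<close>.\<close>
  have lamp: "lam $ j = (\<Sum>\<^sub>\<infinity>m. p m * real (m j))" for j
  proof -
    let ?g = "\<lambda>s. Kfun b (tau + s *\<^sub>R axis j 1) - lam \<bullet> (tau + s *\<^sub>R axis j 1)"
    have lin: "lam \<bullet> (tau + s *\<^sub>R axis j 1) = lam \<bullet> tau + s * lam $ j" for s
      by (simp add: inner_add_right inner_axis)
    have D: "(?g has_real_derivative (\<Sum>\<^sub>\<infinity>m. f m * real (m j)) / B0 - lam $ j) (at 0)"
      unfolding lin by (auto intro!: derivative_eq_intros Kd)
    obtain d where d: "d > 0" "ball tau d \<subseteq> Psi \<Omega>"
      using open_contains_ball open_Psi[OF \<Omega>_open] tau_in by blast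
    have "\<forall>y. \<bar>0 - y\<bar> < d \<longrightarrow> ?g 0 \<le> ?g y"
    proof (intro allI impI)
      fix y :: real assume "\<bar>0 - y\<bar> < d"
      then have "tau + y *\<^sub>R axis j 1 \<in> Psi \<Omega>" by (intro subsetD[OF d(2)]) (simp add: dist_norm norm_axis_1)
      then show "?g 0 \<le> ?g y"
        using tau_unique_min[of "tau + y *\<^sub>R axis j 1"] by (cases "tau + y *\<^sub>R axis j 1 = tau") auto
    qed
    from DERIV_local_min[OF D d(1) this] show ?thesis by (simp add: pinf)
  qed
  \<comment> \<open>Tilting multiplies coefficients by positive numbers, so full rank and
    aperiodicity pass to \<open>p\<close>.\<close>
  have suppp: "support p = support b" using B0 by (auto simp: support_def p_def f_def e_def)
  interpret S: saddle p \<alpha> \<zeta> "min e1 e2" lam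
  proof
    show "p m \<ge> 0" for m using f0 B0 by (simp add: p_def)
    have "((\<lambda>m. f m * inverse B0) has_sum B0 * inverse B0) UNIV"
      unfolding B0f by (intro has_sum_cmult_left has_sum_infsum fs)
    then show "(p has_sum 1) UNIV" using B0 by (simp add: p_def[abs_def] divide_inverse)
    show "min e1 e2 > 0" using e1 e2 by simp
    show "exp_summable (\<lambda>m. complex_of_real (p m)) (min e1 e2)"
    proof -
      have "exp_summable (\<lambda>m. complex_of_real (f m)) (min e1 e2)" by (rule exp_summable_mono[OF e1(2)]) simp
      then have "(\<lambda>m. norm (complex_of_real (f m)) * exp (min e1 e2 * msize m) * inverse B0) summable_on UNIV"
        unfolding exp_summable_def by (rule summable_on_cmult_left)
      moreover have "norm (complex_of_real (f m)) * exp (min e1 e2 * msize m) * inverse B0 = norm (complex_of_real (p m)) * exp (min e1 e2 * msize m)" for m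
        using B0 by (simp only: norm_of_real p_def abs_divide) (simp add: divide_inverse)
      ultimately show ?thesis unfolding exp_summable_def by (simp only:)
    qed
    show "exp_summable \<alpha> (min e1 e2)" by (rule exp_summable_mono[OF e2(2)]) simp
    show "0 < \<zeta> j" "\<zeta> j \<le> 1" for j using zeta_le1[of j] by (simp_all add: \<zeta>_def expvec_def)
    show "lam $ j = (\<Sum>\<^sub>\<infinity>m. p m * real (m j))" for j by (rule lamp)
    show "full_rank p" "aperiodic p"
      using b_full_rank b_aperiodic unfolding full_rank_def aperiodic_def suppp by simp_all
  qed
  have H: "hessian (Kfun b) tau = S.cov"
    by (simp add: vec_eq_iff Hs S.cov_def S.expect_def pinf lamp)
  have e_zeta: "complex_of_real (e m) = (\<Prod>j\<in>UNIV. complex_of_real (\<zeta> j) ^ m j)" for m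
    by (simp add: e_def \<zeta>_def mono_r_expvec[symmetric] mono_r_def)
  have e_add: "complex_of_real (e (\<lambda>j. q j + q' j)) = complex_of_real (e q) * complex_of_real (e q')" for q q'
    by (simp add: e_zeta power_add prod.distrib)
  have e_0: "complex_of_real (e (\<lambda>_. 0)) = 1" by (simp add: e_zeta)
  \<comment> \<open>The monomial at the saddle point is multiplicative in the multi-index, so it can
    be distributed over all factors of the convolution; normalising \<open>B\<close> then takes out
    \<open>B0 ^ n\<close>.\<close>
  have tilted_coeff: "target_coeff a b n k * complex_of_real (mono_r (expvec tau) k) / complex_of_real (B0 ^ n) = S.tilted_coeff n k" for n k
  proof -
    have "target_coeff a b n k * complex_of_real (e k) =
      mconv (mconv \<alpha> (mpow (\<lambda>m. complex_of_real B0 * complex_of_real (p m)) n)) (\<lambda>m. \<Prod>j\<in>UNIV. complex_of_real (\<zeta> j) ^ m j) k"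
    proof -
      have "complex_of_real (b m) * complex_of_real (e m) = complex_of_real B0 * complex_of_real (p m)" for m
        using B0 by (simp add: p_def f_def)
      then have 1: "mpow (\<lambda>m. complex_of_real (b m)) n m * complex_of_real (e m) = mpow (\<lambda>m. complex_of_real B0 * complex_of_real (p m)) n m" for m
        using mpow_twist[of "\<lambda>m. complex_of_real (e m)", OF e_add e_0] by simp
      show ?thesis
        unfolding target_coeff_def mconv_twist[of "\<lambda>m. complex_of_real (e m)", OF e_add] 1 \<alpha>_def[symmetric] mult_1
        unfolding e_zeta ..
    qed
    also have "\<dots> = complex_of_real B0 ^ n * S.tilted_coeff n k"
    proof -
      have "mconv \<alpha> (\<lambda>m. complex_of_real B0 ^ n * mpow (\<lambda>m. complex_of_real (p m)) n m) =
        (\<lambda>m. complex_of_real B0 ^ n * mconv \<alpha> (mpow (\<lambda>m. complex_of_real (p m)) n) m)"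
        by (intro ext mconv_scale_right)
      then show ?thesis unfolding S.tilted_coeff_def mpow_scale by (simp only: mconv_scale_left)
    qed
    finally show ?thesis using B0 by (simp add: mono_r_expvec e_def)
  qed
  \<comment> \<open>All bounds are uniform for \<open>norm \<delta> \<le> D\<close>, which covers
    every \<open>n\<close>.\<close>
  obtain D where D: "\<And>n. norm (ivec (kappa n) - real n *\<^sub>R lam) \<le> D"
    using kappa_bounded unfolding bounded_iff by auto
  let ?\<delta> = "\<lambda>n. ivec (kappa n) - real n *\<^sub>R lam"
  show ?thesis
  \<comment> \<open>The same coefficient functions serve every order \<open>r\<close>.\<close>
  proof (intro allI impI exI[of _ S.exp_coeff] conjI)
    fix r k :: nat
    show "bounded (range (\<lambda>n. S.exp_coeff k (?\<delta> n)))"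
      using S.exp_coeff_bounded[of D k] D unfolding bounded_iff by blast
  next
    fix r :: nat
    obtain C where C: "\<And>n \<delta>. n \<ge> 1 \<Longrightarrow> norm \<delta> \<le> D \<Longrightarrow>
      norm ((1 / (2 * pi) ^ CARD('d)) *\<^sub>R (\<integral>x. S.integrand n \<delta> x * S.pole_prod x \<partial>lborel) - (\<Sum>k<r. S.exp_coeff k \<delta> * of_real (S.hh n ^ k))) \<le> C * S.hh n ^ r"
      using S.integral_expansion[of D r] by blast
    have hh: "S.hh n ^ k = real n powr (- real k / 2)" if "n \<ge> 1" for n k
    proof -
      have "S.hh n = real n powr (- 1 / 2)"
        using that by (simp add: S.hh_def powr_minus powr_half_sqrt inverse_eq_divide)
      then show ?thesis using that by (simp add: powr_realpow[symmetric] powr_powr)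
    qed
    have sq: "real n powr (real c / 2) = sqrt (real n) ^ c" if "n \<ge> 1" for n c :: nat
      using that by (simp add: powr_half_sqrt[symmetric] powr_realpow[symmetric] powr_powr)
    show "(\<lambda>n. norm (target_coeff a b n (kappa n) * complex_of_real (mono_r (expvec tau) (kappa n))
                  / complex_of_real (Bval b (expvec tau) ^ n)
                  * complex_of_real (real n powr (real (card {j. expvec tau $ j < 1}) / 2))
              - (\<Sum>k<r. S.exp_coeff k (?\<delta> n) * complex_of_real (real n powr (- real k / 2)))))
        \<in> O(\<lambda>n. real n powr (- real r / 2))"
    \<comment> \<open>The estimate holds from \<open>n = 1\<close> on; \<open>hh 0\<close> has no
      meaning as a scale.\<close>
    proof (rule bigoI[of _ C], rule eventually_sequentiallyI[of 1])
      fix n :: nat assume n: "1 \<le> n"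
      have main: "S.tilted_coeff n (kappa n) * complex_of_real (real n powr (real (card {j. expvec tau $ j < 1}) / 2))
        = (1 / (2 * pi) ^ CARD('d)) *\<^sub>R (\<integral>x. S.integrand n (?\<delta> n) x * S.pole_prod x \<partial>lborel)"
        using S.tilted_coeff_integral[OF n, of "kappa n"] unfolding sq[OF n] \<zeta>_def by (simp add: mult.commute)
      have "norm (S.tilted_coeff n (kappa n) * complex_of_real (real n powr (real (card {j. expvec tau $ j < 1}) / 2))
              - (\<Sum>k<r. S.exp_coeff k (?\<delta> n) * complex_of_real (real n powr (- real k / 2)))) \<le> C * real n powr (- real r / 2)"
        unfolding main using C[OF n D[of n]] unfolding hh[OF n] .
      then show "norm (norm (target_coeff a b n (kappa n) * complex_of_real (mono_r (expvec tau) (kappa n))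
                  / complex_of_real (Bval b (expvec tau) ^ n)
                  * complex_of_real (real n powr (real (card {j. expvec tau $ j < 1}) / 2))
              - (\<Sum>k<r. S.exp_coeff k (?\<delta> n) * complex_of_real (real n powr (- real k / 2))))) \<le> C * norm (real n powr (- real r / 2))"
        unfolding B0_def[symmetric] tilted_coeff by simp
    qed
  next
    fix n :: nat
    have "(\<Sum>\<^sub>\<infinity>m. \<alpha> m) = Aval a (expvec tau)"
      by (simp add: Aval_def \<alpha>_def e_def mono_r_expvec)
    then show "S.exp_coeff 0 (?\<delta> n) =
         Aval a (expvec tau) / complex_of_real (\<Prod>j\<in>{j. expvec tau $ j < 1}. 1 - expvec tau $ j)
         * complex_of_real (1 / sqrt ((2 * pi) ^ CARD('d) * det (hessian (Kfun b) tau)))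
         * complex_of_real
             (set_lebesgue_integral (PiM {j. expvec tau $ j = 1} (\<lambda>_. lborel))
                {u \<in> space (PiM {j. expvec tau $ j = 1} (\<lambda>_. lborel)).
                   \<forall>j\<in>{j. expvec tau $ j = 1}. u j > 0}
                (\<lambda>u. exp (- (\<Sum>i\<in>{j. expvec tau $ j = 1}. \<Sum>j\<in>{j. expvec tau $ j = 1}.
                         u i * matrix_inv (hessian (Kfun b) tau) $ i $ j * u j) / 2)))"
      using S.exp_coeff_0[of "?\<delta> n"] unfolding H \<zeta>_def by (simp only:)
  next
    fix r k n :: nat
    assume "{j. expvec tau $ j = 1} = {}" "odd k"
    then show "S.exp_coeff k (?\<delta> n) = 0"
      by (intro S.exp_coeff_odd) (simp_all add: \<zeta>_def)
  qed
qed

end
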